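(* Let $r>0$, $-\tilde\gamma<q<\gamma$, and let $\tau$ be given by $\frac1\tau=r+\frac12$. Then, for all $0<s<r$ and $0<\kappa\le\infty$, the approximation spaces of $H^q(\square)$ with respect to the tensor-product wavelets $\{\psi_{\boldsymbol\lambda}:\boldsymbol\lambda\in\boldsymbol\nabla\}$ are given by $$\mathfrak A^s_\kappa\bigl(H^q(\square)\bigr)=\bigl(H^q(\square),\ \mathfrak B^{q,r,\tau}_\tau(\square)\bigr)_{\frac sr,\kappa},$$ where the right-hand side is the real interpolation space defined by the $K$-functional.
   Context: Let $\square=[0,1]^n$. Univariate wavelets. Let $(V_j)_{j\ge j_0}$ be a nested sequence of finite-dimensional function spaces on $[0,1]$ (a multiresolution analysis) with asymptotically dense union, where $V_j$ has a uniformly $L^2$-stable Riesz basis of scaling functions $\{\phi_\lambda:\lambda\in\Delta_j\}$; indices are $\lambda=(j,k)$ with level $|\lambda|=j$ and location $k$. For $j>j_0$, $V_j=V_{j-1}\oplus W_j$, where $W_j$ has basis $\{\psi_\lambda:\lambda\in\nabla_j\}$ (wavelets). By convention $W_{j_0}=V_{j_0}$, $\nabla_{j_0}=\Delta_{j_0}$, $\psi_\lambda=\phi_\lambda$ for $\lambda\in\nabla_{j_0}$, and $\nabla=\bigcup_{j\ge j_0}\nabla_j$. There is a biorthogonal multiresolution analysis $(\tilde V_j)_{j\ge j_0}$ with dual wavelets $\tilde\psi_\lambda$, $\langle\tilde\psi_{\lambda'},\psi_\lambda\rangle=\delta_{\lambda,\lambda'}$; the primal and dual wavelets form Riesz bases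 of $L^2([0,1])$. The regularities are $\gamma=\sup\{t\in\mathbb R:V_j\subset H^t([0,1])\}$ and, analogously, $\tilde\gamma>0$ for $\tilde V_j$. Tensor-product wavelets. For $\boldsymbol j=(j_1,\dots,j_n)$ with all $j_i\ge j_0$ (written $\boldsymbol j\ge\boldsymbol j_0$) let $\boldsymbol\nabla_{\boldsymbol j}=\nabla_{j_1}\times\dots\times\nabla_{j_n}$, $\boldsymbol\nabla=\bigcup_{\boldsymbol j\ge\boldsymbol j_0}\boldsymbol\nabla_{\boldsymbol j}$, $\psi_{\boldsymbol\lambda}=\psi_{\lambda_1}\otimes\dots\otimes\psi_{\lambda_n}$, similarly $\tilde\psi_{\boldsymbol\lambda}$; $|\boldsymbol\lambda|_\infty=|\boldsymbol j|_\infty=\max_ij_i$ and $|\boldsymbol\lambda|_1=|\boldsymbol j|_1=\sum_ij_i$ for $\boldsymbol\lambda\in\boldsymbol\nabla_{\boldsymbol j}$. Sobolev spaces. $H^q(\square)$ is the Sobolev space of order $q$, understood with the boundary conditions imposed by the primal wavelet basis (spaces of negative order are understood as duals). The wavelets satisfy the known norm equivalence $$\|u\|_{H^t(\square)}^2\sim\sum_{\boldsymbol\lambda\in\boldsymbol\nabla}2^{2t|\boldsymbol\lambda|_\infty}|\langle\tilde\psi_{\boldsymbol\lambda},u\rangle|^2,\qquad -\tilde\gamma<t<\gamma .$$ Hybrid Besov spaces. For $0<p<\infty$ and $u=\sum_{\boldsymbol\lambda}u_{\boldsymbol\lambda}\psi_{\boldsymbol\lambda}$ with $u_{\boldsymbol\lambda}=\langle\tilde\psi_{\boldsymbol\lambda},u\rangle$,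 put $u^{(p)}_{\boldsymbol\lambda}=2^{|\boldsymbol\lambda|_1(\frac12-\frac1p)}u_{\boldsymbol\lambda}$. For $q\in\mathbb R$, $r>0$, $0<p,\tau<\infty$, $\mathfrak B^{q,r,p}_\tau(\square)$ is the space of all such $u$ with finite (quasi-)norm $$\|u\|_{\mathfrak B^{q,r,p}_\tau(\square)}=\Bigl[\sum_{\boldsymbol j\ge\boldsymbol j_0}2^{\tau(q|\boldsymbol j|_\infty+r|\boldsymbol j|_1)}\Bigl[\sum_{\boldsymbol\lambda\in\boldsymbol\nabla_{\boldsymbol j}}|u^{(p)}_{\boldsymbol\lambda}|^p\Bigr]^{\tau/p}\Bigr]^{1/\tau}.$$ Approximation spaces. Let $V_N=\{\sum_{\boldsymbol\lambda\in\Lambda}c_{\boldsymbol\lambda}\psi_{\boldsymbol\lambda}:c_{\boldsymbol\lambda}\in\mathbb C,\ \Lambda\subset\boldsymbol\nabla,\ |\Lambda|\le N\}$ and $E_N(u)=\inf_{v_N\in V_N}\|u-v_N\|_{H^q(\square)}$. Then $\mathfrak A^s_\kappa(H^q(\square))$ is the set of $u\in H^q(\square)$ with $|u|_{\mathfrak A^s_\kappa}<\infty$, where $|u|_{\mathfrak A^s_\kappa}=\bigl(\sum_{N>0}\frac1N[N^sE_N(u)]^\kappa\bigr)^{1/\kappa}$ for $\kappa<\infty$ and $|u|_{\mathfrak A^s_\infty}=\sup_{N\ge0}N^sE_N(u)$. Interpolation spaces. For $W$ continuously embedded in $V$ and $u\in V$, $t>0$, let $K(u,t)=\inf_{w\in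 W}\bigl(\|u-w\|_V+t\|w\|_W\bigr)$. For $\theta\in(0,1)$, $\kappa\in(0,\infty]$, $(V,W)_{\theta,\kappa}$ is the set of $u\in V$ such that $\bigl(\int_0^\infty[t^{-\theta}K(u,t)]^\kappa\frac{dt}{t}\bigr)^{1/\kappa}<\infty$ if $\kappa<\infty$, and $\sup_{t>0}t^{-\theta}K(u,t)<\infty$ if $\kappa=\infty$. *)

theory Defs
  imports "HOL-Analysis.Analysis"
begin

section \<open>Square-integrable functions on the unit cube\<close>

text \<open>Everything is stated over an arbitrary Euclidean space, so that the same notions serve for
  the interval \<open>[0,1]\<close> (type \<^typ>\<open>real\<close>) and for the cube \<open>[0,1]\<^sup>n\<close> (type \<open>real ^ 'n\<close>).
  Functions are total; only their values on the cube matter.\<close>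

definition cube :: "'a::euclidean_space measure" where
  "cube = restrict_space lborel (cbox 0 One)"

definition L2 :: "('a::euclidean_space \<Rightarrow> complex) set" where
  "L2 = {f \<in> borel_measurable cube. integrable cube (\<lambda>x. (norm (f x))\<^sup>2)}"

definition l2_norm :: "('a::euclidean_space \<Rightarrow> complex) \<Rightarrow> real" where
  "l2_norm f = sqrt (LINT x|cube. (norm (f x))\<^sup>2)"

text \<open>Antilinear in the first argument.\<close>

definition l2_inner :: "('a::euclidean_space \<Rightarrow> complex) \<Rightarrow> ('a \<Rightarrow> complex) \<Rightarrow> complex" where
  "l2_inner v f = (LINT x|cube. cnj (v x) * f x)"

definition lincomb :: "('i \<Rightarrow> 'a \<Rightarrow> complex) \<Rightarrow> 'i set \<Rightarrow> ('i \<Rightarrow> complex) \<Rightarrow> 'a \<Rightarrow> complex" where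
  "lincomb b F c = (\<lambda>x. \<Sum>i\<in>F. c i * b i x)"

definition fin_span :: "('i \<Rightarrow> 'a \<Rightarrow> complex) \<Rightarrow> 'i set \<Rightarrow> ('a \<Rightarrow> complex) set" where
  "fin_span b I = {lincomb b F c | F c. finite F \<and> F \<subseteq> I}"

text \<open>The span in \<open>L\<^sup>2\<close>, where functions that agree almost everywhere are identified.\<close>

definition L2_span ::
  "('i \<Rightarrow> 'a::euclidean_space \<Rightarrow> complex) \<Rightarrow> 'i set \<Rightarrow> ('a \<Rightarrow> complex) set" where
  "L2_span b I = {f \<in> L2. \<exists>g\<in>fin_span b I. AE x in cube. f x = g x}"

definition L2_dense :: "('a::euclidean_space \<Rightarrow> complex) set \<Rightarrow> bool" where
  "L2_dense S \<longleftrightarrow> (\<forall>f\<in>L2. \<forall>\<epsilon>>0. \<exists>g\<in>S. l2_norm (f - g) < \<epsilon>)"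

definition riesz_basis :: "('i \<Rightarrow> 'a::euclidean_space \<Rightarrow> complex) \<Rightarrow> 'i set \<Rightarrow> bool" where
  "riesz_basis b I \<longleftrightarrow>
     (\<forall>i\<in>I. b i \<in> L2) \<and> L2_dense (fin_span b I) \<and>
     (\<exists>c>0. \<exists>C>0. \<forall>F a. finite F \<and> F \<subseteq> I \<longrightarrow>
        c * (\<Sum>i\<in>F. (norm (a i))\<^sup>2) \<le> (l2_norm (lincomb b F a))\<^sup>2 \<and>
        (l2_norm (lincomb b F a))\<^sup>2 \<le> C * (\<Sum>i\<in>F. (norm (a i))\<^sup>2))"


section \<open>Sobolev spaces on the cube\<close>

text \<open>The Fourier transform (up to normalisation), used for integrable functions only.\<close>

definition fourier :: "('a::euclidean_space \<Rightarrow> complex) \<Rightarrow> 'a \<Rightarrow> complex" where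
  "fourier F \<xi> = (LINT x|lborel. cis (- (\<xi> \<bullet> x)) * F x)"

text \<open>The squared Bessel potential norm on the whole space. By Plancherel the first summand is
  dominated by the second for \<open>t \<ge> 0\<close>, so that this is the usual norm up to equivalence; for
  \<open>t \<le> 0\<close> the first summand dominates and one gets \<open>L\<^sup>2\<close>.\<close>

definition sobolev_norm2_whole :: "real \<Rightarrow> ('a::euclidean_space \<Rightarrow> complex) \<Rightarrow> ennreal" where
  "sobolev_norm2_whole t F =
     (\<integral>\<^sup>+ x. ennreal ((norm (F x))\<^sup>2) \<partial>lborel) +
     (\<integral>\<^sup>+ \<xi>. ennreal ((1 + (norm \<xi>)\<^sup>2) powr t * (norm (fourier F \<xi>))\<^sup>2) \<partial>lborel)"

text \<open>The Sobolev norm on the cube as the quotient norm of restriction: infimum over all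
  extensions. Extensions are taken with support in \<open>[-1,2]\<^sup>n\<close>, which makes them integrable if they
  are square integrable; since multiplication by a smooth cut-off function is bounded on the
  Sobolev space of the whole space, this changes the norm only up to equivalence.\<close>

definition extensions :: "('a::euclidean_space \<Rightarrow> complex) \<Rightarrow> ('a \<Rightarrow> complex) set" where
  "extensions f = {F \<in> borel_measurable borel.
     (\<forall>x. x \<notin> cbox (- One) (2 *\<^sub>R One) \<longrightarrow> F x = 0) \<and> (AE x in cube. F x = f x)}"

definition sobolev_norm2 :: "real \<Rightarrow> ('a::euclidean_space \<Rightarrow> complex) \<Rightarrow> ennreal" where
  "sobolev_norm2 t f = (INF F\<in>extensions f. sobolev_norm2_whole t F)"

definition sobolev_norm :: "real \<Rightarrow> ('a::euclidean_space \<Rightarrow> complex) \<Rightarrow> real" where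
  "sobolev_norm t f = sqrt (enn2real (sobolev_norm2 t f))"

text \<open>\<open>H\<^sup>t\<close> without boundary conditions, for \<open>t \<ge> 0\<close>. (For \<open>t \<le> 0\<close> this is all of \<open>L\<^sup>2\<close>,
  that is, the set of those functions in \<open>L\<^sup>2\<close> that belong to \<open>H\<^sup>t\<close>.)\<close>

definition sobolev :: "real \<Rightarrow> ('a::euclidean_space \<Rightarrow> complex) set" where
  "sobolev t = {f \<in> L2. sobolev_norm2 t f < \<infinity>}"

text \<open>Closure in \<open>H\<^sup>t\<close>, \<open>t \<ge> 0\<close>, of a set of functions.\<close>

definition sobolev_closure ::
  "real \<Rightarrow> ('a::euclidean_space \<Rightarrow> complex) set \<Rightarrow> ('a \<Rightarrow> complex) set" where
  "sobolev_closure t S =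
     {f \<in> sobolev t. \<forall>\<epsilon>>0. \<exists>g\<in>S. f - g \<in> sobolev t \<and> sobolev_norm t (f - g) < \<epsilon>}"


section \<open>Univariate wavelets\<close>

text \<open>Indices are pairs of a level and a location. \<open>\<phi>\<close> are the scaling functions with index sets
  \<open>\<Delta> j\<close>, and \<open>\<psi>\<close> the wavelets with index sets \<open>\<Lambda> j\<close> (usually written \<open>\<nabla>\<^sub>j\<close>). \<open>V\<^sub>j\<close> is
  \<open>L2_span \<phi> (\<Delta> j)\<close> and \<open>W\<^sub>j\<close> is \<open>L2_span \<psi> (\<Lambda> j)\<close>; linear independence of the bases is part of
  the norm estimates. Primes denote the dual objects.\<close>

definition wavelet_mra ::
  "int \<Rightarrow> (int \<Rightarrow> (int \<times> 'k) set) \<Rightarrow> (int \<Rightarrow> (int \<times> 'k) set) \<Rightarrow>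
   (int \<times> 'k \<Rightarrow> real \<Rightarrow> complex) \<Rightarrow> (int \<times> 'k \<Rightarrow> real \<Rightarrow> complex) \<Rightarrow> bool" where
  "wavelet_mra j\<^sub>0 \<Delta> \<Lambda> \<phi> \<psi> \<longleftrightarrow>
     (\<forall>j\<ge>j\<^sub>0. finite (\<Delta> j) \<and> \<Delta> j \<subseteq> {j} \<times> UNIV \<and> (\<forall>l\<in>\<Delta> j. \<phi> l \<in> L2)) \<and>
     (\<forall>j\<ge>j\<^sub>0. finite (\<Lambda> j) \<and> \<Lambda> j \<subseteq> {j} \<times> UNIV \<and> (\<forall>l\<in>\<Lambda> j. \<psi> l \<in> L2)) \<and>
     \<Lambda> j\<^sub>0 = \<Delta> j\<^sub>0 \<and> (\<forall>l\<in>\<Lambda> j\<^sub>0. \<psi> l = \<phi> l) \<and>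
     (\<forall>j\<ge>j\<^sub>0. L2_span \<phi> (\<Delta> j) \<subseteq> L2_span \<phi> (\<Delta> (j + 1))) \<and>
     L2_dense (\<Union>j\<in>{j\<^sub>0..}. L2_span \<phi> (\<Delta> j)) \<and>
     (\<exists>c>0. \<exists>C>0. \<forall>j\<ge>j\<^sub>0. \<forall>a.
        c * (\<Sum>l\<in>\<Delta> j. (norm (a l))\<^sup>2) \<le> (l2_norm (lincomb \<phi> (\<Delta> j) a))\<^sup>2 \<and>
        (l2_norm (lincomb \<phi> (\<Delta> j) a))\<^sup>2 \<le> C * (\<Sum>l\<in>\<Delta> j. (norm (a l))\<^sup>2)) \<and>
     (\<forall>j>j\<^sub>0.
        L2_span \<phi> (\<Delta> j) =
          {\<lambda>x. f x + g x | f g. f \<in> L2_span \<phi> (\<Delta> (j - 1)) \<and> g \<in> L2_span \<psi> (\<Lambda> j)} \<and>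
        (\<forall>f \<in> L2_span \<phi> (\<Delta> (j - 1)) \<inter> L2_span \<psi> (\<Lambda> j). AE x in cube. f x = 0)) \<and>
     riesz_basis \<psi> (\<Union>j\<in>{j\<^sub>0..}. \<Lambda> j)"

definition biorthogonal_wavelets ::
  "int \<Rightarrow> (int \<Rightarrow> (int \<times> 'k) set) \<Rightarrow> (int \<Rightarrow> (int \<times> 'k) set) \<Rightarrow>
   (int \<times> 'k \<Rightarrow> real \<Rightarrow> complex) \<Rightarrow> (int \<times> 'k \<Rightarrow> real \<Rightarrow> complex) \<Rightarrow>
   (int \<times> 'k \<Rightarrow> real \<Rightarrow> complex) \<Rightarrow> (int \<times> 'k \<Rightarrow> real \<Rightarrow> complex) \<Rightarrow> bool" where
  "biorthogonal_wavelets j\<^sub>0 \<Delta> \<Lambda> \<phi> \<psi> \<phi>' \<psi>' \<longleftrightarrow>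
     wavelet_mra j\<^sub>0 \<Delta> \<Lambda> \<phi> \<psi> \<and> wavelet_mra j\<^sub>0 \<Delta> \<Lambda> \<phi>' \<psi>' \<and>
     (\<forall>l \<in> (\<Union>j\<in>{j\<^sub>0..}. \<Lambda> j). \<forall>l' \<in> (\<Union>j\<in>{j\<^sub>0..}. \<Lambda> j).
        l2_inner (\<psi>' l') (\<psi> l) = (if l' = l then 1 else 0))"

definition regularity ::
  "int \<Rightarrow> (int \<Rightarrow> (int \<times> 'k) set) \<Rightarrow> (int \<times> 'k \<Rightarrow> real \<Rightarrow> complex) \<Rightarrow> ereal" where
  "regularity j\<^sub>0 \<Delta> \<phi> = Sup {ereal t | t. \<forall>j\<ge>j\<^sub>0. L2_span \<phi> (\<Delta> j) \<subseteq> sobolev t}"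


section \<open>Tensor-product wavelets\<close>

definition levels :: "int \<Rightarrow> ('n::finite \<Rightarrow> int) set" where
  "levels j\<^sub>0 = {j. \<forall>i. j\<^sub>0 \<le> j i}"

definition tensor_idx_at ::
  "(int \<Rightarrow> (int \<times> 'k) set) \<Rightarrow> ('n::finite \<Rightarrow> int) \<Rightarrow> ('n \<Rightarrow> int \<times> 'k) set" where
  "tensor_idx_at \<Lambda> j = {l. \<forall>i. l i \<in> \<Lambda> (j i)}"

definition tensor_idx ::
  "int \<Rightarrow> (int \<Rightarrow> (int \<times> 'k) set) \<Rightarrow> ('n::finite \<Rightarrow> int \<times> 'k) set" where
  "tensor_idx j\<^sub>0 \<Lambda> = (\<Union>j\<in>levels j\<^sub>0. tensor_idx_at \<Lambda> j)"

definition tensor ::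
  "(int \<times> 'k \<Rightarrow> real \<Rightarrow> complex) \<Rightarrow> ('n::finite \<Rightarrow> int \<times> 'k) \<Rightarrow> real ^ 'n \<Rightarrow> complex" where
  "tensor \<psi> l x = (\<Prod>i\<in>UNIV. \<psi> (l i) (x $ i))"

definition level :: "('n \<Rightarrow> int \<times> 'k) \<Rightarrow> 'n \<Rightarrow> int" where
  "level l = (\<lambda>i. fst (l i))"

definition abs_inf :: "('n::finite \<Rightarrow> int) \<Rightarrow> real" where
  "abs_inf j = of_int (Max (range j))"

definition abs_1 :: "('n::finite \<Rightarrow> int) \<Rightarrow> real" where
  "abs_1 j = of_int (\<Sum>i\<in>UNIV. j i)"


section \<open>Sobolev spaces with boundary conditions, of positive or negative order\<close>

text \<open>Spaces of positive order consist of functions, those of negative order of functionals. To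
  have one ambient space for all of them, an object \<open>u\<close> is represented by the antilinear functional
  \<open>v \<mapsto> \<langle>v, u\<rangle>\<close> on the test space spanned by the dual tensor-product wavelets \<open>P'\<close> with indices
  in \<open>I\<close>. Functionals are set to \<open>0\<close> outside the test space so that they are determined by their
  values on it.\<close>

type_synonym 'a functional = "('a \<Rightarrow> complex) \<Rightarrow> complex"

definition functionals ::
  "('i \<Rightarrow> 'a::euclidean_space \<Rightarrow> complex) \<Rightarrow> 'i set \<Rightarrow> 'a functional set" where
  "functionals P' I = {u. (\<forall>v. v \<notin> fin_span P' I \<longrightarrow> u v = 0) \<and>
     (\<forall>v\<in>fin_span P' I. \<forall>w\<in>fin_span P' I. \<forall>a b.
        u (\<lambda>x. a * v x + b * w x) = cnj a * u v + cnj b * u w)}"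

definition of_fun ::
  "('i \<Rightarrow> 'a::euclidean_space \<Rightarrow> complex) \<Rightarrow> 'i set \<Rightarrow> ('a \<Rightarrow> complex) \<Rightarrow> 'a functional" where
  "of_fun P' I f = (\<lambda>v. if v \<in> fin_span P' I then l2_inner v f else 0)"

text \<open>For \<open>t \<ge> 0\<close> the boundary conditions imposed by the primal wavelets \<open>P\<close> are encoded by
  taking the closure of their span in \<open>H\<^sup>t\<close>. For \<open>t < 0\<close> the space is the dual of the closure of the
  span of the dual wavelets \<open>P'\<close> in \<open>H\<^sup>-\<^sup>t\<close>, that is, the space of bounded antilinear functionals on
  that span.\<close>

definition H_space ::
  "('i \<Rightarrow> 'a::euclidean_space \<Rightarrow> complex) \<Rightarrow> ('i \<Rightarrow> 'a \<Rightarrow> complex) \<Rightarrow> 'i set \<Rightarrow> real \<Rightarrow>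
   'a functional set" where
  "H_space P P' I t =
     (if t \<ge> 0 then of_fun P' I ` sobolev_closure t (fin_span P I)
      else {u \<in> functionals P' I.
              \<exists>C. \<forall>v\<in>fin_span P' I. norm (u v) \<le> C * sobolev_norm (- t) v})"

text \<open>For \<open>t \<ge> 0\<close>, if the dual wavelets are complete in \<open>L\<^sup>2\<close>, the function representing \<open>u\<close> is
  unique almost everywhere, and the infimum is over a single value.\<close>

definition H_norm ::
  "('i \<Rightarrow> 'a::euclidean_space \<Rightarrow> complex) \<Rightarrow> ('i \<Rightarrow> 'a \<Rightarrow> complex) \<Rightarrow> 'i set \<Rightarrow> real \<Rightarrow>
   'a functional \<Rightarrow> real" where
  "H_norm P P' I t u =
     (if t \<ge> 0
      then Inf {sobolev_norm t f | f. f \<in> sobolev_closure t (fin_span P I) \<and> of_fun P' I f = u}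
      else Inf {C. C \<ge> 0 \<and> (\<forall>v\<in>fin_span P' I. norm (u v) \<le> C * sobolev_norm (- t) v)})"

text \<open>The wavelet norm equivalence at order \<open>t\<close>; \<open>u (P' l)\<close> is the coefficient \<open>\<langle>P' l, u\<rangle>\<close>.\<close>

definition norm_equivalence ::
  "(('n::finite \<Rightarrow> int \<times> 'k) \<Rightarrow> real ^ 'n \<Rightarrow> complex) \<Rightarrow>
   (('n \<Rightarrow> int \<times> 'k) \<Rightarrow> real ^ 'n \<Rightarrow> complex) \<Rightarrow> ('n \<Rightarrow> int \<times> 'k) set \<Rightarrow> real \<Rightarrow> bool" where
  "norm_equivalence P P' I t \<longleftrightarrow>
     (\<exists>c>0. \<exists>C>0. \<forall>u\<in>H_space P P' I t.
        (\<lambda>l. 2 powr (2 * t * abs_inf (level l)) * (norm (u (P' l)))\<^sup>2) summable_on I \<and>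
        c * (\<Sum>\<^sub>\<infinity>l\<in>I. 2 powr (2 * t * abs_inf (level l)) * (norm (u (P' l)))\<^sup>2)
          \<le> (H_norm P P' I t u)\<^sup>2 \<and>
        (H_norm P P' I t u)\<^sup>2
          \<le> C * (\<Sum>\<^sub>\<infinity>l\<in>I. 2 powr (2 * t * abs_inf (level l)) * (norm (u (P' l)))\<^sup>2))"


section \<open>Hybrid Besov spaces\<close>

definition besov_term ::
  "(int \<Rightarrow> (int \<times> 'k) set) \<Rightarrow> (('n::finite \<Rightarrow> int \<times> 'k) \<Rightarrow> real ^ 'n \<Rightarrow> complex) \<Rightarrow>
   real \<Rightarrow> real \<Rightarrow> real \<Rightarrow> real \<Rightarrow> (real ^ 'n) functional \<Rightarrow> ('n \<Rightarrow> int) \<Rightarrow> real" where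
  "besov_term \<Lambda> P' q r p \<tau> u j =
     2 powr (\<tau> * (q * abs_inf j + r * abs_1 j)) *
     (\<Sum>l\<in>tensor_idx_at \<Lambda> j.
        (2 powr (abs_1 (level l) * (1/2 - 1/p)) * norm (u (P' l))) powr p) powr (\<tau> / p)"

text \<open>Every functional is the (weakly convergent) series of its wavelet expansion, so no
  convergence is required beyond finiteness of the quasi-norm.\<close>

definition besov_space ::
  "int \<Rightarrow> (int \<Rightarrow> (int \<times> 'k) set) \<Rightarrow> (('n::finite \<Rightarrow> int \<times> 'k) \<Rightarrow> real ^ 'n \<Rightarrow> complex) \<Rightarrow>
   real \<Rightarrow> real \<Rightarrow> real \<Rightarrow> real \<Rightarrow> (real ^ 'n) functional set" where
  "besov_space j\<^sub>0 \<Lambda> P' q r p \<tau> =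
     {u \<in> functionals P' (tensor_idx j\<^sub>0 \<Lambda>). besov_term \<Lambda> P' q r p \<tau> u summable_on levels j\<^sub>0}"

definition besov_norm ::
  "int \<Rightarrow> (int \<Rightarrow> (int \<times> 'k) set) \<Rightarrow> (('n::finite \<Rightarrow> int \<times> 'k) \<Rightarrow> real ^ 'n \<Rightarrow> complex) \<Rightarrow>
   real \<Rightarrow> real \<Rightarrow> real \<Rightarrow> real \<Rightarrow> (real ^ 'n) functional \<Rightarrow> real" where
  "besov_norm j\<^sub>0 \<Lambda> P' q r p \<tau> u =
     (\<Sum>\<^sub>\<infinity>j\<in>levels j\<^sub>0. besov_term \<Lambda> P' q r p \<tau> u j) powr (1 / \<tau>)"


section \<open>Approximation spaces and real interpolation\<close>

definition n_term ::
  "('i \<Rightarrow> 'a::euclidean_space \<Rightarrow> complex) \<Rightarrow> ('i \<Rightarrow> 'a \<Rightarrow> complex) \<Rightarrow> 'i set \<Rightarrow> nat \<Rightarrow>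
   'a functional set" where
  "n_term P P' I N =
     {of_fun P' I (lincomb P F c) | F c. finite F \<and> F \<subseteq> I \<and> card F \<le> N}"

definition approx_error ::
  "('v::minus \<Rightarrow> real) \<Rightarrow> (nat \<Rightarrow> 'v set) \<Rightarrow> nat \<Rightarrow> 'v \<Rightarrow> real" where
  "approx_error nV A N u = (INF v\<in>A N. nV (u - v))"

definition approx_space ::
  "'v::minus set \<Rightarrow> ('v \<Rightarrow> real) \<Rightarrow> (nat \<Rightarrow> 'v set) \<Rightarrow> real \<Rightarrow> ereal \<Rightarrow> 'v set" where
  "approx_space V nV A s \<kappa> =
     {u \<in> V.
       if \<kappa> = \<infinity> then bdd_above (range (\<lambda>N. real N powr s * approx_error nV A N u))
       else summable (\<lambda>N. 1 / real (Suc N) *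
              (real (Suc N) powr s * approx_error nV A (Suc N) u) powr real_of_ereal \<kappa>)}"

definition K_functional ::
  "('v::minus \<Rightarrow> real) \<Rightarrow> 'v set \<Rightarrow> ('v \<Rightarrow> real) \<Rightarrow> 'v \<Rightarrow> real \<Rightarrow> real" where
  "K_functional nV W nW u t = (INF w\<in>W. nV (u - w) + t * nW w)"

definition interp_space ::
  "'v::minus set \<Rightarrow> ('v \<Rightarrow> real) \<Rightarrow> 'v set \<Rightarrow> ('v \<Rightarrow> real) \<Rightarrow> real \<Rightarrow> ereal \<Rightarrow> 'v set" where
  "interp_space V nV W nW \<theta> \<kappa> =
     {u \<in> V.
       if \<kappa> = \<infinity> then bdd_above ((\<lambda>t. t powr (- \<theta>) * K_functional nV W nW u t) ` {0<..})
       else (\<integral>\<^sup>+ t\<in>{0<..}. ennreal ((t powr (- \<theta>) * K_functional nV W nW u t)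
               powr real_of_ereal \<kappa> / t) \<partial>lborel) < \<infinity>}"

end

theory Submission
  imports Defs
begin

text \<open>The coefficient map turns the statement into one about sequences. To \<open>u\<close> belongs the sequence
  \<open>a\<^sub>l = 2 powr (q |l|\<^sub>\<infinity>) \<langle>\<psi>'\<^sub>l, u\<rangle>\<close>. By the norm equivalence the norm of \<open>H\<^sup>q\<close> is equivalent to the
  \<open>\<ell>\<^sup>2\<close> norm of \<open>a\<close>. In the Besov norm with both summability indices equal to \<open>\<tau>\<close>, the
  normalisation of the coefficients contributes \<open>2 powr (- \<tau> r |l|\<^sub>1)\<close> because \<open>1/2 - 1/\<tau> = - r\<close>; this
  cancels the weight \<open>2 powr (\<tau> r |l|\<^sub>1)\<close>, and what remains is exactly the \<open>\<ell>\<^sup>\<tau>\<close> norm of \<open>a\<close>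
  (\<open>besov_term_eq\<close>). Thus all dependence on the levels disappears, and the claim becomes the classical
  one that \<open>N\<close>-term approximation in \<open>\<ell>\<^sup>2\<close> is governed by interpolation between \<open>\<ell>\<^sup>2\<close> and \<open>\<ell>\<^sup>\<tau>\<close>.

  That claim rests on two inequalities. Jackson: an \<open>\<ell>\<^sup>\<tau>\<close> sequence is approximated in \<open>\<ell>\<^sup>2\<close> by \<open>N\<close>
  of its entries up to \<open>N\<^sup>-\<^sup>r\<close> times its \<open>\<ell>\<^sup>\<tau>\<close> norm (\<open>threshold_set\<close>). Bernstein: a sequence with \<open>N\<close>
  entries has \<open>\<ell>\<^sup>\<tau>\<close> norm at most \<open>N\<^sup>r\<close> times its \<open>\<ell>\<^sup>2\<close> norm (\<open>power_sum_le\<close>). Both spaces in the theorem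
  are described by the values of \<open>E\<^sub>N\<close> at \<open>N = 2\<^sup>m\<close> and of \<open>K\<close> at \<open>t = 2 powr (- m r)\<close>
  (\<open>approx_space_dyadic\<close>, \<open>interp_space_dyadic\<close>). Jackson's inequality bounds \<open>E\<close> by \<open>K\<close> term by term.
  Conversely, nearly best index sets of size \<open>2\<^sup>k\<close> for all \<open>k \<le> m\<close> are united; the restriction of \<open>a\<close>
  to the union is a competitor in \<open>K\<close>, and its \<open>\<ell>\<^sup>\<tau>\<close> norm is estimated blockwise by Bernstein's
  inequality. The resulting sum over \<open>k\<close> is controlled by a discrete Hardy inequality, which is where
  \<open>s < r\<close> enters (\<open>K_dyadic_of_E_dyadic\<close>, \<open>in_ell_recursion\<close>).

  To transfer this to function spaces one must know that the objects involved lie in \<open>H\<^sup>q\<close>. Finite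
  combinations of tensor wavelets do, since the univariate wavelets are regular enough and
  \<open>1 + |\<xi>|\<^sup>2 \<le> \<Prod>\<^sub>i (1 + \<xi>\<^sub>i\<^sup>2)\<close> (\<open>sobolev_tensor\<close>). The decisive point is the inclusion of the Besov space
  in \<open>H\<^sup>q\<close>: a functional whose weighted coefficients are square summable must be an element of \<open>H\<^sup>q\<close>
  (\<open>in_H\<close>). For \<open>q < 0\<close> the finite sections give uniform bounds on the functional. For \<open>q \<ge> 0\<close> a function
  has to be produced, and this requires the completeness of Sobolev spaces on the cube, obtained by summing
  extensions of the increments (\<open>sobolev_complete\<close>).\<close>

section \<open>A discrete Hardy inequality\<close>

text \<open>Finite and infinite \<open>\<kappa>\<close> share this predicate, so that the comparison principles below cover
  summability and boundedness at once.\<close>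

definition in_ell :: "ereal \<Rightarrow> (nat \<Rightarrow> real) \<Rightarrow> bool" where
  "in_ell \<kappa> x = (if \<kappa> = \<infinity> then bdd_above (range x)
     else summable (\<lambda>m. x m powr real_of_ereal \<kappa>))"

lemma in_ell_cases:
  assumes "0 < (\<kappa>::ereal)"
  obtains "\<kappa> = \<infinity>" | k where "\<kappa> = ereal k" "0 < k"
  using assms by (cases \<kappa>) auto

lemma in_ell_mono:
  assumes "0 < \<kappa>" "in_ell \<kappa> y" "\<And>m. 0 \<le> x m" "\<And>m. x m \<le> C * y m" "0 \<le> C" "\<And>m. 0 \<le> y m"
  shows "in_ell \<kappa> x"
proof (rule in_ell_cases[OF assms(1)])
  assume k: "\<kappa> = \<infinity>"
  then obtain B where B: "\<And>m. y m \<le> B" using assms(2) by (auto simp: in_ell_def bdd_above_def)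
  have "x m \<le> C * B" for m using assms(4)[of m] mult_left_mono[OF B[of m] assms(5)] by simp
  then show ?thesis using k by (auto simp: in_ell_def bdd_above_def)
next
  fix k assume k: "\<kappa> = ereal k" "0 < k"
  have "summable (\<lambda>m. C powr k * y m powr k)" using assms(2) k by (auto simp: in_ell_def)
  then have "summable (\<lambda>m. x m powr k)"
  proof (rule summable_comparison_test_ev[rotated], intro always_eventually allI)
    fix m
    have "x m powr k \<le> (C * y m) powr k" using assms k by (intro powr_mono2) auto
    then show "norm (x m powr k) \<le> C powr k * y m powr k" using assms by (simp add: powr_mult)
  qed
  then show ?thesis using k by (auto simp: in_ell_def)
qed

lemma in_ell_add:
  assumes "0 < \<kappa>" "in_ell \<kappa> x" "in_ell \<kappa> y" "\<And>m. 0 \<le> x m" "\<And>m. 0 \<le> y m"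
  shows "in_ell \<kappa> (\<lambda>m. x m + y m)"
proof (rule in_ell_cases[OF assms(1)])
  assume k: "\<kappa> = \<infinity>"
  then obtain B B' where B: "\<And>m. x m \<le> B" "\<And>m. y m \<le> B'"
    using assms(2,3) by (auto simp: in_ell_def bdd_above_def)
  have "x m + y m \<le> B + B'" for m using B[of m] by simp
  then show ?thesis using k by (auto simp: in_ell_def bdd_above_def)
next
  fix k assume k: "\<kappa> = ereal k" "0 < k"
  have "summable (\<lambda>m. 2 powr k * (x m powr k + y m powr k))"
    using assms k by (auto simp: in_ell_def intro!: summable_mult summable_add)
  then have "summable (\<lambda>m. (x m + y m) powr k)"
  proof (rule summable_comparison_test_ev[rotated], intro always_eventually allI)
    fix m
    have "(x m + y m) powr k \<le> (2 * max (x m) (y m)) powr k"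
      using assms(4,5)[of m] k by (intro powr_mono2) auto
    also have "\<dots> = 2 powr k * max (x m) (y m) powr k"
      using assms(4,5)[of m] by (simp add: powr_mult)
    also have "\<dots> \<le> 2 powr k * (x m powr k + y m powr k)"
      by (intro mult_left_mono) (auto simp: max_def)
    finally show "norm ((x m + y m) powr k) \<le> 2 powr k * (x m powr k + y m powr k)" by simp
  qed
  then show ?thesis using k by (auto simp: in_ell_def)
qed

lemma in_ell_geometric:
  assumes "0 < \<kappa>" "d < 0"
  shows "in_ell \<kappa> (\<lambda>m. 2 powr (real m * d))"
proof (rule in_ell_cases[OF assms(1)])
  assume k: "\<kappa> = \<infinity>"
  have "2 powr (real m * d) \<le> 1" for m
    using assms using powr_mono[of "real m * d" 0 2] by (simp add: mult_nonneg_nonpos)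
  then show ?thesis using k by (auto simp: in_ell_def bdd_above_def)
next
  fix k assume k: "\<kappa> = ereal k" "0 < k"
  have "(2 powr (real m * d)) powr k = (2 powr (d * k)) ^ m" for m
    by (simp add: powr_powr powr_realpow[symmetric] mult_ac)
  moreover have "(2::real) powr (d * k) < 1" using assms k powr_less_mono[of "d * k" 0 2] by (simp add: mult_neg_pos)
  ultimately show ?thesis using k by (auto simp: in_ell_def intro!: summable_geometric)
qed

text \<open>Unrolling the recursion, \<open>z\<close> is a geometrically weighted sum of \<open>x\<close>, so that this is a discrete
  Hardy inequality. In the form of a recursion it can be proved for all exponents \<open>\<kappa> / \<tau>\<close>, below and
  above \<open>1\<close>, by the same argument: if \<open>x m\<close> is at most a small multiple of \<open>z m\<close>, the step still
  contracts; otherwise \<open>z (m + 1)\<close> is bounded by a multiple of \<open>x m\<close>.\<close>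

lemma in_ell_recursion:
  fixes x z :: "nat \<Rightarrow> real"
  assumes \<kappa>: "0 < \<kappa>" and x: "in_ell \<kappa> (\<lambda>m. x m powr (1 / \<tau>))" and \<tau>: "0 < \<tau>"
    and \<rho>: "0 \<le> \<rho>" "\<rho> < 1" and z0: "\<And>m. 0 \<le> z m" and x0: "\<And>m. 0 \<le> x m"
    and step: "\<And>m. z (Suc m) \<le> \<rho> * z m + x m"
  shows "in_ell \<kappa> (\<lambda>m. z m powr (1 / \<tau>))"
proof (rule in_ell_cases[OF \<kappa>])
  assume k: "\<kappa> = \<infinity>"
  then obtain B where "\<And>m. x m powr (1 / \<tau>) \<le> B" using x by (auto simp: in_ell_def bdd_above_def)
  then have "(x m powr (1 / \<tau>)) powr \<tau> \<le> B powr \<tau>" for m using \<tau> by (intro powr_mono2) auto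
  then have B: "x m \<le> B powr \<tau>" for m using x0 \<tau> by (simp add: powr_powr abs_of_nonneg)
  define D where "D = max (z 0) (B powr \<tau> / (1 - \<rho>))"
  have "z m \<le> D" for m
  proof (induction m)
    case (Suc m)
    have "B powr \<tau> / (1 - \<rho>) \<le> D" by (simp add: D_def)
    then have "B powr \<tau> \<le> (1 - \<rho>) * D" using \<rho> by (simp add: pos_divide_le_eq mult.commute)
    then have "\<rho> * D + B powr \<tau> \<le> D" by (simp add: algebra_simps)
    then show ?case using step[of m] mult_left_mono[OF Suc \<rho>(1)] B[of m] by linarith
  qed (simp add: D_def)
  then have "z m powr (1 / \<tau>) \<le> D powr (1 / \<tau>)" for m using \<tau> z0 by (intro powr_mono2) auto
  then show ?thesis using k by (auto simp: in_ell_def bdd_above_def)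
next
  fix k assume k: "\<kappa> = ereal k" "0 < k"
  define \<beta> where "\<beta> = k / \<tau>"
  have \<beta>: "0 < \<beta>" using k \<tau> by (simp add: \<beta>_def)
  have sx: "summable (\<lambda>m. x m powr \<beta>)" using x k \<tau> by (simp add: in_ell_def powr_powr \<beta>_def)
  define \<eta> where "\<eta> = (1 - \<rho>) / 2"
  have \<eta>: "0 < \<eta>" "0 < \<rho> + \<eta>" "\<rho> + \<eta> < 1" using \<rho> by (auto simp: \<eta>_def field_simps)
  define a where "a = (\<rho> + \<eta>) powr \<beta>"
  define D where "D = (\<rho> / \<eta> + 1) powr \<beta>"
  have a: "0 \<le> a" "a < 1" using powr_less_mono2[OF \<beta>, of "\<rho> + \<eta>" 1] \<eta> by (auto simp: a_def)
  have rec: "z (Suc m) powr \<beta> \<le> a * z m powr \<beta> + D * x m powr \<beta>" for m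
  proof (cases "x m \<le> \<eta> * z m")
    case True
    then have "z (Suc m) \<le> (\<rho> + \<eta>) * z m" using step[of m] by (simp add: algebra_simps)
    then have "z (Suc m) powr \<beta> \<le> ((\<rho> + \<eta>) * z m) powr \<beta>" using \<beta> z0 by (intro powr_mono2) auto
    also have "\<dots> = a * z m powr \<beta>" using \<eta> z0[of m] by (simp add: powr_mult a_def)
    also have "\<dots> \<le> a * z m powr \<beta> + D * x m powr \<beta>" by (simp add: D_def)
    finally show ?thesis .
  next
    case False
    then have "z m \<le> x m / \<eta>" using \<eta> by (simp add: field_simps)
    then have "\<rho> * z m \<le> \<rho> * (x m / \<eta>)" by (intro mult_left_mono \<rho>)
    then have "z (Suc m) \<le> (\<rho> / \<eta> + 1) * x m" using step[of m] by (simp add: algebra_simps)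
    then have "z (Suc m) powr \<beta> \<le> ((\<rho> / \<eta> + 1) * x m) powr \<beta>" using \<beta> z0 by (intro powr_mono2) auto
    also have "\<dots> = D * x m powr \<beta>" using \<eta> \<rho> x0[of m] by (simp add: powr_mult D_def)
    also have "\<dots> \<le> a * z m powr \<beta> + D * x m powr \<beta>" using a by simp
    finally show ?thesis .
  qed
  have bound: "(\<Sum>m<M. z m powr \<beta>) \<le> (z 0 powr \<beta> + D * (\<Sum>m. x m powr \<beta>)) / (1 - a)" for M
  proof -
    have "(\<Sum>m<M. z m powr \<beta>) \<le> (\<Sum>m<Suc M. z m powr \<beta>)" by simp
    also have "\<dots> = z 0 powr \<beta> + (\<Sum>m<M. z (Suc m) powr \<beta>)" by (rule sum.lessThan_Suc_shift)
    also have "\<dots> \<le> z 0 powr \<beta> + (\<Sum>m<M. a * z m powr \<beta> + D * x m powr \<beta>)"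
      by (intro add_left_mono sum_mono rec)
    also have "\<dots> = z 0 powr \<beta> + a * (\<Sum>m<M. z m powr \<beta>) + D * (\<Sum>m<M. x m powr \<beta>)"
      by (simp add: sum.distrib sum_distrib_left)
    also have "\<dots> \<le> z 0 powr \<beta> + a * (\<Sum>m<M. z m powr \<beta>) + D * (\<Sum>m. x m powr \<beta>)"
      by (intro add_left_mono mult_left_mono sum_le_suminf sx) (auto simp: D_def)
    finally show ?thesis using a by (simp add: field_simps)
  qed
  have "summable (\<lambda>m. z m powr \<beta>)" by (rule summableI_nonneg_bounded[OF _ bound]) simp
  then show ?thesis using k \<tau> by (simp add: in_ell_def powr_powr \<beta>_def)
qed

section \<open>Dyadic descriptions of approximation and interpolation spaces\<close>

lemma dyadic_nat:
  assumes "1 \<le> (n::nat)" obtains m where "2 ^ m \<le> n" "n < 2 ^ Suc m"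
  using ex_power_ivl1[of 2 n] assms by auto

lemma two_powr_nat: "real (2 ^ m) powr s = 2 powr (real m * s)"
  by (simp add: powr_realpow[symmetric] powr_powr)

lemma sum_dyadic_blocks:
  "(\<Sum>n\<in>{1..<2 ^ M::nat}. g n) = (\<Sum>m<M. \<Sum>n\<in>{2 ^ m..<2 ^ Suc m}. (g n :: real))"
proof (induction M)
  case (Suc M)
  have "(\<Sum>n\<in>{1..<2 ^ Suc M}. g n) = (\<Sum>n\<in>{1..<2 ^ M}. g n) + (\<Sum>n\<in>{2 ^ M..<2 ^ Suc M}. g n)"
    by (rule sum.atLeastLessThan_concat[symmetric]) auto
  then show ?case using Suc by simp
qed simp

text \<open>For \<open>2\<^sup>m \<le> n < 2\<^sup>m\<^sup>+\<^sup>1\<close> the factor \<open>n powr s\<close> agrees with \<open>2 powr (m s)\<close> up to a constant, and the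
  weights \<open>1 / n\<close> add up to a number between \<open>1/2\<close> and \<open>1\<close>. Since \<open>E\<close> decreases, each block of the
  series is at least a multiple of the dyadic term at its right end, which is why the index is
  shifted by one.\<close>

lemma dyadic_of_approx:
  fixes E :: "nat \<Rightarrow> real"
  assumes E0: "\<And>N. 0 \<le> E N" and dec: "\<And>M N. M \<le> N \<Longrightarrow> E N \<le> E M" and s: "0 < s" and k: "0 < k"
    and sm: "summable (\<lambda>N. 1 / real (Suc N) * (real (Suc N) powr s * E (Suc N)) powr k)"
  shows "summable (\<lambda>m. (2 powr (real m * s) * E (2 ^ m)) powr k)"
proof -
  define g where "g n = 1 / real n * (real n powr s * E n) powr k" for n
  have g0: "0 \<le> g n" for n by (simp add: g_def)
  have sg: "summable g" using sm summable_Suc_iff[of g] by (simp add: g_def)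
  define x where "x m = 2 powr (real m * s) * E (2 ^ m)" for m
  have "summable (\<lambda>m. x (Suc m) powr k)"
  proof (rule summableI_nonneg_bounded)
    fix M
    have blk: "x (Suc m) powr k \<le> 2 * 2 powr (s * k) * (\<Sum>n\<in>{2 ^ m..<2 ^ Suc m}. g n)" for m
    proof -
      have "(1 / 2 ^ Suc m) * (2 powr (real m * s) * E (2 ^ Suc m)) powr k \<le> g n"
        if "n \<in> {2 ^ m..<2 ^ Suc m}" for n
      proof -
        have n: "2 ^ m \<le> n" "n < 2 ^ Suc m" "0 < n" using that by (auto intro: less_le_trans[of 0 "2 ^ m"])
        have "real n \<le> real (2 ^ Suc m)" using n by (intro of_nat_mono) simp
        then have 1: "(1 / 2 ^ Suc m) \<le> 1 / real n" using n by (auto simp: field_simps)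
        have "real (2 ^ m) powr s \<le> real n powr s" using n s by (intro powr_mono2) (auto intro: of_nat_mono)
        then have 2: "2 powr (real m * s) * E (2 ^ Suc m) \<le> real n powr s * E n"
          unfolding two_powr_nat using n by (intro mult_mono dec E0) auto
        show ?thesis unfolding g_def using E0 k
          by (intro mult_mono 1 powr_mono2 2) auto
      qed
      then have "(\<Sum>n\<in>{2 ^ m..<2 ^ Suc m::nat}. (1 / 2 ^ Suc m) * (2 powr (real m * s) * E (2 ^ Suc m)) powr k)
          \<le> (\<Sum>n\<in>{2 ^ m..<2 ^ Suc m}. g n)" by (intro sum_mono) auto
      moreover have "x (Suc m) powr k = 2 powr (s * k) * (2 powr (real m * s) * E (2 ^ Suc m)) powr k"
      proof -
        have "x (Suc m) = 2 powr s * (2 powr (real m * s) * E (2 ^ Suc m))"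
          by (simp add: x_def distrib_right powr_add)
        then show ?thesis using E0[of "2 ^ Suc m"] by (simp add: powr_mult powr_powr)
      qed
      ultimately show ?thesis by (simp add: field_simps)
    qed
    have "(\<Sum>m<M. x (Suc m) powr k) \<le> (\<Sum>m<M. 2 * 2 powr (s * k) * (\<Sum>n\<in>{2 ^ m..<2 ^ Suc m}. g n))"
      by (intro sum_mono blk)
    also have "\<dots> = 2 * 2 powr (s * k) * (\<Sum>n\<in>{1..<2 ^ M}. g n)"
      by (simp only: sum_dyadic_blocks sum_distrib_left)
    also have "\<dots> \<le> 2 * 2 powr (s * k) * suminf g"
      by (intro mult_left_mono sum_le_suminf sg) (auto simp: g0)
    finally show "(\<Sum>m<M. x (Suc m) powr k) \<le> 2 * 2 powr (s * k) * suminf g" .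
  qed simp
  then show ?thesis using summable_Suc_iff[of "\<lambda>m. x m powr k"] by (simp add: x_def)
qed

text \<open>The same block estimate from above, with \<open>E\<close> replaced by its value at the left end of the block.\<close>

lemma approx_of_dyadic:
  fixes E :: "nat \<Rightarrow> real"
  assumes E0: "\<And>N. 0 \<le> E N" and dec: "\<And>M N. M \<le> N \<Longrightarrow> E N \<le> E M" and s: "0 < s" and k: "0 < k"
    and sm: "summable (\<lambda>m. (2 powr (real m * s) * E (2 ^ m)) powr k)"
  shows "summable (\<lambda>N. 1 / real (Suc N) * (real (Suc N) powr s * E (Suc N)) powr k)"
proof -
  define g where "g n = 1 / real n * (real n powr s * E n) powr k" for n
  have g0: "0 \<le> g n" for n by (simp add: g_def)
  define y where "y m = (2 powr (real m * s) * E (2 ^ m)) powr k" for m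
  have sy: "summable y" using sm unfolding y_def .
  have "summable (\<lambda>N. g (Suc N))"
  proof (rule summableI_nonneg_bounded)
    fix M
    have blk: "(\<Sum>n\<in>{2 ^ m..<2 ^ Suc m}. g n) \<le> 2 powr (s * k) * y m" for m
    proof -
      have "g n \<le> (1 / 2 ^ m) * (2 powr (s * k) * y m)"
        if "n \<in> {2 ^ m..<2 ^ Suc m}" for n
      proof -
        have n: "2 ^ m \<le> n" "n < 2 ^ Suc m" "0 < n" using that by (auto intro: less_le_trans[of 0 "2 ^ m"])
        have "real (2 ^ m) \<le> real n" using n by (intro of_nat_mono) simp
        then have 1: "1 / real n \<le> 1 / 2 ^ m" using n by (auto simp: field_simps)
        have "real n \<le> real (2 ^ Suc m)" using n by (intro of_nat_mono) simp
      then have "real n powr s \<le> real (2 ^ Suc m) powr s" using s by (intro powr_mono2) auto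
        then have 2: "real n powr s * E n \<le> 2 powr (real (Suc m) * s) * E (2 ^ m)"
          unfolding two_powr_nat using n by (intro mult_mono dec E0) auto
        have "(2 powr (real (Suc m) * s) * E (2 ^ m)) powr k = 2 powr (s * k) * y m"
        proof -
          have "2 powr (real (Suc m) * s) * E (2 ^ m) = 2 powr s * (2 powr (real m * s) * E (2 ^ m))"
            by (simp add: distrib_right powr_add)
          then show ?thesis unfolding y_def using E0[of "2 ^ m"]
            by (simp only: powr_mult powr_powr powr_ge_zero mult_nonneg_nonneg)
        qed
        then show ?thesis unfolding g_def using E0 k powr_mono2[OF _ _ 2, of k]
          by (intro mult_mono 1) (auto simp: y_def)
      qed
      then have "(\<Sum>n\<in>{2 ^ m..<2 ^ Suc m}. g n) \<le> (\<Sum>n\<in>{2 ^ m..<2 ^ Suc m::nat}. (1 / 2 ^ m) * (2 powr (s * k) * y m))"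
        by (intro sum_mono) auto
      then show ?thesis by simp
    qed
    have "(\<Sum>N<M. g (Suc N)) = (\<Sum>n\<in>{1..<Suc M}. g n)"
      by (rule sum.reindex_bij_witness[of _ "\<lambda>n. n - 1" Suc]) auto
    also have "\<dots> \<le> (\<Sum>n\<in>{1..<2 ^ M}. g n)"
      by (intro sum_mono2) (auto simp: g0 Suc_le_eq less_le_trans[of _ M]  intro: order.strict_trans2 )
    also have "\<dots> \<le> (\<Sum>m<M. 2 powr (s * k) * y m)"
      unfolding sum_dyadic_blocks by (intro sum_mono blk)
    also have "\<dots> \<le> 2 powr (s * k) * suminf y"
      unfolding sum_distrib_left[symmetric]
      by (intro mult_left_mono sum_le_suminf sy) (auto simp: y_def)
    finally show "(\<Sum>N<M. g (Suc N)) \<le> 2 powr (s * k) * suminf y" .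
  qed (simp add: g0)
  then show ?thesis by (simp add: g_def)
qed

lemma approx_space_dyadic:
  assumes E0: "\<And>N. 0 \<le> approx_error nV A N u"
    and dec: "\<And>M N. M \<le> N \<Longrightarrow> approx_error nV A N u \<le> approx_error nV A M u"
    and s: "0 < s" and \<kappa>: "0 < \<kappa>"
  shows "u \<in> approx_space V nV A s \<kappa> \<longleftrightarrow>
    u \<in> V \<and> in_ell \<kappa> (\<lambda>m. 2 powr (real m * s) * approx_error nV A (2 ^ m) u)"
proof (rule in_ell_cases[OF \<kappa>])
  fix k assume k: "\<kappa> = ereal k" "0 < k"
  show ?thesis
    using dyadic_of_approx[where E = "\<lambda>N. approx_error nV A N u", OF E0 dec s k(2)]
      approx_of_dyadic[where E = "\<lambda>N. approx_error nV A N u", OF E0 dec s k(2)] k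
    by (auto simp: approx_space_def in_ell_def)
next
  assume k: "\<kappa> = \<infinity>"
  let ?E = "\<lambda>N. approx_error nV A N u"
  have "bdd_above (range (\<lambda>N. real N powr s * ?E N)) \<longleftrightarrow>
        bdd_above (range (\<lambda>m. 2 powr (real m * s) * ?E (2 ^ m)))"
  proof
    assume "bdd_above (range (\<lambda>N. real N powr s * ?E N))"
    then obtain B where B: "\<And>N. real N powr s * ?E N \<le> B" by (auto simp: bdd_above_def)
    have "2 powr (real m * s) * ?E (2 ^ m) \<le> B" for m
      using B[of "2 ^ m"] unfolding two_powr_nat .
    then show "bdd_above (range (\<lambda>m. 2 powr (real m * s) * ?E (2 ^ m)))" by (auto simp: bdd_above_def)
  next
    assume "bdd_above (range (\<lambda>m. 2 powr (real m * s) * ?E (2 ^ m)))"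
    then obtain B where B: "\<And>m. 2 powr (real m * s) * ?E (2 ^ m) \<le> B" by (auto simp: bdd_above_def)
    have "0 \<le> 2 powr (real 0 * s) * ?E (2 ^ 0)" using E0 by simp
    then have B0: "0 \<le> B" using B[of 0] by linarith
    have "real n powr s * ?E n \<le> 2 powr s * B" for n
    proof (cases "n = 0")
      case False
      then obtain m where n: "2 ^ m \<le> n" "n < 2 ^ Suc m" using dyadic_nat[of n] by auto
      have "real n \<le> real (2 ^ Suc m)" using n by (intro of_nat_mono) simp
      then have "real n powr s \<le> real (2 ^ Suc m) powr s" using s by (intro powr_mono2) auto
      then have "real n powr s * ?E n \<le> 2 powr (real (Suc m) * s) * ?E (2 ^ m)"
        unfolding two_powr_nat using n by (intro mult_mono dec E0) auto
      also have "\<dots> = 2 powr s * (2 powr (real m * s) * ?E (2 ^ m))"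
        by (simp add: distrib_right powr_add)
      also have "\<dots> \<le> 2 powr s * B" by (intro mult_left_mono B) simp
      finally show ?thesis .
    qed (simp add: B0)
    then show "bdd_above (range (\<lambda>N. real N powr s * ?E N))" by (auto simp: bdd_above_def)
  qed
  then show ?thesis using k by (auto simp: approx_space_def in_ell_def)
qed

lemma dyadic_real:
  assumes "0 < t" "t \<le> 1" "0 < r"
  obtains m :: nat where "2 powr (- (real (Suc m) * r)) < t" "t \<le> 2 powr (- (real m * r))"
proof -
  define y where "y = - log 2 t / r"
  have y: "0 \<le> y" using assms by (simp add: y_def divide_nonpos_pos)
  have t: "t = 2 powr (- (y * r))" using assms by (simp add: y_def)
  define m where "m = nat \<lfloor>y\<rfloor>"
  have m: "real m \<le> y" "y < real (Suc m)" using y by (auto simp: m_def) linarith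
  have "real m * r \<le> y * r" "y * r < real (Suc m) * r"
    using m assms by (auto simp del: of_nat_Suc)
  then show ?thesis using that[of m] unfolding t by (simp del: of_nat_Suc)
qed

text \<open>The points \<open>2 powr (- m r)\<close> are the images of \<open>N = 2\<^sup>m\<close> under \<open>t = N\<^sup>-\<^sup>r\<close>, the scale on which Jackson's
  inequality relates \<open>K\<close> to \<open>E\<close>. Between consecutive points every power of \<open>t\<close> is constant up to a factor.\<close>

lemma interp_block_bounds:
  assumes t: "2 powr (- (real (Suc m) * r)) < t" "t \<le> 2 powr (- (real m * r))" and r: "0 < r" and s: "0 < s"
  shows "2 powr (real m * s) \<le> t powr (- (s / r))" "t powr (- (s / r)) \<le> 2 powr s * 2 powr (real m * s)"
    "2 powr (real m * r) \<le> 1 / t" "1 / t \<le> 2 powr r * 2 powr (real m * r)"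
proof -
  have t0: "0 < t" using t(1) by (rule less_trans[rotated]) simp
  have sr: "- (s / r) < 0" using r s by simp
  have "(2 powr (- (real m * r))) powr (- (s / r)) \<le> t powr (- (s / r))"
    using t t0 sr by (intro powr_mono2') auto
  then show "2 powr (real m * s) \<le> t powr (- (s / r))" using r by (simp add: powr_powr)
  have "t powr (- (s / r)) \<le> (2 powr (- (real (Suc m) * r))) powr (- (s / r))"
    using t t0 sr by (intro powr_mono2') auto
  also have "\<dots> = 2 powr s * 2 powr (real m * s)"
    using r by (simp add: powr_powr powr_add[symmetric] algebra_simps add_divide_distrib)
  finally show "t powr (- (s / r)) \<le> 2 powr s * 2 powr (real m * s)" .
  have "1 / 2 powr (- (real m * r)) \<le> 1 / t" using t t0 by (intro divide_left_mono) auto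
  then show "2 powr (real m * r) \<le> 1 / t" by (simp add: powr_minus divide_inverse)
  have "1 / t \<le> 1 / 2 powr (- (real (Suc m) * r))" using t t0 by (intro divide_left_mono) auto
  also have "\<dots> = 2 powr r * 2 powr (real m * r)"
    by (simp add: powr_minus_divide powr_add[symmetric] algebra_simps del: of_nat_Suc) (simp add: algebra_simps)
  finally show "1 / t \<le> 2 powr r * 2 powr (real m * r)" .
qed

context
  fixes K :: "real \<Rightarrow> real" and r s k :: real
  assumes K0: "\<And>t. 0 < t \<Longrightarrow> 0 \<le> K t" and inc: "\<And>t t'. 0 < t \<Longrightarrow> t \<le> t' \<Longrightarrow> K t \<le> K t'"
    and r: "0 < r" and s: "0 < s" and k: "0 < k"
begin

abbreviation block :: "nat \<Rightarrow> real set" where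
  "block m \<equiv> {2 powr (- (real (Suc m) * r))<..2 powr (- (real m * r))}"

lemma emeasure_block: "emeasure lborel (block m) = ennreal ((1 - 2 powr (- r)) * 2 powr (- (real m * r)))"
proof -
  have "2 powr (- (real (Suc m) * r)) = 2 powr (- r) * 2 powr (- (real m * r))"
    by (simp add: powr_add[symmetric] algebra_simps)
  moreover have "2 powr (- (real (Suc m) * r)) \<le> 2 powr (- (real m * r))"
    using r by (intro powr_mono) (auto simp: algebra_simps)
  ultimately show ?thesis by (simp add: algebra_simps del: of_nat_Suc)
qed

lemma two_powr_cancel: "2 powr (real m * r) * 2 powr (- (real m * r)) = (1::real)"
  by (simp add: powr_add[symmetric])

lemma two_powr_minus_r: "2 powr (- r) < 1"
  using r powr_less_mono[of "- r" 0 2] by simp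

lemma block_disjoint: "t \<in> block m \<Longrightarrow> t \<in> block m' \<Longrightarrow> m = m'"
proof (rule ccontr)
  have *: "m' \<le> m" if "t \<in> block m" "t \<in> block m'" for m m'
  proof (rule ccontr)
    assume "\<not> m' \<le> m"
    then have "Suc m \<le> m'" by simp
    then have "real (Suc m) * r \<le> real m' * r" using r by (intro mult_right_mono of_nat_mono) auto
    then have "2 powr (- (real m' * r)) \<le> 2 powr (- (real (Suc m) * r))" by (intro powr_mono) auto
    then show False using that by (simp only: greaterThanAtMost_iff) linarith
  qed
  assume "t \<in> block m" "t \<in> block m'" "m \<noteq> m'"
  then show False using *[of m m'] *[of m' m] by simp
qed

lemma suminf_block:
  assumes "t \<in> block m" shows "(\<Sum>m. c m * indicator (block m) t) = (c m :: ennreal)"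
proof -
  have "indicator (block m') t = (0::ennreal)" if "m' \<notin> {m}" for m'
    using block_disjoint[OF assms, of m'] that by (auto simp only: indicator_simps split: split_indicator)
  then have "(\<Sum>m. c m * indicator (block m) t) = (\<Sum>m'\<in>{m}. c m' * indicator (block m') t)"
    by (intro suminf_finite) (simp_all del: of_nat_Suc)
  moreover have "sum X {m} = X m" for X :: "nat \<Rightarrow> ennreal" by simp
  ultimately show ?thesis using assms by (simp only: indicator_simps mult_1_right)
qed

lemma nn_integral_blocks:
  "(\<integral>\<^sup>+ t. (\<Sum>m. c m * indicator (block m) t) \<partial>lborel) =
     (\<Sum>m. c m * ennreal ((1 - 2 powr (- r)) * 2 powr (- (real m * r))))"
proof -
  have "(\<integral>\<^sup>+ t. c m * indicator (block m) t \<partial>lborel) = c m * ennreal ((1 - 2 powr (- r)) * 2 powr (- (real m * r)))" for m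
    by (subst nn_integral_cmult_indicator) (simp_all only: emeasure_block, simp)
  then show ?thesis by (subst nn_integral_suminf) simp_all
qed

abbreviation integrand :: "real \<Rightarrow> real" where
  "integrand t \<equiv> (t powr (- (s / r)) * K t) powr k / t"

text \<open>The integrand dominates a step function whose value on a block is computed from \<open>K\<close> at the left end
  point. The factor \<open>1 / t\<close> compensates the length of the block.\<close>

lemma dyadic_of_integral:
  assumes fin: "(\<integral>\<^sup>+ t\<in>{0<..}. ennreal (integrand t) \<partial>lborel) < \<infinity>"
  shows "summable (\<lambda>m. (2 powr (real m * s) * K (2 powr (- (real m * r)))) powr k)"
proof -
  define x where "x m = 2 powr (real m * s) * K (2 powr (- (real m * r)))" for m
  define a where "a m = (2 powr (real m * s) * K (2 powr (- (real (Suc m) * r)))) powr k" for m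
  define c where "c m = 2 powr (real m * r) * a m" for m
  have "(\<Sum>m. ennreal (c m) * indicator (block m) t) \<le> ennreal (integrand t) * indicator {0<..} t" for t
  proof (cases "\<exists>m. t \<in> block m")
    case True
    then obtain m where m: "t \<in> block m" ..
    then have t: "2 powr (- (real (Suc m) * r)) < t" "t \<le> 2 powr (- (real m * r))" by auto
    note b = interp_block_bounds[OF t r s]
    have t0: "0 < t" using t(1) by (rule less_trans[rotated]) simp
    have "a m \<le> (t powr (- (s / r)) * K t) powr k"
      unfolding a_def using K0 b t t0 k by (intro powr_mono2 mult_mono inc) (auto intro: K0)
    then have "c m \<le> 1 / t * (t powr (- (s / r)) * K t) powr k"
      unfolding c_def using b t0 by (intro mult_mono) (auto simp: a_def)
    then show ?thesis unfolding suminf_block[OF m] using t0 by (simp add: ennreal_leI)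
  next
    case False
    then have "(\<Sum>m. ennreal (c m) * indicator (block m) t) = 0"
      by (subst suminf_eq_zero_iff) (auto split: split_indicator)
    then show ?thesis by simp
  qed
  then have "(\<integral>\<^sup>+ t. (\<Sum>m. ennreal (c m) * indicator (block m) t) \<partial>lborel) < \<infinity>"
    by (intro le_less_trans[OF nn_integral_mono fin])
  moreover have "ennreal (c m) * ennreal ((1 - 2 powr (- r)) * 2 powr (- (real m * r))) =
      ennreal ((1 - 2 powr (- r)) * a m)" for m
  proof -
    have "c m * ((1 - 2 powr (- r)) * 2 powr (- (real m * r))) =
        (1 - 2 powr (- r)) * a m * (2 powr (real m * r) * 2 powr (- (real m * r)))"
      by (simp only: c_def mult_ac)
    then show ?thesis using two_powr_minus_r
      by (subst ennreal_mult[symmetric]) (auto simp only: two_powr_cancel c_def a_def, auto)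
  qed
  ultimately have "(\<Sum>m. ennreal ((1 - 2 powr (- r)) * a m)) < \<infinity>"
    unfolding nn_integral_blocks by simp
  then have "summable (\<lambda>m. (1 - 2 powr (- r)) * a m)"
    using two_powr_minus_r by (intro summable_suminf_not_top) (auto simp: a_def)
  then have "summable a" using two_powr_minus_r by (subst (asm) summable_cmult_iff) auto
  then have "summable (\<lambda>m. 2 powr (s * k) * a m)" by (rule summable_mult)
  moreover have "2 powr (s * k) * a m = x (Suc m) powr k" for m
  proof -
    have "x (Suc m) = 2 powr s * (2 powr (real m * s) * K (2 powr (- (real (Suc m) * r))))"
      unfolding x_def by (simp add: powr_add[symmetric] algebra_simps)
    then show ?thesis unfolding a_def using K0[of "2 powr (- (real (Suc m) * r))"]
      by (simp add: powr_mult powr_powr del: of_nat_Suc)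
  qed
  ultimately show ?thesis using summable_Suc_iff[of "\<lambda>m. x m powr k"] by (simp add: x_def)
qed

text \<open>On \<open>(0, 1]\<close> the integrand is dominated by a step function computed from \<open>K\<close> at the right end points
  of the blocks. For \<open>t > 1\<close> the bound \<open>B\<close> leaves a power of \<open>t\<close> that is integrable at infinity.\<close>

lemma integral_of_dyadic:
  assumes sm: "summable (\<lambda>m. (2 powr (real m * s) * K (2 powr (- (real m * r)))) powr k)"
    and B: "\<And>t. 0 < t \<Longrightarrow> K t \<le> B"
  shows "(\<integral>\<^sup>+ t\<in>{0<..}. ennreal (integrand t) \<partial>lborel) < \<infinity>"
proof -
  define a where "a m = (2 powr (real m * s) * K (2 powr (- (real m * r)))) powr k" for m
  define c where "c m = 2 powr r * 2 powr (s * k) * 2 powr (real m * r) * a m" for m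
  define h where "h t = B powr k * t powr (- (s / r) * k - 1)" for t
  have B0: "0 \<le> B" using B[of 1] K0[of 1] by simp
  have le: "ennreal (integrand t) * indicator {0<..} t \<le>
      (\<Sum>m. ennreal (c m) * indicator (block m) t) + ennreal (h t) * indicator {1..} t" for t
  proof (cases "0 < t \<and> t \<le> 1")
    case True
    obtain m where t: "2 powr (- (real (Suc m) * r)) < t" "t \<le> 2 powr (- (real m * r))"
      using dyadic_real[of t r] True r by auto
    then have m: "t \<in> block m" by auto
    note b = interp_block_bounds[OF t r s]
    have "(t powr (- (s / r)) * K t) powr k \<le> (2 powr s * 2 powr (real m * s) * K (2 powr (- (real m * r)))) powr k"
      using True b t k by (intro powr_mono2 mult_mono inc mult_nonneg_nonneg K0) auto
    also have "\<dots> = 2 powr (s * k) * a m"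
      using K0[of "2 powr (- (real m * r))"] by (simp add: a_def powr_mult powr_powr)
    finally have "1 / t * (t powr (- (s / r)) * K t) powr k \<le> (2 powr r * 2 powr (real m * r)) * (2 powr (s * k) * a m)"
      using b True by (intro mult_mono) (auto simp: a_def)
    then have "integrand t \<le> c m" by (simp add: c_def mult_ac)
    then show ?thesis unfolding suminf_block[OF m] using True
      by (auto intro!: add_increasing2 ennreal_leI split: split_indicator)
  next
    case False
    show ?thesis
    proof (cases "0 < t")
      case True
      have "(t powr (- (s / r)) * K t) powr k \<le> (t powr (- (s / r)) * B) powr k"
        using True K0[of t] B[of t] k by (intro powr_mono2 mult_left_mono) auto
      also have "\<dots> / t = h t" using True B0 by (simp add: h_def powr_mult powr_powr powr_diff)
      finally have "integrand t \<le> h t" using True by (simp add: divide_right_mono)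
      then show ?thesis using True False by (auto intro!: add_increasing ennreal_leI)
    qed simp
  qed
  have "- (s / r) * k - 1 < - 1" using r s k by simp
  note has_integral_powr_to_inf[OF this, of 1]
  then have "(h has_integral (B powr k * (- (1 powr (- (s / r) * k - 1 + 1)) / (- (s / r) * k - 1 + 1)))) {1..}"
    unfolding h_def by (intro has_integral_mult_right) auto
  then have hfin: "(\<integral>\<^sup>+ t. ennreal (h t) * indicator {1..} t \<partial>lborel) < \<infinity>"
    using nn_integral_has_integral_lebesgue[of "{1..}" h]
    by (simp add: h_def ennreal_mult'' ennreal_indicator mult.commute)
  have "(\<integral>\<^sup>+ t\<in>{0<..}. ennreal (integrand t) \<partial>lborel) \<le>
     (\<integral>\<^sup>+ t. (\<Sum>m. ennreal (c m) * indicator (block m) t) + ennreal (h t) * indicator {1..} t \<partial>lborel)"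
    by (intro nn_integral_mono le)
  also have "\<dots> = (\<integral>\<^sup>+ t. (\<Sum>m. ennreal (c m) * indicator (block m) t) \<partial>lborel) +
      (\<integral>\<^sup>+ t. ennreal (h t) * indicator {1..} t \<partial>lborel)"
    unfolding h_def by (intro nn_integral_add) measurable
  also have "\<dots> < \<infinity>"
  proof -
    have "ennreal (c m) * ennreal ((1 - 2 powr (- r)) * 2 powr (- (real m * r))) =
       ennreal (2 powr r * 2 powr (s * k) * (1 - 2 powr (- r)) * a m)" for m
    proof -
      have "c m * ((1 - 2 powr (- r)) * 2 powr (- (real m * r))) =
          2 powr r * 2 powr (s * k) * (1 - 2 powr (- r)) * a m * (2 powr (real m * r) * 2 powr (- (real m * r)))"
        by (simp only: c_def mult_ac)
      then show ?thesis using two_powr_minus_r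
        by (subst ennreal_mult[symmetric]) (auto simp only: two_powr_cancel c_def a_def, auto)
    qed
    moreover have "summable (\<lambda>m. 2 powr r * 2 powr (s * k) * (1 - 2 powr (- r)) * a m)"
      using sm by (intro summable_mult) (simp add: a_def)
    ultimately have "(\<integral>\<^sup>+ t. (\<Sum>m. ennreal (c m) * indicator (block m) t) \<partial>lborel) < \<infinity>"
      unfolding nn_integral_blocks using two_powr_minus_r
      by (simp add: suminf_ennreal2 a_def)
    then show ?thesis using hfin by simp
  qed
  finally show ?thesis .
qed

end

lemma interp_space_dyadic:
  fixes nV :: "'v::minus \<Rightarrow> real"
  assumes K0: "\<And>t. 0 < t \<Longrightarrow> 0 \<le> K_functional nV W nW u t"
    and inc: "\<And>t t'. 0 < t \<Longrightarrow> t \<le> t' \<Longrightarrow> K_functional nV W nW u t \<le> K_functional nV W nW u t'"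
    and B: "\<And>t. 0 < t \<Longrightarrow> K_functional nV W nW u t \<le> B"
    and r: "0 < r" and s: "0 < s" and \<kappa>: "0 < \<kappa>"
  shows "u \<in> interp_space V nV W nW (s / r) \<kappa> \<longleftrightarrow>
    u \<in> V \<and> in_ell \<kappa> (\<lambda>m. 2 powr (real m * s) * K_functional nV W nW u (2 powr (- (real m * r))))"
proof (rule in_ell_cases[OF \<kappa>])
  let ?K = "K_functional nV W nW u"
  fix k assume k: "\<kappa> = ereal k" "0 < k"
  show ?thesis
    using dyadic_of_integral[of ?K, OF K0 inc r s k(2)]
      integral_of_dyadic[of ?K, OF K0 inc r s k(2) _ B] k
    by (auto simp: interp_space_def in_ell_def)
next
  let ?K = "K_functional nV W nW u"
  assume k: "\<kappa> = \<infinity>"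
  have "bdd_above ((\<lambda>t. t powr (- (s / r)) * ?K t) ` {0<..}) \<longleftrightarrow>
        bdd_above (range (\<lambda>m. 2 powr (real m * s) * ?K (2 powr (- (real m * r)))))"
  proof
    assume "bdd_above ((\<lambda>t. t powr (- (s / r)) * ?K t) ` {0<..})"
    then obtain D where D: "\<And>t. 0 < t \<Longrightarrow> t powr (- (s / r)) * ?K t \<le> D" by (auto simp: bdd_above_def)
    have "2 powr (real m * s) * ?K (2 powr (- (real m * r))) \<le> D" for m
      using D[of "2 powr (- (real m * r))"] r by (simp add: powr_powr)
    then show "bdd_above (range (\<lambda>m. 2 powr (real m * s) * ?K (2 powr (- (real m * r)))))"
      by (auto simp: bdd_above_def)
  next
    assume "bdd_above (range (\<lambda>m. 2 powr (real m * s) * ?K (2 powr (- (real m * r)))))"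
    then obtain D where D: "\<And>m. 2 powr (real m * s) * ?K (2 powr (- (real m * r))) \<le> D"
      by (auto simp: bdd_above_def)
    have "t powr (- (s / r)) * ?K t \<le> max (2 powr s * D) B" if t: "0 < t" for t
    proof (cases "t \<le> 1")
      case True
      obtain m :: nat where m: "2 powr (- (real (Suc m) * r)) < t" "t \<le> 2 powr (- (real m * r))"
        using dyadic_real[OF t True r] .
      have "t powr (- (s / r)) * ?K t \<le> 2 powr s * 2 powr (real m * s) * ?K (2 powr (- (real m * r)))"
        using interp_block_bounds[OF m r s] m t by (intro mult_mono inc K0) auto
      also have "\<dots> \<le> 2 powr s * D" using D[of m] by simp
      finally show ?thesis by simp
    next
      case False
      then have "t powr (- (s / r)) \<le> t powr 0" using r s by (intro powr_mono) auto
      then have "t powr (- (s / r)) * ?K t \<le> 1 * B" using t by (intro mult_mono B K0) auto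
      then show ?thesis by simp
    qed
    then show "bdd_above ((\<lambda>t. t powr (- (s / r)) * ?K t) ` {0<..})" by (auto simp: bdd_above_def)
  qed
  then show ?thesis using k by (auto simp: interp_space_def in_ell_def)
qed

section \<open>Best N-term approximation of square-summable sequences\<close>

lemma norm_add_square_le: "(norm (a + b :: 'a::real_normed_vector))\<^sup>2 \<le> 2 * (norm a)\<^sup>2 + 2 * (norm b)\<^sup>2"
proof -
  have "(norm (a + b))\<^sup>2 \<le> (norm a + norm b)\<^sup>2" by (simp add: norm_triangle_ineq power_mono)
  also have "\<dots> \<le> 2 * (norm a)\<^sup>2 + 2 * (norm b)\<^sup>2"
    using sum_squares_bound[of "norm a" "norm b"] by (simp add: power2_sum)
  finally show ?thesis .
qed

lemma summability_exponent:
  fixes \<tau> r :: real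
  assumes "1 / \<tau> = r + 1 / 2" "0 < r"
  shows "0 < \<tau>" "\<tau> < 2"
proof -
  have "1 / 2 < 1 / \<tau>" using assms by simp
  then show "0 < \<tau>" by (metis half_gt_zero_iff less_trans zero_less_divide_1_iff zero_less_one)
  with \<open>1 / 2 < 1 / \<tau>\<close> show "\<tau> < 2" by (simp add: field_simps)
qed

text \<open>Bernstein's inequality for finite sums; it is Jensen's inequality for the concave power \<open>\<tau> / 2\<close>.\<close>

lemma power_sum_le:
  fixes x :: "'i \<Rightarrow> real"
  assumes "finite F" "real (card F) \<le> n" "0 < n" "\<And>l. l \<in> F \<Longrightarrow> 0 \<le> x l" "0 < \<tau>" "\<tau> < 2"
  shows "(\<Sum>l\<in>F. x l powr \<tau>) \<le> n powr (1 - \<tau> / 2) * (\<Sum>l\<in>F. (x l)\<^sup>2) powr (\<tau> / 2)"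
proof (cases "(\<Sum>l\<in>F. (x l)\<^sup>2) = 0")
  case True
  then have "\<forall>l\<in>F. x l = 0" using assms(1) by (simp add: sum_nonneg_eq_0_iff)
  then show ?thesis by simp
next
  case False
  define M where "M = (\<Sum>l\<in>F. (x l)\<^sup>2) / n"
  have S0: "0 < (\<Sum>l\<in>F. (x l)\<^sup>2)" using False sum_nonneg[of F "\<lambda>l. (x l)\<^sup>2"] by (auto simp: less_le)
  then have M: "0 < M" using assms by (simp add: M_def)
  \<comment> \<open>The concave power lies below its tangent at the mean \<open>M\<close>; Young's inequality expresses this.\<close>
  have tangent: "x l powr \<tau> \<le> M powr (\<tau> / 2) * ((\<tau> / 2) * ((x l)\<^sup>2 / M) + (1 - \<tau> / 2))" if "l \<in> F" for l
  proof -
    have "((x l)\<^sup>2 / M) powr (\<tau> / 2) \<le> (\<tau> / 2) * ((x l)\<^sup>2 / M) + (1 - \<tau> / 2)"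
    proof (cases "x l = 0")
      case False
      then show ?thesis
        using assms M Youngs_inequality_0[of "\<tau> / 2" "1 - \<tau> / 2" "(x l)\<^sup>2 / M" 1] by simp
    qed (use assms in simp)
    moreover have "x l powr \<tau> = M powr (\<tau> / 2) * ((x l)\<^sup>2 / M) powr (\<tau> / 2)"
    proof -
      have "(x l)\<^sup>2 powr (\<tau> / 2) = x l powr \<tau>"
        using assms(4)[OF that] powr_powr[of "x l" 2 "\<tau> / 2"] by (cases "x l = 0") (auto simp: powr_numeral)
      then show ?thesis using M by (simp add: powr_divide)
    qed
    ultimately show ?thesis by (simp add: mult_left_mono)
  qed
  have "(\<Sum>l\<in>F. x l powr \<tau>) \<le> (\<Sum>l\<in>F. M powr (\<tau> / 2) * ((\<tau> / 2) * ((x l)\<^sup>2 / M) + (1 - \<tau> / 2)))"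
    by (intro sum_mono tangent)
  also have "\<dots> = M powr (\<tau> / 2) * ((\<tau> / 2) * ((\<Sum>l\<in>F. (x l)\<^sup>2) / M) + real (card F) * (1 - \<tau> / 2))"
    by (simp add: sum_distrib_left[symmetric] sum.distrib sum_divide_distrib[symmetric])
  also have "(\<Sum>l\<in>F. (x l)\<^sup>2) / M = n" using False assms by (simp add: M_def)
  also have "M powr (\<tau> / 2) * ((\<tau> / 2) * n + real (card F) * (1 - \<tau> / 2)) \<le> M powr (\<tau> / 2) * ((\<tau> / 2) * n + n * (1 - \<tau> / 2))"
    using assms by (intro mult_left_mono add_left_mono mult_right_mono) auto
  also have "\<dots> = M powr (\<tau> / 2) * n" by (simp add: algebra_simps)
  also have "\<dots> = n powr (1 - \<tau> / 2) * (\<Sum>l\<in>F. (x l)\<^sup>2) powr (\<tau> / 2)"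
    using assms S0 by (simp add: M_def powr_divide powr_diff)
  finally show ?thesis .
qed

text \<open>Jackson's inequality. Keep the entries whose \<open>\<tau>\<close>-th power exceeds the \<open>N\<close>-th part of the total sum
  \<open>S\<close>: there can be at most \<open>N\<close> of them. For the others, write \<open>2 = \<tau> + \<tau> (2 r)\<close> and estimate the second
  factor of \<open>x\<^sup>2 = x\<^sup>\<tau> (x\<^sup>\<tau>)\<^sup>2\<^sup>r\<close> by \<open>(S / N)\<^sup>2\<^sup>r\<close>.\<close>

lemma threshold_set:
  fixes x :: "'i \<Rightarrow> real"
  assumes sm: "(\<lambda>l. x l powr \<tau>) summable_on I" and x0: "\<And>l. l \<in> I \<Longrightarrow> 0 \<le> x l"
    and sq: "(\<lambda>l. (x l)\<^sup>2) summable_on I"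
    and \<tau>: "1 / \<tau> = r + 1 / 2" and r: "0 < r" and N: "0 < N"
  obtains F where "finite F" "F \<subseteq> I" "card F \<le> N"
    "(\<Sum>\<^sub>\<infinity>l\<in>I - F. (x l)\<^sup>2) \<le> (real N powr (- r) * (\<Sum>\<^sub>\<infinity>l\<in>I. x l powr \<tau>) powr (1 / \<tau>))\<^sup>2"
proof -
  define S where "S = (\<Sum>\<^sub>\<infinity>l\<in>I. x l powr \<tau>)"
  have S0: "0 \<le> S" unfolding S_def by (intro infsum_nonneg) simp
  have \<tau>0: "0 < \<tau>" by (rule summability_exponent[OF \<tau> r])
  have exp: "\<tau> * (2 * r) = 2 - \<tau>" using \<tau> \<tau>0 by (simp add: field_simps)
  define F where "F = {l \<in> I. S / real N < x l powr \<tau>}"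
  have part: "sum (\<lambda>l. x l powr \<tau>) G \<le> S" if "finite G" "G \<subseteq> I" for G
    unfolding S_def using that by (intro finite_sum_le_infsum sm) auto
  have cardG: "card G \<le> N" if G: "finite G" "G \<subseteq> F" for G
  proof (rule ccontr)
    assume "\<not> card G \<le> N"
    then have ne: "G \<noteq> {}" and gt: "real N \<le> real (card G)" by auto
    have "real (card G) * (S / real N) < sum (\<lambda>l. x l powr \<tau>) G"
      using G ne sum_strict_mono[of G "\<lambda>_. S / real N" "\<lambda>l. x l powr \<tau>"] by (auto simp: F_def)
    moreover have "S \<le> real (card G) * (S / real N)"
      using gt N S0 mult_right_mono[OF gt, of "S / real N"] by simp
    ultimately show False using part[of G] G by (auto simp: F_def)
  qed
  have finF: "finite F" and cardF: "card F \<le> N"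
    using finite_if_finite_subsets_card_bdd[of F N] cardG by auto
  have off: "(x l)\<^sup>2 \<le> x l powr \<tau> * (S / real N) powr (2 * r)" if "l \<in> I - F" for l
  proof -
    have "(x l)\<^sup>2 = x l powr \<tau> * (x l powr \<tau>) powr (2 * r)"
      using x0[of l] that by (cases "x l = 0") (auto simp: powr_powr exp powr_add[symmetric])
    also have "\<dots> \<le> x l powr \<tau> * (S / real N) powr (2 * r)"
      using that r by (intro mult_left_mono powr_mono2) (auto simp: F_def)
    finally show ?thesis .
  qed
  have smd: "(\<lambda>l. x l powr \<tau>) summable_on I - F" using sm by (rule summable_on_subset_banach) auto
  have "(\<Sum>\<^sub>\<infinity>l\<in>I - F. (x l)\<^sup>2) \<le> (\<Sum>\<^sub>\<infinity>l\<in>I - F. x l powr \<tau> * (S / real N) powr (2 * r))"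
    by (intro infsum_mono off summable_on_cmult_left smd summable_on_subset_banach[OF sq]) auto
  also have "\<dots> = (\<Sum>\<^sub>\<infinity>l\<in>I - F. x l powr \<tau>) * (S / real N) powr (2 * r)"
    by (rule infsum_cmult_left')
  also have "\<dots> \<le> S * (S / real N) powr (2 * r)"
    unfolding S_def by (intro mult_right_mono infsum_mono_neutral smd sm) auto
  also have "\<dots> = (real N powr (- r) * S powr (1 / \<tau>))\<^sup>2"
  proof (cases "S = 0")
    case False
    have sq: "(y powr e)\<^sup>2 = y powr (2 * e)" for y e :: real
      by (simp add: power2_eq_square powr_add[symmetric])
    have "S * S powr (2 * r) = S powr (2 * (1 / \<tau>))"
      using False S0 powr_add[of S 1 "2 * r"] by (simp only: \<tau>) (simp add: algebra_simps)
    then show ?thesis using S0 N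
      by (simp add: power_mult_distrib sq powr_divide powr_minus_divide power_divide)
  qed (use \<tau>0 r in simp)
  finally show ?thesis using that[of F] finF cardF by (auto simp: F_def S_def)
qed

text \<open>The sequence-space picture of the theorem: \<open>a u\<close> is the sequence of weighted coefficients of \<open>u\<close>, \<open>V\<close> plays
  the role of \<open>\<ell>\<^sup>2\<close> up to equivalence of norms, \<open>W\<close> that of \<open>\<ell>\<^sup>\<tau>\<close>, and \<open>A N\<close> consists of elements
  with at most \<open>N\<close> nonzero coefficients.
  That \<open>W\<close> is contained in \<open>V\<close> expresses the completeness of \<open>V\<close> as far as it enters.\<close>

locale seq_model =
  fixes V :: "'v::minus set" and nV :: "'v \<Rightarrow> real" and W :: "'v set" and nW :: "'v \<Rightarrow> real"
    and A :: "nat \<Rightarrow> 'v set" and I :: "'i set" and a :: "'v \<Rightarrow> 'i \<Rightarrow> complex" and \<tau> r c C :: real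
  assumes r: "0 < r" and \<tau>: "1 / \<tau> = r + 1 / 2" and c: "0 < c" and C: "0 < C"
    and diff: "u \<in> V \<Longrightarrow> v \<in> V \<Longrightarrow> u - v \<in> V"
    and a_diff: "u \<in> V \<Longrightarrow> v \<in> V \<Longrightarrow> l \<in> I \<Longrightarrow> a (u - v) l = a u l - a v l"
    and nV_nonneg: "u \<in> V \<Longrightarrow> 0 \<le> nV u"
    and square_summable: "u \<in> V \<Longrightarrow> (\<lambda>l. (norm (a u l))\<^sup>2) summable_on I"
    and nV_lower: "u \<in> V \<Longrightarrow> c * (\<Sum>\<^sub>\<infinity>l\<in>I. (norm (a u l))\<^sup>2) \<le> (nV u)\<^sup>2"
    and nV_upper: "u \<in> V \<Longrightarrow> (nV u)\<^sup>2 \<le> C * (\<Sum>\<^sub>\<infinity>l\<in>I. (norm (a u l))\<^sup>2)"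
    and W_subset: "W \<subseteq> V"
    and W_summable: "w \<in> W \<Longrightarrow> (\<lambda>l. norm (a w l) powr \<tau>) summable_on I"
    and nW: "w \<in> W \<Longrightarrow> nW w = (\<Sum>\<^sub>\<infinity>l\<in>I. norm (a w l) powr \<tau>) powr (1 / \<tau>)"
    and A_subset: "A N \<subseteq> W" and A_mono: "M \<le> N \<Longrightarrow> A M \<subseteq> A N"
    and A_support: "v \<in> A N \<Longrightarrow> \<exists>F. finite F \<and> F \<subseteq> I \<and> card F \<le> N \<and> (\<forall>l\<in>I - F. a v l = 0)"
    and A_exists: "finite F \<Longrightarrow> F \<subseteq> I \<Longrightarrow> card F \<le> N \<Longrightarrow>
      \<exists>v\<in>A N. (\<forall>l\<in>F. a v l = b l) \<and> (\<forall>l\<in>I - F. a v l = 0)"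
begin

definition tail :: "'v \<Rightarrow> 'i set \<Rightarrow> real" where
  "tail u F = (\<Sum>\<^sub>\<infinity>l\<in>I - F. (norm (a u l))\<^sup>2)"

lemma \<tau>_pos: "0 < \<tau>" and \<tau>_less_2: "\<tau> < 2"
  by (fact summability_exponent[OF \<tau> r])+

lemma A_subset_V: "v \<in> A N \<Longrightarrow> v \<in> V"
  using A_subset W_subset by blast

lemma diff_A: "u \<in> V \<Longrightarrow> v \<in> A N \<Longrightarrow> u - v \<in> V"
  using diff A_subset_V by blast

lemma nW_nonneg: "w \<in> W \<Longrightarrow> 0 \<le> nW w"
  by (simp add: nW)

lemma summable_diff: "u \<in> V \<Longrightarrow> (\<lambda>l. (norm (a u l))\<^sup>2) summable_on I - F"
  by (rule summable_on_subset_banach[OF square_summable]) auto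

lemma tail_antimono: "u \<in> V \<Longrightarrow> F \<subseteq> G \<Longrightarrow> tail u G \<le> tail u F"
  unfolding tail_def by (intro infsum_mono_neutral summable_diff) auto

abbreviation E :: "'v \<Rightarrow> nat \<Rightarrow> real" where "E u N \<equiv> approx_error nV A N u"
abbreviation K :: "'v \<Rightarrow> real \<Rightarrow> real" where "K u t \<equiv> K_functional nV W nW u t"

lemma A_nonempty: "\<exists>v\<in>A N. \<forall>l\<in>I. a v l = 0"
  using A_exists[of "{}" N] by auto

lemma E_le:
  assumes "u \<in> V" "v \<in> A N" shows "E u N \<le> nV (u - v)"
  unfolding approx_error_def using assms
  by (intro cINF_lower bdd_belowI2[where m = 0] nV_nonneg diff_A)

lemma E_nonneg: "u \<in> V \<Longrightarrow> 0 \<le> E u N"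
  unfolding approx_error_def using A_nonempty[of N]
  by (intro cINF_greatest nV_nonneg diff_A) auto

lemma E_decreasing:
  assumes "u \<in> V" "M \<le> N" shows "E u N \<le> E u M"
  unfolding approx_error_def[of nV A M] using A_nonempty[of M] A_mono[OF assms(2)]
  by (intro cINF_greatest E_le[OF assms(1)]) auto

lemma K_le:
  assumes "u \<in> V" "w \<in> W" "0 < t" shows "K u t \<le> nV (u - w) + t * nW w"
  unfolding K_functional_def using assms W_subset
  by (intro cINF_lower bdd_belowI2[where m = 0] add_nonneg_nonneg mult_nonneg_nonneg nV_nonneg nW_nonneg diff) auto

lemma W_nonempty: "W \<noteq> {}"
  using A_nonempty[of 0] A_subset[of 0] by auto

lemma K_nonneg: "u \<in> V \<Longrightarrow> 0 < t \<Longrightarrow> 0 \<le> K u t"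
  unfolding K_functional_def using W_nonempty W_subset
  by (intro cINF_greatest add_nonneg_nonneg mult_nonneg_nonneg nV_nonneg nW_nonneg diff) auto

lemma K_increasing:
  assumes "u \<in> V" "0 < t" "t \<le> t'" shows "K u t \<le> K u t'"
  unfolding K_functional_def[of nV W nW u t'] using W_nonempty
proof (rule cINF_greatest)
  fix w assume w: "w \<in> W"
  have "K u t \<le> nV (u - w) + t * nW w" by (intro K_le assms w)
  also have "\<dots> \<le> nV (u - w) + t' * nW w" using nW_nonneg[OF w] assms by (simp add: mult_right_mono)
  finally show "K u t \<le> nV (u - w) + t' * nW w" .
qed

text \<open>Restricting the coefficients of \<open>u\<close> to a finite set \<open>F\<close> yields the competitors for the \<open>K\<close>-functional.\<close>

lemma truncation:
  assumes u: "u \<in> V" and F: "finite F" "F \<subseteq> I"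
  obtains v where "v \<in> A (card F)" "\<And>l. l \<in> F \<Longrightarrow> a v l = a u l" "\<And>l. l \<in> I - F \<Longrightarrow> a v l = 0"
    "nV (u - v) \<le> sqrt C * sqrt (tail u F)" "nW v = (\<Sum>l\<in>F. norm (a u l) powr \<tau>) powr (1 / \<tau>)"
proof -
  obtain v where v: "v \<in> A (card F)" "\<And>l. l \<in> F \<Longrightarrow> a v l = a u l" "\<And>l. l \<in> I - F \<Longrightarrow> a v l = 0"
    using A_exists[OF F order_refl, of "a u"] by auto
  have vV: "v \<in> V" and vW: "v \<in> W" using A_subset_V[OF v(1)] subsetD[OF A_subset v(1)] .
  have "(\<Sum>\<^sub>\<infinity>l\<in>I. (norm (a (u - v) l))\<^sup>2) = tail u F"
    unfolding tail_def using v F by (intro infsum_cong_neutral) (auto simp: a_diff[OF u vV])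
  then have "(nV (u - v))\<^sup>2 \<le> C * tail u F" using nV_upper[OF diff[OF u vV]] by simp
  then have "nV (u - v) \<le> sqrt (C * tail u F)" by (rule real_le_rsqrt)
  moreover have "(\<Sum>\<^sub>\<infinity>l\<in>I. norm (a v l) powr \<tau>) = (\<Sum>\<^sub>\<infinity>l\<in>F. norm (a u l) powr \<tau>)"
    using v F by (intro infsum_cong_neutral) auto
  ultimately show ?thesis using that[OF v] F nW[OF vW] by (simp add: real_sqrt_mult)
qed

text \<open>Only the support of an approximant matters: outside its support, the coefficients of \<open>u\<close> are
  part of the error. The slack \<open>e\<close> replaces the attainment of the infimum.\<close>

lemma near_best_set:
  assumes u: "u \<in> V" and e: "0 < e"
  obtains F where "finite F" "F \<subseteq> I" "card F \<le> N" "sqrt (tail u F) \<le> (E u N + e) / sqrt c"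
proof -
  have "(INF v\<in>A N. nV (u - v)) < E u N + e" using e by (simp add: approx_error_def)
  then obtain v where v: "v \<in> A N" "nV (u - v) < E u N + e"
    using A_nonempty[of N] by (subst (asm) cINF_less_iff)
      (auto intro!: bdd_belowI2[where m = 0] nV_nonneg diff_A u)
  obtain F where F: "finite F" "F \<subseteq> I" "card F \<le> N" "\<And>l. l \<in> I - F \<Longrightarrow> a v l = 0"
    using A_support[OF v(1)] by auto
  have vV: "v \<in> V" using v A_subset_V by auto
  have "tail u F \<le> (\<Sum>\<^sub>\<infinity>l\<in>I. (norm (a (u - v) l))\<^sup>2)"
    unfolding tail_def using F by (intro infsum_mono_neutral summable_diff u square_summable diff vV)
      (auto simp: a_diff[OF u vV])
  then have "c * tail u F \<le> (nV (u - v))\<^sup>2"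
    using nV_lower[OF diff[OF u vV]] c by (meson mult_left_mono less_imp_le order_trans)
  then have "sqrt c * sqrt (tail u F) \<le> nV (u - v)"
    using nV_nonneg[OF diff[OF u vV]] by (metis real_sqrt_mult real_le_lsqrt real_sqrt_le_iff real_sqrt_abs abs_of_nonneg)
  then have "sqrt (tail u F) \<le> (E u N + e) / sqrt c" using v(2) c by (simp add: field_simps)
  then show ?thesis using that F by auto
qed

text \<open>For \<open>w\<close> in \<open>W\<close>, an \<open>N\<close>-term approximant of \<open>w\<close> is also one of \<open>u\<close>, at the additional cost of the distance
  from \<open>u\<close> to \<open>w\<close>. Minimising over \<open>w\<close> gives the \<open>K\<close>-functional.\<close>

lemma jackson:
  assumes u: "u \<in> V" and N: "0 < N"
  shows "E u N \<le> (sqrt (2 * C / c) + sqrt (2 * C)) * K u (real N powr (- r))"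
proof -
  define D where "D = sqrt (2 * C / c) + sqrt (2 * C)"
  have D: "0 < D" "sqrt (2 * C / c) \<le> D" "sqrt (2 * C) \<le> D"
    using c C by (auto simp: D_def add_pos_pos)
  have "E u N / D \<le> K u (real N powr (- r))"
    unfolding K_functional_def using W_nonempty
  proof (rule cINF_greatest)
    fix w assume w: "w \<in> W"
    then have wV: "w \<in> V" using W_subset by auto
    obtain F where F: "finite F" "F \<subseteq> I" "card F \<le> N" and
      tl: "(\<Sum>\<^sub>\<infinity>l\<in>I - F. (norm (a w l))\<^sup>2) \<le> (real N powr (- r) * (\<Sum>\<^sub>\<infinity>l\<in>I. norm (a w l) powr \<tau>) powr (1 / \<tau>))\<^sup>2"
      using threshold_set[OF W_summable[OF w] _ square_summable[OF wV] \<tau> r N] by auto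
    have tl: "tail w F \<le> (real N powr (- r) * nW w)\<^sup>2" using tl by (simp add: tail_def nW[OF w])
    obtain v where v: "v \<in> A N" "\<And>l. l \<in> F \<Longrightarrow> a v l = a w l" "\<And>l. l \<in> I - F \<Longrightarrow> a v l = 0"
      using A_exists[OF F, of "a w"] by auto
    have vV: "v \<in> V" using v A_subset_V by auto
    have bound: "(norm (a (u - v) l))\<^sup>2 \<le> 2 * (norm (a (u - w) l))\<^sup>2 + 2 * (norm (a (w - v) l))\<^sup>2"
      if "l \<in> I" for l
    proof -
      have "a (u - v) l = a (u - w) l + a (w - v) l" using that by (simp add: a_diff u vV wV)
      then show ?thesis using norm_add_square_le[of "a (u - w) l" "a (w - v) l"] by simp
    qed
    have wv: "(\<Sum>\<^sub>\<infinity>l\<in>I. (norm (a (w - v) l))\<^sup>2) = tail w F"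
      unfolding tail_def using v F by (intro infsum_cong_neutral) (auto simp: a_diff[OF wV vV])
    have "(\<Sum>\<^sub>\<infinity>l\<in>I. (norm (a (u - v) l))\<^sup>2) \<le>
        (\<Sum>\<^sub>\<infinity>l\<in>I. 2 * (norm (a (u - w) l))\<^sup>2 + 2 * (norm (a (w - v) l))\<^sup>2)"
      by (intro infsum_mono bound summable_on_add summable_on_cmult_right square_summable diff u vV wV)
    also have "\<dots> = 2 * (\<Sum>\<^sub>\<infinity>l\<in>I. (norm (a (u - w) l))\<^sup>2) + 2 * tail w F"
      by (simp add: infsum_add summable_on_cmult_right square_summable diff u vV wV infsum_cmult_right' wv)
    also have "\<dots> \<le> 2 * ((nV (u - w))\<^sup>2 / c) + 2 * (real N powr (- r) * nW w)\<^sup>2"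
      using nV_lower[OF diff[OF u wV]] c tl by (intro add_mono mult_left_mono) (auto simp: field_simps)
    finally have "C * (\<Sum>\<^sub>\<infinity>l\<in>I. (norm (a (u - v) l))\<^sup>2) \<le>
        C * (2 * ((nV (u - w))\<^sup>2 / c) + 2 * (real N powr (- r) * nW w)\<^sup>2)" using C by simp
    with nV_upper[OF diff[OF u vV]] have "(nV (u - v))\<^sup>2 \<le>
        2 * C / c * (nV (u - w))\<^sup>2 + 2 * C * (real N powr (- r) * nW w)\<^sup>2" by (simp add: algebra_simps)
    then have "nV (u - v) \<le> sqrt (2 * C / c * (nV (u - w))\<^sup>2 + 2 * C * (real N powr (- r) * nW w)\<^sup>2)"
      by (rule real_le_rsqrt)
    also have "\<dots> \<le> sqrt (2 * C / c * (nV (u - w))\<^sup>2) + sqrt (2 * C * (real N powr (- r) * nW w)\<^sup>2)"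
      using C c by (intro sqrt_add_le_add_sqrt) auto
    also have "\<dots> = sqrt (2 * C / c) * nV (u - w) + sqrt (2 * C) * (real N powr (- r) * nW w)"
      using nV_nonneg[OF diff[OF u wV]] nW_nonneg[OF w]
      by (simp add: real_sqrt_mult[of "2 * C / c"] real_sqrt_mult[of "2 * C"] del: times_divide_eq_left)
    also have "\<dots> \<le> D * nV (u - w) + D * (real N powr (- r) * nW w)"
      using D nV_nonneg[OF diff[OF u wV]] nW_nonneg[OF w] by (intro add_mono mult_right_mono) auto
    finally have "E u N \<le> D * (nV (u - w) + real N powr (- r) * nW w)"
      using E_le[OF u v(1)] by (simp add: algebra_simps)
    then show "E u N / D \<le> nV (u - w) + real N powr (- r) * nW w"
      using D by (simp add: pos_divide_le_eq mult.commute)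
  qed
  then show ?thesis using D(1) unfolding D_def[symmetric] by (simp add: pos_divide_le_eq mult.commute)
qed

text \<open>Let \<open>S k\<close> be a nearly best set of size \<open>2\<^sup>k\<close> and \<open>T m\<close> the union of \<open>S 0, \<dots>, S m\<close>. The restriction of \<open>u\<close> to
  \<open>T m\<close> approximates \<open>u\<close> at least as well as that to \<open>S m\<close>. Passing from \<open>T m\<close> to \<open>T (m + 1)\<close> adds at most
  \<open>2\<^sup>m\<^sup>+\<^sup>1\<close> entries, whose \<open>\<ell>\<^sup>2\<close> norm is at most the error of \<open>S m\<close> because they lie outside \<open>S m\<close>. As the
  added sets are disjoint, the \<open>\<tau>\<close>-th powers of the \<open>\<ell>\<^sup>\<tau>\<close> norms satisfy an additive recursion, and after
  rescaling by \<open>2 powr (- m (r - s) \<tau>)\<close> it is contractive since \<open>s < r\<close>.\<close>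

lemma K_dyadic_of_E_dyadic:
  assumes u: "u \<in> V" and \<kappa>: "0 < \<kappa>" and s: "0 < s" "s < r"
    and E: "in_ell \<kappa> (\<lambda>m. 2 powr (real m * s) * E u (2 ^ m))"
  shows "in_ell \<kappa> (\<lambda>m. 2 powr (real m * s) * K u (2 powr (- (real m * r))))"
proof -
  \<comment> \<open>The slack \<open>2 powr (- m r)\<close> decays fast enough to be harmless after multiplication by \<open>2 powr (m s)\<close>.\<close>
  define d where "d m = (E u (2 ^ m) + 2 powr (- (real m * r))) / sqrt c" for m
  have d0: "0 \<le> d m" for m using E_nonneg[OF u] c by (simp add: d_def)
  have d: "in_ell \<kappa> (\<lambda>m. 2 powr (real m * s) * d m)"
  proof (rule in_ell_mono[OF \<kappa>])
    show "in_ell \<kappa> (\<lambda>m. 2 powr (real m * s) * E u (2 ^ m) + 2 powr (real m * (s - r)))"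
      using s E_nonneg[OF u] by (intro in_ell_add[OF \<kappa> E] in_ell_geometric \<kappa>) auto
    fix m
    have "2 powr (real m * s) * d m = 1 / sqrt c *
        (2 powr (real m * s) * E u (2 ^ m) + 2 powr (real m * s) * 2 powr (- (real m * r)))"
      by (simp add: d_def field_simps)
    also have "2 powr (real m * s) * 2 powr (- (real m * r)) = 2 powr (real m * (s - r))"
      by (simp add: powr_add[symmetric] algebra_simps)
    finally show "2 powr (real m * s) * d m \<le> 1 / sqrt c *
        (2 powr (real m * s) * E u (2 ^ m) + 2 powr (real m * (s - r)))" by simp
  qed (use c d0 E_nonneg[OF u] in auto)
  have "\<exists>F. finite F \<and> F \<subseteq> I \<and> card F \<le> 2 ^ m \<and> sqrt (tail u F) \<le> d m" for m
    using near_best_set[OF u, of "2 powr (- (real m * r))" "2 ^ m"] unfolding d_def by (metis powr_gt_zero zero_neq_numeral)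
  then obtain S where S: "\<And>m. finite (S m)" "\<And>m. S m \<subseteq> I" "\<And>m. card (S m) \<le> 2 ^ m"
    "\<And>m. sqrt (tail u (S m)) \<le> d m" by metis
  define T where "T m = (\<Union>k\<le>m. S k)" for m
  have T: "finite (T m)" "T m \<subseteq> I" "S m \<subseteq> T m" for m using S by (auto simp: T_def)
  define Z where "Z m = (\<Sum>l\<in>T m. norm (a u l) powr \<tau>)" for m
  have Z0: "0 \<le> Z m" for m by (simp add: Z_def sum_nonneg)
  have Zstep: "Z (Suc m) \<le> Z m + 2 powr (real (Suc m) * r * \<tau>) * d m powr \<tau>" for m
  proof -
    let ?G = "S (Suc m) - T m"
    have "T (Suc m) = T m \<union> ?G" by (auto simp: T_def atMost_Suc)
    then have "Z (Suc m) = Z m + (\<Sum>l\<in>?G. norm (a u l) powr \<tau>)"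
      unfolding Z_def using T(1) S(1) by (metis Diff_disjoint finite_Diff sum.union_disjoint)
    also have "(\<Sum>l\<in>?G. norm (a u l) powr \<tau>) \<le>
        real (2 ^ Suc m) powr (1 - \<tau> / 2) * (\<Sum>l\<in>?G. (norm (a u l))\<^sup>2) powr (\<tau> / 2)"
    proof (rule power_sum_le)
      have "card ?G \<le> 2 ^ Suc m" using S(3)[of "Suc m"] card_mono[OF S(1)[of "Suc m"], of ?G] by auto
      then show "real (card ?G) \<le> real (2 ^ Suc m)" by (rule of_nat_mono)
    qed (use S \<tau>_pos \<tau>_less_2 in auto)
    also have "1 - \<tau> / 2 = r * \<tau>" using \<tau> \<tau>_pos by (simp add: field_simps)
    also have "(\<Sum>l\<in>?G. (norm (a u l))\<^sup>2) powr (\<tau> / 2) \<le> d m powr \<tau>"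
    proof -
      have "(\<Sum>l\<in>?G. (norm (a u l))\<^sup>2) \<le> tail u (S m)"
        unfolding tail_def using S T(3)[of m] by (intro finite_sum_le_infsum summable_diff u) auto
      also have "\<dots> \<le> (d m)\<^sup>2" using S(4)[of m] d0[of m] by (metis sqrt_le_D)
      finally have "(\<Sum>l\<in>?G. (norm (a u l))\<^sup>2) powr (\<tau> / 2) \<le> ((d m)\<^sup>2) powr (\<tau> / 2)"
        using \<tau>_pos by (intro powr_mono2 sum_nonneg) auto
      also have "\<dots> = d m powr \<tau>" using d0[of m] powr_powr[of "d m" 2 "\<tau> / 2"]
        by (cases "d m = 0") (auto simp: powr_numeral)
      finally show ?thesis .
    qed
    finally show ?thesis unfolding two_powr_nat by (simp add: mult.assoc mult_left_mono)
  qed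
  define z where "z m = 2 powr (- (real m * (r - s) * \<tau>)) * Z m" for m
  define x where "x m = (2 powr (real (Suc m) * s) * d m) powr \<tau>" for m
  define \<rho> :: real where "\<rho> = 2 powr (- ((r - s) * \<tau>))"
  have z: "in_ell \<kappa> (\<lambda>m. z m powr (1 / \<tau>))"
  proof (rule in_ell_recursion[OF \<kappa> _ \<tau>_pos])
    have "x m powr (1 / \<tau>) = 2 powr s * (2 powr (real m * s) * d m)" for m
      using \<tau>_pos d0[of m] by (simp add: x_def powr_powr powr_add[symmetric] algebra_simps)
    moreover have "in_ell \<kappa> (\<lambda>m. 2 powr s * (2 powr (real m * s) * d m))"
      by (rule in_ell_mono[OF \<kappa> d, where C = "2 powr s"]) (auto simp: d0)
    ultimately show "in_ell \<kappa> (\<lambda>m. x m powr (1 / \<tau>))" by simp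
    show "0 \<le> \<rho>" "\<rho> < 1"
      using s \<tau>_pos powr_less_mono[of "- ((r - s) * \<tau>)" 0 2] by (auto simp: \<rho>_def)
    show "0 \<le> z m" "0 \<le> x m" for m by (auto simp: z_def x_def Z0)
    fix m
    have "z (Suc m) \<le> 2 powr (- (real (Suc m) * (r - s) * \<tau>)) * (Z m + 2 powr (real (Suc m) * r * \<tau>) * d m powr \<tau>)"
      unfolding z_def by (intro mult_left_mono Zstep) simp
    also have "\<dots> = 2 powr (- (real (Suc m) * (r - s) * \<tau>)) * Z m +
        (2 powr (- (real (Suc m) * (r - s) * \<tau>)) * 2 powr (real (Suc m) * r * \<tau>)) * d m powr \<tau>"
      by (simp only: distrib_left mult_ac)
    also have "2 powr (- (real (Suc m) * (r - s) * \<tau>)) = \<rho> * 2 powr (- (real m * (r - s) * \<tau>))"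
      by (simp add: \<rho>_def powr_add[symmetric] algebra_simps)
    also have "\<rho> * 2 powr (- (real m * (r - s) * \<tau>)) * 2 powr (real (Suc m) * r * \<tau>) = 2 powr (real (Suc m) * s * \<tau>)"
      by (simp add: \<rho>_def powr_add[symmetric] algebra_simps)
    also have "2 powr (real (Suc m) * s * \<tau>) * d m powr \<tau> = x m"
      by (simp add: x_def powr_mult d0 powr_powr)
    finally show "z (Suc m) \<le> \<rho> * z m + x m" by (simp add: z_def mult.assoc)
  qed
  have "in_ell \<kappa> (\<lambda>m. sqrt C * (2 powr (real m * s) * d m) + z m powr (1 / \<tau>))"
  proof (rule in_ell_add[OF \<kappa> _ z])
    show "in_ell \<kappa> (\<lambda>m. sqrt C * (2 powr (real m * s) * d m))"
      by (rule in_ell_mono[OF \<kappa> d, where C = "sqrt C"]) (use d0 C in auto)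
  qed (use C d0 in auto)
  then show ?thesis
  proof (rule in_ell_mono[OF \<kappa>, where C = 1])
    fix m
    obtain v where v: "v \<in> A (card (T m))" "nV (u - v) \<le> sqrt C * sqrt (tail u (T m))"
      "nW v = Z m powr (1 / \<tau>)"
      using truncation[OF u T(1,2)[of m]] unfolding Z_def by metis
    have "sqrt (tail u (T m)) \<le> d m"
      using tail_antimono[OF u T(3)[of m]] S(4)[of m] by (meson order_trans real_sqrt_le_mono)
    then have "nV (u - v) \<le> sqrt C * d m" using v(2) C by (meson mult_left_mono order_trans real_sqrt_ge_zero less_imp_le)
    then have "K u (2 powr (- (real m * r))) \<le> sqrt C * d m + 2 powr (- (real m * r)) * Z m powr (1 / \<tau>)"
      using K_le[OF u, of v "2 powr (- (real m * r))"] A_subset v by force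
    then have "2 powr (real m * s) * K u (2 powr (- (real m * r))) \<le>
        2 powr (real m * s) * (sqrt C * d m + 2 powr (- (real m * r)) * Z m powr (1 / \<tau>))"
      by (intro mult_left_mono) auto
    also have "\<dots> = sqrt C * (2 powr (real m * s) * d m) +
        (2 powr (real m * s) * 2 powr (- (real m * r))) * Z m powr (1 / \<tau>)"
      by (simp only: distrib_left mult_ac)
    also have "2 powr (real m * s) * 2 powr (- (real m * r)) = (2 powr (- (real m * (r - s) * \<tau>))) powr (1 / \<tau>)"
      using \<tau>_pos by (simp add: powr_powr powr_add[symmetric] algebra_simps)
    also have "\<dots> * Z m powr (1 / \<tau>) = z m powr (1 / \<tau>)" by (simp add: z_def powr_mult Z0)
    finally show "2 powr (real m * s) * K u (2 powr (- (real m * r))) \<le>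
       1 * (sqrt C * (2 powr (real m * s) * d m) + z m powr (1 / \<tau>))" by simp
  qed (use K_nonneg[OF u] C d0 in auto)
qed

theorem approx_space_eq_interp_space:
  assumes \<kappa>: "0 < \<kappa>" and s: "0 < s" "s < r"
  shows "approx_space V nV A s \<kappa> = interp_space V nV W nW (s / r) \<kappa>"
proof (intro set_eqI)
  fix u
  show "u \<in> approx_space V nV A s \<kappa> \<longleftrightarrow> u \<in> interp_space V nV W nW (s / r) \<kappa>"
  proof (cases "u \<in> V")
    case u: True
    obtain w where w: "w \<in> A 0" "\<And>l. l \<in> I \<Longrightarrow> a w l = 0" using A_nonempty[of 0] by auto
    have wW: "w \<in> W" using subsetD[OF A_subset w(1)] .
    have "(\<Sum>\<^sub>\<infinity>l\<in>I. norm (a w l) powr \<tau>) = 0" using w(2) by (intro infsum_0) simp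
    then have "nW w = 0" using nW[OF wW] by simp
    then have B: "K u t \<le> nV (u - w)" if "0 < t" for t
      using K_le[OF u wW that] by simp
    have "in_ell \<kappa> (\<lambda>m. 2 powr (real m * s) * E u (2 ^ m))"
      if "in_ell \<kappa> (\<lambda>m. 2 powr (real m * s) * K u (2 powr (- (real m * r))))"
    proof (rule in_ell_mono[OF \<kappa> that, where C = "sqrt (2 * C / c) + sqrt (2 * C)"])
      fix m
      have "real (2 ^ m) powr - r = 2 powr (- (real m * r))" unfolding two_powr_nat by simp
      then have "E u (2 ^ m) \<le> (sqrt (2 * C / c) + sqrt (2 * C)) * K u (2 powr (- (real m * r)))"
        using jackson[OF u, of "2 ^ m"] by simp
      then have "2 powr (real m * s) * E u (2 ^ m) \<le>
          2 powr (real m * s) * ((sqrt (2 * C / c) + sqrt (2 * C)) * K u (2 powr (- (real m * r))))"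
        by (intro mult_left_mono) auto
      then show "2 powr (real m * s) * E u (2 ^ m) \<le> (sqrt (2 * C / c) + sqrt (2 * C)) *
          (2 powr (real m * s) * K u (2 powr (- (real m * r))))" by (simp only: mult_ac)
    qed (use E_nonneg[OF u] K_nonneg[OF u] c C in auto)
    then have "in_ell \<kappa> (\<lambda>m. 2 powr (real m * s) * E u (2 ^ m)) \<longleftrightarrow>
       in_ell \<kappa> (\<lambda>m. 2 powr (real m * s) * K u (2 powr (- (real m * r))))"
      using K_dyadic_of_E_dyadic[OF u \<kappa> s] by blast
    then show ?thesis
      using approx_space_dyadic[OF E_nonneg[OF u] E_decreasing[OF u] s(1) \<kappa>, of V]
        interp_space_dyadic[OF K_nonneg[OF u] K_increasing[OF u] B r s(1) \<kappa>, of V] by simp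
  qed (auto simp: approx_space_def interp_space_def)
qed

end

section \<open>Integration of tensor products\<close>

lemma measurable_vec_lambda_PiM:
  "(\<lambda>f. \<chi> i. f i) \<in> (\<Pi>\<^sub>M i\<in>(UNIV::'n::finite set). (lborel::real measure)) \<rightarrow>\<^sub>M (borel :: (real ^ 'n) measure)"
  by (subst borel_measurable_euclidean_space) (auto simp: Basis_vec_def inner_axis)

text \<open>This identification carries Fubini's theorem for products over an index set over to Lebesgue measure on
  vectors.\<close>

lemma lborel_vec_eq_distr:
  "(lborel :: (real ^ 'n::finite) measure) = distr (\<Pi>\<^sub>M i\<in>(UNIV::'n set). lborel) borel (\<lambda>f. \<chi> i. f i)"
proof (rule lborel_eqI)
  interpret product_sigma_finite "\<lambda>_::'n. lborel :: real measure" ..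
  fix l u :: "real ^ 'n" assume lu: "\<And>b. b \<in> Basis \<Longrightarrow> l \<bullet> b \<le> u \<bullet> b"
  have le: "l $ i \<le> u $ i" for i using lu[of "axis i 1"] by (simp add: axis_in_Basis_iff inner_axis)
  have "emeasure (distr (\<Pi>\<^sub>M i\<in>(UNIV::'n set). lborel) borel (\<lambda>f. \<chi> i. f i)) (box l u) =
      emeasure (\<Pi>\<^sub>M i\<in>(UNIV::'n set). lborel) (Pi\<^sub>E UNIV (\<lambda>i. {l $ i<..<u $ i}))"
    by (subst emeasure_distr[OF measurable_vec_lambda_PiM])
      (auto simp: mem_box_cart space_PiM PiE_def Pi_def intro!: arg_cong[where f = "emeasure _"])
  also have "\<dots> = (\<Prod>i\<in>UNIV. ennreal (u $ i - l $ i))"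
    by (subst emeasure_PiM) (auto simp: le)
  also have "\<dots> = ennreal (\<Prod>i\<in>UNIV. u $ i - l $ i)" using le by (simp add: prod_ennreal)
  also have "(\<Prod>i\<in>UNIV. u $ i - l $ i) = (\<Prod>b\<in>Basis. (u - l) \<bullet> b)"
    by (intro prod.reindex_bij_witness[of _ "\<lambda>b. THE i. b = axis i 1" "\<lambda>i. axis i 1"])
      (auto simp: Basis_vec_def inner_axis axis_eq_axis)
  finally show "emeasure (distr (\<Pi>\<^sub>M i\<in>(UNIV::'n set). lborel) borel (\<lambda>f. \<chi> i. f i)) (box l u) =
      ennreal (\<Prod>b\<in>Basis. (u - l) \<bullet> b)" .
qed simp

lemma nn_integral_tensor:
  fixes g :: "'n::finite \<Rightarrow> real \<Rightarrow> ennreal"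
  assumes [measurable]: "\<And>i. g i \<in> borel_measurable borel"
  shows "(\<integral>\<^sup>+ x. (\<Prod>i\<in>UNIV. g i (x $ i)) \<partial>lborel) = (\<Prod>i\<in>UNIV. \<integral>\<^sup>+ y. g i y \<partial>lborel)"
proof -
  interpret product_sigma_finite "\<lambda>_::'n. lborel :: real measure" ..
  show ?thesis
    by (subst lborel_vec_eq_distr, subst nn_integral_distr[OF measurable_vec_lambda_PiM])
      (simp_all add: product_nn_integral_prod)
qed

lemma integrable_tensor:
  fixes g :: "'n::finite \<Rightarrow> real \<Rightarrow> complex"
  assumes "\<And>i. integrable lborel (g i)"
  shows "integrable lborel (\<lambda>x. \<Prod>i\<in>UNIV. g i (x $ i))"
    and "(LINT x|lborel. (\<Prod>i\<in>UNIV. g i (x $ i))) = (\<Prod>i\<in>UNIV. (LINT y|lborel. g i y))"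
proof -
  interpret product_sigma_finite "\<lambda>_::'n. lborel :: real measure" ..
  have [measurable]: "g i \<in> borel_measurable borel" for i
    using borel_measurable_integrable[OF assms[of i]] by simp
  have m: "(\<lambda>x::real ^ 'n. \<Prod>i\<in>UNIV. g i (x $ i)) \<in> borel_measurable borel" by measurable
  show "integrable lborel (\<lambda>x. \<Prod>i\<in>UNIV. g i (x $ i))"
    by (subst lborel_vec_eq_distr, subst integrable_distr_eq[OF measurable_vec_lambda_PiM m])
      (simp add: product_integrable_prod assms)
  show "(LINT x|lborel. (\<Prod>i\<in>UNIV. g i (x $ i))) = (\<Prod>i\<in>UNIV. (LINT y|lborel. g i y))"
    by (subst lborel_vec_eq_distr, subst integral_distr[OF measurable_vec_lambda_PiM m])
      (simp add: product_integral_prod assms)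
qed

text \<open>The measure of a cylinder over a null set is a product with a vanishing factor.\<close>

lemma AE_component:
  assumes "AE y in lborel. Q (y::real)"
  shows "AE x in lborel. Q ((x :: real ^ 'n::finite) $ i)"
proof -
  obtain N where N: "{y. \<not> Q y} \<subseteq> N" "N \<in> sets borel" "emeasure lborel N = 0"
    using AE_E[OF assms] by auto
  note N(2)[measurable]
  have "emeasure lborel {x::real ^ 'n. x $ i \<in> N} = (\<integral>\<^sup>+ x. indicator {x. x $ i \<in> N} x \<partial>(lborel :: (real ^ 'n) measure))"
    by (subst nn_integral_indicator) auto
  also have "\<dots> = (\<integral>\<^sup>+ x. (\<Prod>k\<in>UNIV. if k = i then indicator N ((x::real ^ 'n) $ k) else 1) \<partial>lborel)"
    by (intro nn_integral_cong) (simp add: indicator_def)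
  also have "\<dots> = (\<Prod>k\<in>UNIV. \<integral>\<^sup>+ y. (if k = i then indicator N y else 1) \<partial>(lborel :: real measure))"
    by (rule nn_integral_tensor) measurable
  also have "\<dots> = 0"
  proof (rule prod_zero)
    have "(\<integral>\<^sup>+ y. (if i = i then indicator N y else 1) \<partial>(lborel :: real measure)) = 0" using N by simp
    then show "\<exists>k\<in>UNIV. (\<integral>\<^sup>+ y. (if k = i then indicator N y else 1) \<partial>(lborel :: real measure)) = 0"
      by (intro bexI[of _ i]) auto
  qed simp
  finally show ?thesis using N by (intro AE_I[of _ _ "{x. x $ i \<in> N}"]) auto
qed

section \<open>Square-integrable functions on the cube\<close>

lemma borel_measurable_cnj_comp [measurable]:
  "f \<in> borel_measurable M \<Longrightarrow> (\<lambda>x. cnj (f x)) \<in> borel_measurable M"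
  using borel_measurable_continuous_on[of cnj f M] by (simp add: continuous_on_cnj)

lemma cube_in_sets [simp]: "cbox 0 One \<inter> space lborel \<in> sets lborel" by simp

lemma measurable_cube_iff:
  fixes f :: "'a::euclidean_space \<Rightarrow> complex"
  shows "f \<in> borel_measurable cube \<longleftrightarrow> (\<lambda>x. indicator (cbox 0 One) x *\<^sub>R f x) \<in> borel_measurable borel"
  unfolding cube_def by (subst borel_measurable_restrict_space_iff) auto

lemma AE_cube_iff: "(AE x in cube. Q x) \<longleftrightarrow> (AE x in lborel. x \<in> cbox 0 One \<longrightarrow> Q x)"
  unfolding cube_def by (rule AE_restrict_space_iff) simp

lemma cube_component: "x \<in> cbox 0 (One :: real ^ 'n::finite) \<longleftrightarrow> (\<forall>i. x $ i \<in> cbox 0 (One::real))"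
proof -
  have "x \<in> cbox 0 (One :: real ^ 'n) \<longleftrightarrow> (\<forall>b\<in>Basis. 0 \<le> x \<bullet> b \<and> x \<bullet> b \<le> 1)"
    by (simp add: mem_box)
  also have "\<dots> \<longleftrightarrow> (\<forall>i. x $ i \<in> cbox 0 (One::real))"
    by (auto simp: Basis_vec_def inner_axis)
  finally show ?thesis .
qed

text \<open>The squared norm as an extended nonnegative number, which makes sense before integrability is known.\<close>

definition square_integral :: "('a::euclidean_space \<Rightarrow> complex) \<Rightarrow> ennreal" where
  "square_integral f = (\<integral>\<^sup>+ x. ennreal ((norm (f x))\<^sup>2) \<partial>cube)"

lemma L2_iff: "f \<in> L2 \<longleftrightarrow> f \<in> borel_measurable cube \<and> square_integral f < \<infinity>"
  unfolding L2_def square_integral_def by (auto simp: integrable_iff_bounded)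

lemma L2_measurable [measurable_dest]: "f \<in> L2 \<Longrightarrow> f \<in> borel_measurable cube"
  by (simp add: L2_iff)

lemma l2_norm_eq: "f \<in> L2 \<Longrightarrow> ennreal ((l2_norm f)\<^sup>2) = square_integral f"
  unfolding L2_def square_integral_def l2_norm_def
  by (subst nn_integral_eq_integral) auto

lemma L2_add_scale:
  assumes [measurable]: "f \<in> L2" "g \<in> L2"
  shows "(\<lambda>x. a * f x + b * g x) \<in> L2"
proof -
  have "square_integral (\<lambda>x. a * f x + b * g x) \<le> (\<integral>\<^sup>+ x. ennreal (2 * (norm a)\<^sup>2) * ennreal ((norm (f x))\<^sup>2) +
       ennreal (2 * (norm b)\<^sup>2) * ennreal ((norm (g x))\<^sup>2) \<partial>cube)"
    unfolding square_integral_def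
  proof (intro nn_integral_mono)
    fix x
    have "(norm (a * f x + b * g x))\<^sup>2 \<le> 2 * (norm (a * f x))\<^sup>2 + 2 * (norm (b * g x))\<^sup>2"
      by (rule norm_add_square_le)
    then show "ennreal ((norm (a * f x + b * g x))\<^sup>2) \<le>
      ennreal (2 * (norm a)\<^sup>2) * ennreal ((norm (f x))\<^sup>2) + ennreal (2 * (norm b)\<^sup>2) * ennreal ((norm (g x))\<^sup>2)"
      by (simp add: ennreal_mult[symmetric] ennreal_plus[symmetric] norm_mult power_mult_distrib mult.assoc del: ennreal_plus)
  qed
  also have "\<dots> = ennreal (2 * (norm a)\<^sup>2) * square_integral f + ennreal (2 * (norm b)\<^sup>2) * square_integral g"
    unfolding square_integral_def by (simp add: nn_integral_add nn_integral_cmult)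
  also have "\<dots> < \<infinity>" using assms by (auto simp: L2_iff ennreal_mult_less_top)
  finally show ?thesis by (simp add: L2_iff)
qed

lemma L2_diff: "f \<in> L2 \<Longrightarrow> g \<in> L2 \<Longrightarrow> f - g \<in> L2"
  using L2_add_scale[of f g 1 "-1"] by (simp add: fun_diff_def)

lemma L2_zero: "(\<lambda>x. 0) \<in> L2" by (simp add: L2_iff square_integral_def)

lemma lincomb_insert: "finite F \<Longrightarrow> i \<notin> F \<Longrightarrow> lincomb b (insert i F) c = (\<lambda>x. c i * b i x + lincomb b F c x)"
  by (simp add: lincomb_def)

lemma L2_lincomb:
  assumes "finite F" "\<And>i. i \<in> F \<Longrightarrow> b i \<in> L2" shows "lincomb b F c \<in> L2"
  using assms
proof (induction F rule: finite_induct)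
  case (insert i F)
  then show ?case using L2_add_scale[of "b i" "lincomb b F c" "c i" 1] by (simp add: lincomb_insert)
qed (simp add: lincomb_def L2_zero)

lemma L2_inner_integrable:
  assumes [measurable]: "v \<in> L2" "f \<in> L2"
  shows "integrable cube (\<lambda>x. cnj (v x) * f x)"
proof (rule Bochner_Integration.integrable_bound)
  note assms[THEN L2_measurable, measurable]
  show "(\<lambda>x. cnj (v x) * f x) \<in> borel_measurable cube" by measurable
  show "integrable cube (\<lambda>x. (norm (v x))\<^sup>2 + (norm (f x))\<^sup>2)"
    using assms by (auto simp: L2_def)
  show "AE x in cube. norm (cnj (v x) * f x) \<le> norm ((norm (v x))\<^sup>2 + (norm (f x))\<^sup>2)"
  proof (intro AE_I2)
    fix x
    show "norm (cnj (v x) * f x) \<le> norm ((norm (v x))\<^sup>2 + (norm (f x))\<^sup>2)"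
      using sum_squares_bound[of "norm (v x)" "norm (f x)"]
        mult_nonneg_nonneg[OF norm_ge_zero norm_ge_zero, of "v x" "f x"]
      unfolding norm_mult complex_mod_cnj real_norm_def by linarith
  qed
qed

lemma l2_Cauchy_Schwarz:
  assumes [measurable]: "v \<in> L2" "f \<in> L2"
  shows "norm (l2_inner v f) \<le> l2_norm v * l2_norm f"
proof -
  have "ennreal (norm (l2_inner v f)) \<le> (\<integral>\<^sup>+ x. ennreal (norm (cnj (v x) * f x)) \<partial>cube)"
    unfolding l2_inner_def by (rule integral_norm_bound_ennreal) (rule L2_inner_integrable; fact)
  also have "\<dots> = (\<integral>\<^sup>+ x. ennreal (norm (v x)) * ennreal (norm (f x)) \<partial>cube)"
    by (simp add: norm_mult ennreal_mult)
  finally have "(ennreal (norm (l2_inner v f)))\<^sup>2 \<le> (\<integral>\<^sup>+ x. ennreal (norm (v x)) * ennreal (norm (f x)) \<partial>cube)\<^sup>2"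
    by (rule power_mono) simp
  also have "\<dots> \<le> (\<integral>\<^sup>+ x. (ennreal (norm (v x)))\<^sup>2 \<partial>cube) * (\<integral>\<^sup>+ x. (ennreal (norm (f x)))\<^sup>2 \<partial>cube)"
    by (rule Cauchy_Schwarz_nn_integral) measurable
  also have "\<dots> = ennreal ((l2_norm v)\<^sup>2) * ennreal ((l2_norm f)\<^sup>2)"
    unfolding l2_norm_eq[OF assms(1)] l2_norm_eq[OF assms(2)] square_integral_def by (simp add: ennreal_power)
  also have "\<dots> = ennreal ((l2_norm v * l2_norm f)\<^sup>2)" by (simp add: ennreal_mult power_mult_distrib)
  finally have "(norm (l2_inner v f))\<^sup>2 \<le> (l2_norm v * l2_norm f)\<^sup>2"
    by (simp add: ennreal_power)
  then show ?thesis by (rule power2_le_imp_le) (simp add: l2_norm_def)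
qed

lemma l2_inner_antilinear:
  assumes "v \<in> L2" "w \<in> L2" "f \<in> L2"
  shows "l2_inner (\<lambda>x. a * v x + b * w x) f = cnj a * l2_inner v f + cnj b * l2_inner w f"
  using L2_inner_integrable[OF assms(1,3)] L2_inner_integrable[OF assms(2,3)]
  unfolding l2_inner_def by (simp add: algebra_simps)

lemma l2_inner_linear:
  assumes "v \<in> L2" "f \<in> L2" "g \<in> L2"
  shows "l2_inner v (\<lambda>x. a * f x + b * g x) = a * l2_inner v f + b * l2_inner v g"
  using L2_inner_integrable[OF assms(1,2)] L2_inner_integrable[OF assms(1,3)]
  unfolding l2_inner_def by (simp add: algebra_simps)

lemma l2_inner_diff:
  assumes "v \<in> L2" "f \<in> L2" "g \<in> L2"
  shows "l2_inner v (f - g) = l2_inner v f - l2_inner v g"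
  using l2_inner_linear[OF assms, of 1 "-1"] by (simp add: fun_diff_def)

lemma l2_inner_lincomb:
  assumes "v \<in> L2" "finite F" "\<And>i. i \<in> F \<Longrightarrow> b i \<in> L2"
  shows "l2_inner v (lincomb b F c) = (\<Sum>i\<in>F. c i * l2_inner v (b i))"
  using assms(2,3)
proof (induction F rule: finite_induct)
  case (insert i F)
  then show ?case using l2_inner_linear[OF assms(1), of "b i" "lincomb b F c" "c i" 1]
    by (simp add: lincomb_insert L2_lincomb)
qed (simp add: lincomb_def l2_inner_def)

text \<open>The cube is itself a product, hence integrals over it factorise like those over the whole space.\<close>

lemma indicator_cube_tensor:
  "indicator (cbox 0 (One :: real ^ 'n::finite)) x *\<^sub>R (\<Prod>i\<in>UNIV. h i (x $ i)) =
   (\<Prod>i\<in>UNIV. indicator (cbox 0 (One::real)) (x $ i) *\<^sub>R (h i (x $ i) :: complex))"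
proof (cases "x \<in> cbox 0 (One :: real ^ 'n)")
  case True
  then have "indicator (cbox 0 (One::real)) (x $ i) = (1::real)" for i by (simp only: cube_component indicator_simps)
  then show ?thesis using True by simp
next
  case False
  then obtain i where "x $ i \<notin> cbox 0 (One::real)" by (auto simp only: cube_component)
  then have "indicator (cbox 0 (One::real)) (x $ i) = (0::real)" by (rule indicator_simps(2))
  then have "\<exists>i\<in>UNIV. indicator (cbox 0 (One::real)) (x $ i) *\<^sub>R (h i (x $ i) :: complex) = 0"
    by (intro bexI[of _ i]) (simp_all only: scaleR_zero_left UNIV_I)
  then show ?thesis using False by (simp add: prod_zero)
qed

lemma L2_tensor:
  fixes l :: "'n::finite \<Rightarrow> int \<times> 'k"
  assumes "\<And>i. \<psi> (l i) \<in> L2"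
  shows "tensor \<psi> l \<in> L2"
proof -
  let ?I = "indicator (cbox 0 (One::real)) :: real \<Rightarrow> real"
  define G where "G i y = ?I y *\<^sub>R \<psi> (l i) y" for i y
  have m: "G i \<in> borel_measurable borel" for i
    using L2_measurable[OF assms[of i]] unfolding measurable_cube_iff G_def .
  note m[measurable]
  have 1: "tensor \<psi> l \<in> borel_measurable cube"
    unfolding measurable_cube_iff tensor_def indicator_cube_tensor[where h = "\<lambda>i. \<psi> (l i)"] G_def[symmetric] by measurable
  have fin: "(\<integral>\<^sup>+ y. ennreal ((norm (G i y))\<^sup>2) \<partial>lborel) < \<infinity>" for i
  proof -
    have "square_integral (\<psi> (l i)) < \<infinity>" using assms[of i] by (simp add: L2_iff)
    moreover have "square_integral (\<psi> (l i)) = (\<integral>\<^sup>+ y. ennreal ((norm (G i y))\<^sup>2) \<partial>lborel)"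
      unfolding square_integral_def cube_def by (subst nn_integral_restrict_space)
        (auto intro!: nn_integral_cong simp: G_def split: split_indicator)
    ultimately show ?thesis by simp
  qed
  have "square_integral (tensor \<psi> l) = (\<integral>\<^sup>+ x. (\<Prod>i\<in>UNIV. ennreal ((norm (G i (x $ i)))\<^sup>2)) \<partial>lborel)"
    unfolding square_integral_def cube_def
  proof (subst nn_integral_restrict_space, simp, intro nn_integral_cong)
    fix x :: "real ^ 'n"
    have "ennreal ((norm (tensor \<psi> l x))\<^sup>2) * indicator (cbox 0 One) x =
       ennreal ((norm (indicator (cbox 0 One) x *\<^sub>R tensor \<psi> l x))\<^sup>2)" by (auto split: split_indicator)
    also have "\<dots> = (\<Prod>i\<in>UNIV. ennreal ((norm (G i (x $ i)))\<^sup>2))"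
      unfolding tensor_def indicator_cube_tensor[where h = "\<lambda>i. \<psi> (l i)"] G_def[symmetric] by (simp only: prod_norm[symmetric] prod_power_distrib) (simp add: prod_ennreal)
    finally show "ennreal ((norm (tensor \<psi> l x))\<^sup>2) * indicator (cbox 0 One) x =
      (\<Prod>i\<in>UNIV. ennreal ((norm (G i (x $ i)))\<^sup>2))" .
  qed
  also have "\<dots> = (\<Prod>i\<in>UNIV. \<integral>\<^sup>+ y. ennreal ((norm (G i y))\<^sup>2) \<partial>lborel)"
    by (rule nn_integral_tensor) measurable
  also have "\<dots> < \<infinity>" using fin by (simp add: less_top[symmetric] ennreal_prod_eq_top)
  finally show ?thesis using 1 by (simp add: L2_iff)
qed

lemma l2_inner_tensor:
  fixes l l' :: "'n::finite \<Rightarrow> int \<times> 'k"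
  assumes "\<And>i. \<psi> (l i) \<in> L2" "\<And>i. \<psi>' (l' i) \<in> L2"
  shows "l2_inner (tensor \<psi>' l') (tensor \<psi> l) = (\<Prod>i\<in>UNIV. l2_inner (\<psi>' (l' i)) (\<psi> (l i)))"
proof -
  let ?I = "indicator (cbox 0 (One::real)) :: real \<Rightarrow> real"
  define h where "h i y = cnj (\<psi>' (l' i) y) * \<psi> (l i) y" for i y
  have int: "integrable lborel (\<lambda>y. ?I y *\<^sub>R h i y)" for i
    using L2_inner_integrable[OF assms(2,1)] unfolding cube_def h_def
    by (subst (asm) integrable_restrict_space) auto
  have "l2_inner (tensor \<psi>' l') (tensor \<psi> l) = (LINT x|lborel. indicator (cbox 0 One) x *\<^sub>R (\<Prod>i\<in>UNIV. h i (x $ i)))"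
    unfolding l2_inner_def cube_def tensor_def h_def by (subst integral_restrict_space) (auto simp: prod.distrib)
  also have "\<dots> = (\<Prod>i\<in>UNIV. (LINT y|lborel. ?I y *\<^sub>R h i y))"
    unfolding indicator_cube_tensor by (rule integrable_tensor(2)) (rule int)
  also have "\<dots> = (\<Prod>i\<in>UNIV. l2_inner (\<psi>' (l' i)) (\<psi> (l i)))"
    unfolding l2_inner_def cube_def h_def by (subst integral_restrict_space) auto
  finally show ?thesis .
qed

section \<open>Fourier transforms\<close>

lemma fourier_measurable [measurable]:
  assumes [measurable]: "F \<in> borel_measurable borel"
  shows "fourier F \<in> borel_measurable borel"
proof -
  have [measurable]: "cis \<in> borel_measurable borel"
    by (intro borel_measurable_continuous_onI continuous_intros)
  have "(\<lambda>\<xi>. LINT x|lborel. cis (- (\<xi> \<bullet> x)) * F x) \<in> borel_measurable borel"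
    by (rule lborel.borel_measurable_lebesgue_integral) measurable
  then show ?thesis by (simp add: fourier_def[abs_def])
qed

lemma fourier_integrable:
  assumes "integrable lborel F"
  shows "integrable lborel (\<lambda>x. cis (- (\<xi> \<bullet> x)) * F x)"
proof (rule Bochner_Integration.integrable_bound[OF assms])
  have [measurable]: "F \<in> borel_measurable lborel" "cis \<in> borel_measurable borel"
    using assms by (auto intro!: borel_measurable_continuous_onI continuous_intros)
  show "(\<lambda>x. cis (- (\<xi> \<bullet> x)) * F x) \<in> borel_measurable lborel" by measurable
qed (simp add: norm_mult)

lemma fourier_add:
  assumes "integrable lborel F" "integrable lborel G"
  shows "fourier (\<lambda>x. F x + b * G x) \<xi> = fourier F \<xi> + b * fourier G \<xi>"
  using fourier_integrable[OF assms(1), of \<xi>] fourier_integrable[OF assms(2), of \<xi>]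
  unfolding fourier_def by (simp add: algebra_simps)

text \<open>Termwise transformation of a series that converges absolutely in \<open>L\<^sup>1\<close>.\<close>

lemma fourier_suminf:
  assumes int: "\<And>k. integrable lborel (F k)" and AE: "AE x in lborel. summable (\<lambda>k. norm (F k x))"
    and sm: "summable (\<lambda>k. LINT x|lborel. norm (F k x))"
  shows "fourier (\<lambda>x. \<Sum>k. F k x) \<xi> = (\<Sum>k. fourier (F k) \<xi>)"
proof -
  have "fourier (\<lambda>x. \<Sum>k. F k x) \<xi> = (LINT x|lborel. (\<Sum>k. cis (- (\<xi> \<bullet> x)) * F k x))"
    unfolding fourier_def
  proof (rule integral_cong_AE)
    have [measurable]: "F k \<in> borel_measurable lborel" "cis \<in> borel_measurable borel" for k
      using int by (auto intro!: borel_measurable_continuous_onI continuous_intros)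
    show "(\<lambda>x. cis (- (\<xi> \<bullet> x)) * (\<Sum>k. F k x)) \<in> borel_measurable lborel" by measurable
    show "(\<lambda>x. \<Sum>k. cis (- (\<xi> \<bullet> x)) * F k x) \<in> borel_measurable lborel" by measurable
    show "AE x in lborel. cis (- (\<xi> \<bullet> x)) * (\<Sum>k. F k x) = (\<Sum>k. cis (- (\<xi> \<bullet> x)) * F k x)"
      using AE by eventually_elim (simp add: suminf_mult summable_norm_cancel)
  qed
  also have "\<dots> = (\<Sum>k. fourier (F k) \<xi>)"
    unfolding fourier_def
    by (rule integral_suminf) (use AE sm in \<open>simp_all add: norm_mult fourier_integrable int\<close>)
  finally show ?thesis .
qed

lemma fourier_tensor:
  fixes F :: "'n::finite \<Rightarrow> real \<Rightarrow> complex"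
  assumes "\<And>i. integrable lborel (F i)"
  shows "fourier (\<lambda>x. \<Prod>i\<in>UNIV. F i (x $ i)) \<xi> = (\<Prod>i\<in>UNIV. fourier (F i) (\<xi> $ i))"
proof -
  have cis_sum: "cis (- (\<Sum>i\<in>A. y i)) = (\<Prod>i\<in>A. cis (- y i))" if "finite A" for A and y :: "'n \<Rightarrow> real"
    using that
  proof (induction A rule: finite_induct)
    case (insert i A)
    have "cis (- (\<Sum>i\<in>insert i A. y i)) = cis (- y i + - (\<Sum>i\<in>A. y i))" using insert by simp
    also have "\<dots> = cis (- y i) * cis (- (\<Sum>i\<in>A. y i))" by (rule cis_mult[symmetric])
    also have "\<dots> = (\<Prod>i\<in>insert i A. cis (- y i))" using insert by simp
    finally show ?case .
  qed simp
  have "fourier (\<lambda>x. \<Prod>i\<in>UNIV. F i (x $ i)) \<xi> =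
      (LINT x|lborel. (\<Prod>i\<in>UNIV. cis (- (\<xi> $ i \<bullet> x $ i)) * F i (x $ i)))"
    unfolding fourier_def inner_vec_def by (subst cis_sum) (auto simp: prod.distrib)
  also have "\<dots> = (\<Prod>i\<in>UNIV. fourier (F i) (\<xi> $ i))"
    unfolding fourier_def
    by (rule integrable_tensor(2)[of "\<lambda>i y. cis (- (\<xi> $ i \<bullet> y)) * F i y"]) (rule fourier_integrable[OF assms])
  finally show ?thesis .
qed

section \<open>The Sobolev norm\<close>

text \<open>The conditions on an extension that do not refer to the function extended; they persist under sums and
  limits.\<close>

definition supported_in_box :: "('a::euclidean_space \<Rightarrow> complex) \<Rightarrow> bool" where
  "supported_in_box F \<longleftrightarrow> F \<in> borel_measurable borel \<and> (\<forall>x. x \<notin> cbox (- One) (2 *\<^sub>R One) \<longrightarrow> F x = 0)"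

lemma extensions_iff: "F \<in> extensions f \<longleftrightarrow> supported_in_box F \<and> (AE x in cube. F x = f x)"
  by (auto simp: extensions_def supported_in_box_def)

lemma supported_in_box_add: "supported_in_box F \<Longrightarrow> supported_in_box G \<Longrightarrow> supported_in_box (\<lambda>x. F x + b * G x)"
  by (auto simp: supported_in_box_def)

text \<open>On a set of finite measure, \<open>|F| \<le> y + |F|\<^sup>2 / y\<close> bounds the \<open>L\<^sup>1\<close> norm by the \<open>L\<^sup>2\<close> norm. The parameter
  \<open>y\<close> is kept free so that, for a series, it can be chosen geometrically decreasing.\<close>

lemma supported_in_box_integrable:
  fixes F :: "'a::euclidean_space \<Rightarrow> complex"
  assumes F: "supported_in_box F" and fin: "sobolev_norm2_whole t F < \<infinity>"
  shows "integrable lborel F"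
    "0 < y \<Longrightarrow> (LINT x|lborel. norm (F x)) \<le>
      y * measure lborel (cbox (- One) (2 *\<^sub>R (One::'a))) + 1 / y * enn2real (sobolev_norm2_whole t F)"
proof -
  let ?B = "cbox (- One) (2 *\<^sub>R (One::'a))"
  have [measurable]: "F \<in> borel_measurable borel" using F by (simp add: supported_in_box_def)
  have le: "(\<integral>\<^sup>+ x. ennreal ((norm (F x))\<^sup>2) \<partial>lborel) \<le> sobolev_norm2_whole t F"
    by (simp add: sobolev_norm2_whole_def)
  then have sq: "integrable lborel (\<lambda>x. (norm (F x))\<^sup>2)"
    using fin by (intro integrableI_bounded) (auto simp: less_top[symmetric] top_unique)
  have bound: "norm (F x) \<le> y * indicator ?B x + 1 / y * (norm (F x))\<^sup>2" if "0 < y" for x y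
  proof (cases "x \<in> ?B")
    case True
    have "2 * y * norm (F x) \<le> y\<^sup>2 + (norm (F x))\<^sup>2" using sum_squares_bound[of y "norm (F x)"] by simp
    moreover have "0 \<le> y * norm (F x)" using that by simp
    ultimately have "y * norm (F x) \<le> y\<^sup>2 + (norm (F x))\<^sup>2" by linarith
    then have "y * norm (F x) \<le> y * (y * 1 + 1 / y * (norm (F x))\<^sup>2)"
      using that by (simp add: distrib_left power2_eq_square)
    then show ?thesis using that True by simp
  qed (use F that in \<open>auto simp: supported_in_box_def\<close>)
  have int: "integrable lborel (\<lambda>x. y * indicator ?B x + 1 / y * (norm (F x))\<^sup>2)" for y :: real
    using sq by (intro Bochner_Integration.integrable_add integrable_mult_right integrable_real_indicator) auto
  show intF: "integrable lborel F"
  proof (rule Bochner_Integration.integrable_bound[OF int[of 1]])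
    show "AE x in lborel. norm (F x) \<le> norm (1 * indicator ?B x + 1 / 1 * (norm (F x))\<^sup>2)"
      using bound[of 1] by (intro AE_I2) (simp add: abs_of_nonneg)
  qed simp
  assume y: "0 < y"
  have "(LINT x|lborel. norm (F x)) \<le> (LINT x|lborel. y * indicator ?B x + 1 / y * (norm (F x))\<^sup>2)"
    by (intro integral_mono integrable_norm intF int bound y)
  also have "\<dots> = y * measure lborel ?B + 1 / y * (LINT x|lborel. (norm (F x))\<^sup>2)"
    using sq by (subst Bochner_Integration.integral_add) (auto intro!: integrable_real_indicator)
  also have "(LINT x|lborel. (norm (F x))\<^sup>2) \<le> enn2real (sobolev_norm2_whole t F)"
    using le fin by (subst integral_eq_nn_integral) (auto intro!: enn2real_mono)
  finally show "(LINT x|lborel. norm (F x)) \<le> y * measure lborel ?B + 1 / y * enn2real (sobolev_norm2_whole t F)"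
    using y by (simp add: divide_right_mono)
qed

lemma sobolev_norm2_whole_add:
  fixes F G :: "'a::euclidean_space \<Rightarrow> complex"
  assumes F: "supported_in_box F" "sobolev_norm2_whole t F < \<infinity>" and G: "supported_in_box G" "sobolev_norm2_whole t G < \<infinity>"
  shows "sobolev_norm2_whole t (\<lambda>x. F x + b * G x) \<le>
    2 * sobolev_norm2_whole t F + ennreal (2 * (norm b)\<^sup>2) * sobolev_norm2_whole t G"
proof -
  have [measurable]: "F \<in> borel_measurable borel" "G \<in> borel_measurable borel" using F G by (auto simp: supported_in_box_def)
  have pw: "ennreal (w * (norm (y + b * z))\<^sup>2) \<le> 2 * ennreal (w * (norm y)\<^sup>2) + ennreal (2 * (norm b)\<^sup>2) * ennreal (w * (norm z)\<^sup>2)"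
    if "0 \<le> w" for w y z
  proof -
    have "w * (norm (y + b * z))\<^sup>2 \<le> w * (2 * (norm y)\<^sup>2 + 2 * (norm (b * z))\<^sup>2)"
      by (intro mult_left_mono norm_add_square_le that)
    also have "\<dots> = 2 * (w * (norm y)\<^sup>2) + (2 * (norm b)\<^sup>2) * (w * (norm z)\<^sup>2)"
      by (simp add: norm_mult power_mult_distrib algebra_simps)
    finally have "ennreal (w * (norm (y + b * z))\<^sup>2) \<le> ennreal (2 * (w * (norm y)\<^sup>2) + (2 * (norm b)\<^sup>2) * (w * (norm z)\<^sup>2))"
      by (rule ennreal_leI)
    also have "\<dots> = 2 * ennreal (w * (norm y)\<^sup>2) + ennreal (2 * (norm b)\<^sup>2) * ennreal (w * (norm z)\<^sup>2)"
      using that by (subst ennreal_plus) (auto simp: ennreal_mult')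
    finally show ?thesis .
  qed
  have 1: "(\<integral>\<^sup>+ x. ennreal ((norm (F x + b * G x))\<^sup>2) \<partial>lborel) \<le>
      2 * (\<integral>\<^sup>+ x. ennreal ((norm (F x))\<^sup>2) \<partial>lborel) + ennreal (2 * (norm b)\<^sup>2) * (\<integral>\<^sup>+ x. ennreal ((norm (G x))\<^sup>2) \<partial>lborel)"
    using nn_integral_mono[OF pw[of 1], of lborel F G] by (simp add: nn_integral_add nn_integral_cmult)
  let ?w = "\<lambda>\<xi>::'a. (1 + (norm \<xi>)\<^sup>2) powr t"
  have "(\<integral>\<^sup>+ \<xi>. ennreal (?w \<xi> * (norm (fourier (\<lambda>x. F x + b * G x) \<xi>))\<^sup>2) \<partial>lborel) \<le>
     (\<integral>\<^sup>+ \<xi>. 2 * ennreal (?w \<xi> * (norm (fourier F \<xi>))\<^sup>2) + ennreal (2 * (norm b)\<^sup>2) * ennreal (?w \<xi> * (norm (fourier G \<xi>))\<^sup>2) \<partial>lborel)"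
    unfolding fourier_add[OF supported_in_box_integrable(1)[OF F] supported_in_box_integrable(1)[OF G]]
    by (intro nn_integral_mono pw) simp
  also have "\<dots> = 2 * (\<integral>\<^sup>+ \<xi>. ennreal (?w \<xi> * (norm (fourier F \<xi>))\<^sup>2) \<partial>lborel) +
     ennreal (2 * (norm b)\<^sup>2) * (\<integral>\<^sup>+ \<xi>. ennreal (?w \<xi> * (norm (fourier G \<xi>))\<^sup>2) \<partial>lborel)"
    by (subst nn_integral_add) (auto simp: nn_integral_cmult)
  finally have 2: "(\<integral>\<^sup>+ \<xi>. ennreal (?w \<xi> * (norm (fourier (\<lambda>x. F x + b * G x) \<xi>))\<^sup>2) \<partial>lborel) \<le>
     2 * (\<integral>\<^sup>+ \<xi>. ennreal (?w \<xi> * (norm (fourier F \<xi>))\<^sup>2) \<partial>lborel) +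
     ennreal (2 * (norm b)\<^sup>2) * (\<integral>\<^sup>+ \<xi>. ennreal (?w \<xi> * (norm (fourier G \<xi>))\<^sup>2) \<partial>lborel)" .
  show ?thesis using add_mono[OF 1 2] unfolding sobolev_norm2_whole_def distrib_left
    by (simp only: ac_simps)
qed

text \<open>The strict bounds \<open>X\<close> and \<open>Y\<close> allow the choice of extensions that nearly attain the infima. The
  factor \<open>2\<close> comes from working with squared norms and is harmless for closures.\<close>

lemma sobolev_norm2_add:
  assumes f: "sobolev_norm2 t f < X" and g: "sobolev_norm2 t g < Y"
  shows "sobolev_norm2 t (\<lambda>x. f x + b * g x) \<le> 2 * X + ennreal (2 * (norm b)\<^sup>2) * Y"
proof -
  obtain F where F: "F \<in> extensions f" "sobolev_norm2_whole t F < X" using f by (auto simp: sobolev_norm2_def INF_less_iff)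
  obtain G where G: "G \<in> extensions g" "sobolev_norm2_whole t G < Y" using g by (auto simp: sobolev_norm2_def INF_less_iff)
  have "AE x in cube. F x = f x" "AE x in cube. G x = g x" using F G by (auto simp: extensions_iff)
  then have "AE x in cube. F x + b * G x = f x + b * g x" by eventually_elim simp
  then have "(\<lambda>x. F x + b * G x) \<in> extensions (\<lambda>x. f x + b * g x)"
    using F G by (auto simp: extensions_iff intro: supported_in_box_add)
  then have "sobolev_norm2 t (\<lambda>x. f x + b * g x) \<le> sobolev_norm2_whole t (\<lambda>x. F x + b * G x)"
    unfolding sobolev_norm2_def by (rule INF_lower)
  also have "\<dots> \<le> 2 * sobolev_norm2_whole t F + ennreal (2 * (norm b)\<^sup>2) * sobolev_norm2_whole t G"
    using F G less_le_trans[OF F(2) top_greatest] less_le_trans[OF G(2) top_greatest]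
    by (intro sobolev_norm2_whole_add) (simp_all add: extensions_iff)
  also have "\<dots> \<le> 2 * X + ennreal (2 * (norm b)\<^sup>2) * Y"
    using F G by (intro add_mono mult_left_mono) auto
  finally show ?thesis .
qed

lemma sobolev_add:
  assumes "f \<in> sobolev t" "g \<in> sobolev t" shows "(\<lambda>x. f x + b * g x) \<in> sobolev t"
proof -
  have fg: "sobolev_norm2 t f < \<infinity>" "sobolev_norm2 t g < \<infinity>" using assms by (auto simp: sobolev_def)
  obtain X where X: "sobolev_norm2 t f < X" "X < \<infinity>" using dense[OF fg(1)] by auto
  obtain Y where Y: "sobolev_norm2 t g < Y" "Y < \<infinity>" using dense[OF fg(2)] by auto
  have "sobolev_norm2 t (\<lambda>x. f x + b * g x) \<le> 2 * X + ennreal (2 * (norm b)\<^sup>2) * Y"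
    by (rule sobolev_norm2_add[OF X(1) Y(1)])
  also have "\<dots> < \<infinity>" using X Y by (simp add: ennreal_mult_less_top)
  finally show ?thesis using L2_add_scale[of f g 1 b] assms by (simp add: sobolev_def)
qed

lemma sobolev_norm2_zero: "sobolev_norm2 t (\<lambda>x::'a::euclidean_space. 0) = 0"
proof -
  have "sobolev_norm2 t (\<lambda>x::'a. 0) \<le> sobolev_norm2_whole t (\<lambda>x::'a. 0)"
    unfolding sobolev_norm2_def by (rule INF_lower) (simp add: extensions_iff supported_in_box_def)
  also have "\<dots> = 0" by (simp add: sobolev_norm2_whole_def fourier_def)
  finally show ?thesis by simp
qed

lemma sobolev_zero: "(\<lambda>x. 0) \<in> sobolev t"
  by (simp add: sobolev_def sobolev_norm2_zero L2_zero)

lemma sobolev_lincomb: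
  assumes "finite F" "\<And>i. i \<in> F \<Longrightarrow> b i \<in> sobolev t" shows "lincomb b F c \<in> sobolev t"
  using assms
proof (induction F rule: finite_induct)
  case (insert i F)
  then show ?case using sobolev_add[of "lincomb b F c" t "b i" "c i"] by (simp add: lincomb_insert add.commute)
qed (simp add: lincomb_def sobolev_zero)

lemma sobolev_norm2_eq: "f \<in> sobolev t \<Longrightarrow> sobolev_norm2 t f = ennreal ((sobolev_norm t f)\<^sup>2)"
  by (simp add: sobolev_def sobolev_norm_def)

lemma sobolev_norm_nonneg: "0 \<le> sobolev_norm t f"
  by (simp add: sobolev_norm_def)

lemma sobolev_norm_less_iff:
  assumes "f \<in> sobolev t" "0 < e" shows "sobolev_norm t f < e \<longleftrightarrow> sobolev_norm2 t f < ennreal (e\<^sup>2)"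
proof -
  have "sobolev_norm t f < e \<longleftrightarrow> (sobolev_norm t f)\<^sup>2 < e\<^sup>2"
    using assms(2) sobolev_norm_nonneg[of t f] by (meson less_imp_le power_mono_iff not_le pos2)
  then show ?thesis using assms by (simp add: sobolev_norm2_eq ennreal_less_iff)
qed

text \<open>Every extension contributes at least its \<open>L\<^sup>2\<close> norm over the cube.\<close>

lemma square_integral_le_sobolev: "square_integral f \<le> sobolev_norm2 t f"
  unfolding sobolev_norm2_def
proof (rule INF_greatest)
  fix F assume F: "F \<in> extensions f"
  then have "square_integral f = (\<integral>\<^sup>+ x. ennreal ((norm (F x))\<^sup>2) \<partial>cube)"
    unfolding square_integral_def by (intro nn_integral_cong_AE) (auto simp: extensions_iff elim: eventually_mono)
  also have "\<dots> = (\<integral>\<^sup>+ x. ennreal ((norm (F x))\<^sup>2) * indicator (cbox 0 One) x \<partial>lborel)"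
    unfolding cube_def by (rule nn_integral_restrict_space) simp
  also have "\<dots> \<le> (\<integral>\<^sup>+ x. ennreal ((norm (F x))\<^sup>2) \<partial>lborel)"
    by (intro nn_integral_mono) (auto split: split_indicator)
  also have "\<dots> \<le> sobolev_norm2_whole t F" by (simp add: sobolev_norm2_whole_def)
  finally show "square_integral f \<le> sobolev_norm2_whole t F" .
qed

lemma l2_norm_le_sobolev_norm:
  assumes "f \<in> sobolev t" shows "l2_norm f \<le> sobolev_norm t f"
proof -
  have "ennreal ((l2_norm f)\<^sup>2) \<le> ennreal ((sobolev_norm t f)\<^sup>2)"
    using square_integral_le_sobolev[of f t] assms sobolev_norm2_eq[OF assms] l2_norm_eq[of f] by (simp add: sobolev_def)
  then show ?thesis by (intro power2_le_imp_le[OF _ sobolev_norm_nonneg]) simp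
qed

lemma sobolev_mono:
  assumes "q \<le> t" shows "sobolev t \<subseteq> (sobolev q :: ('a::euclidean_space \<Rightarrow> complex) set)"
proof -
  have "sobolev_norm2_whole q F \<le> sobolev_norm2_whole t F" for F :: "'a \<Rightarrow> complex"
    unfolding sobolev_norm2_whole_def using assms
    by (intro add_mono nn_integral_mono order_refl ennreal_leI mult_right_mono powr_mono) auto
  then have "sobolev_norm2 q f \<le> sobolev_norm2 t f" for f :: "'a \<Rightarrow> complex"
    unfolding sobolev_norm2_def by (intro INF_mono) auto
  then show ?thesis by (auto simp: sobolev_def intro: le_less_trans)
qed

lemma outer_box_component: "x \<in> cbox (- One) (2 *\<^sub>R (One :: real ^ 'n::finite)) \<longleftrightarrow> (\<forall>i. x $ i \<in> cbox (- One) (2 *\<^sub>R (One::real)))"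
proof -
  have "x \<in> cbox (- One) (2 *\<^sub>R (One :: real ^ 'n)) \<longleftrightarrow> (\<forall>b\<in>Basis. - 1 \<le> x \<bullet> b \<and> x \<bullet> b \<le> 2)"
    by (simp add: mem_box)
  also have "\<dots> \<longleftrightarrow> (\<forall>i. x $ i \<in> cbox (- One) (2 *\<^sub>R (One::real)))"
    by (auto simp: Basis_vec_def inner_axis)
  finally show ?thesis .
qed

lemma one_plus_sum_le_prod:
  fixes y :: "'i \<Rightarrow> real"
  assumes "finite A" "\<And>i. 0 \<le> y i"
  shows "1 + (\<Sum>i\<in>A. y i) \<le> (\<Prod>i\<in>A. 1 + y i)"
  using assms(1)
proof (induction A rule: finite_induct)
  case (insert i A)
  have "0 \<le> y i * (\<Sum>i\<in>A. y i)" using assms(2) by (intro mult_nonneg_nonneg sum_nonneg) auto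
  then have "1 + (\<Sum>i\<in>insert i A. y i) \<le> (1 + y i) * (1 + (\<Sum>i\<in>A. y i))"
    using insert by (simp add: algebra_simps)
  also have "\<dots> \<le> (1 + y i) * (\<Prod>i\<in>A. 1 + y i)"
    using insert assms(2) by (intro mult_left_mono) (auto simp: add_nonneg_nonneg)
  finally show ?case using insert by simp
qed simp

text \<open>The tensor product of extensions extends the tensor product, and its Fourier transform is the tensor product
  of the transforms. For \<open>t \<ge> 0\<close> the weight is at most the product of the univariate weights, so both
  parts of the norm are bounded by products of univariate integrals.\<close>

lemma sobolev_tensor:
  fixes l :: "'n::finite \<Rightarrow> int \<times> 'k"
  assumes t: "0 \<le> t" and \<psi>: "\<And>i. \<psi> (l i) \<in> sobolev t"
  shows "tensor \<psi> l \<in> sobolev t"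
proof -
  have "\<exists>F. F \<in> extensions (\<psi> (l i)) \<and> sobolev_norm2_whole t F < \<infinity>" for i
    using \<psi>[of i] by (auto simp: sobolev_def sobolev_norm2_def INF_less_iff)
  then obtain F where F: "\<And>i. F i \<in> extensions (\<psi> (l i))" "\<And>i. sobolev_norm2_whole t (F i) < \<infinity>" by metis
  have [measurable]: "F i \<in> borel_measurable borel" for i using F by (auto simp: extensions_iff supported_in_box_def)
  have int: "integrable lborel (F i)" for i
    using F by (intro supported_in_box_integrable(1)[of _ t]) (auto simp: extensions_iff)
  define G where "G x = (\<Prod>i\<in>UNIV. F i (x $ i))" for x :: "real ^ 'n"
  have "AE x in cube. G x = tensor \<psi> l x"
  proof -
    have "AE x in lborel. x $ i \<in> cbox 0 (One::real) \<longrightarrow> F i ((x :: real ^ 'n) $ i) = \<psi> (l i) (x $ i)" for i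
      using F(1)[of i] unfolding extensions_iff AE_cube_iff by (intro AE_component) auto
    then have "AE x in lborel. \<forall>i. x $ i \<in> cbox 0 (One::real) \<longrightarrow> F i ((x :: real ^ 'n) $ i) = \<psi> (l i) (x $ i)"
      by (simp add: AE_all_countable)
    then show ?thesis unfolding AE_cube_iff G_def tensor_def
      by eventually_elim (auto simp only: cube_component intro!: prod.cong)
  qed
  moreover have "supported_in_box G"
  proof -
    have "G x = 0" if x: "x \<notin> cbox (- One) (2 *\<^sub>R One)" for x
    proof -
      obtain i where "x $ i \<notin> cbox (- One) (2 *\<^sub>R (One::real))" using x by (auto simp only: outer_box_component)
      then have "F i (x $ i) = 0" using F(1)[of i] unfolding extensions_iff supported_in_box_def by blast
      then show ?thesis unfolding G_def by (intro prod_zero) auto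
    qed
    moreover have "G \<in> borel_measurable borel" unfolding G_def by measurable
    ultimately show ?thesis by (simp add: supported_in_box_def)
  qed
  ultimately have "sobolev_norm2 t (tensor \<psi> l) \<le> sobolev_norm2_whole t G"
    unfolding sobolev_norm2_def by (intro INF_lower) (simp add: extensions_iff)
  also have "\<dots> < \<infinity>"
  proof -
    have "(\<integral>\<^sup>+ x. ennreal ((norm (G x))\<^sup>2) \<partial>lborel) = (\<integral>\<^sup>+ x. (\<Prod>i\<in>UNIV. ennreal ((norm (F i (x $ i)))\<^sup>2)) \<partial>lborel)"
      by (simp add: G_def prod_norm[symmetric] prod_power_distrib prod_ennreal)
    also have "\<dots> = (\<Prod>i\<in>UNIV. \<integral>\<^sup>+ y. ennreal ((norm (F i y))\<^sup>2) \<partial>lborel)"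
      by (rule nn_integral_tensor) measurable
    also have "\<dots> < \<infinity>"
      using F(2) by (auto simp: less_top[symmetric] ennreal_prod_eq_top sobolev_norm2_whole_def)
    finally have 1: "(\<integral>\<^sup>+ x. ennreal ((norm (G x))\<^sup>2) \<partial>lborel) < \<infinity>" .
    have "(\<integral>\<^sup>+ \<xi>. ennreal ((1 + (norm \<xi>)\<^sup>2) powr t * (norm (fourier G \<xi>))\<^sup>2) \<partial>lborel) \<le>
      (\<integral>\<^sup>+ \<xi>. (\<Prod>i\<in>UNIV. ennreal ((1 + (norm (\<xi> $ i))\<^sup>2) powr t * (norm (fourier (F i) (\<xi> $ i)))\<^sup>2)) \<partial>lborel)"
    proof (intro nn_integral_mono)
      fix \<xi> :: "real ^ 'n"
      have "1 + (norm \<xi>)\<^sup>2 \<le> (\<Prod>i\<in>UNIV. 1 + (norm (\<xi> $ i))\<^sup>2)"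
        using one_plus_sum_le_prod[of UNIV "\<lambda>i. (norm (\<xi> $ i))\<^sup>2"]
        by (simp add: norm_vec_def L2_set_def sum_nonneg)
      then have "(1 + (norm \<xi>)\<^sup>2) powr t \<le> (\<Prod>i\<in>UNIV. 1 + (norm (\<xi> $ i))\<^sup>2) powr t"
        using t by (intro powr_mono2) auto
      also have "\<dots> = (\<Prod>i\<in>UNIV. (1 + (norm (\<xi> $ i))\<^sup>2) powr t)"
        by (rule prod_powr_distrib)
      finally have "(1 + (norm \<xi>)\<^sup>2) powr t * (norm (fourier G \<xi>))\<^sup>2 \<le>
         (\<Prod>i\<in>UNIV. (1 + (norm (\<xi> $ i))\<^sup>2) powr t) * (norm (\<Prod>i\<in>UNIV. fourier (F i) (\<xi> $ i)))\<^sup>2"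
        unfolding G_def fourier_tensor[OF int] by (intro mult_right_mono) auto
      also have "\<dots> = (\<Prod>i\<in>UNIV. (1 + (norm (\<xi> $ i))\<^sup>2) powr t * (norm (fourier (F i) (\<xi> $ i)))\<^sup>2)"
        by (simp only: prod_norm[symmetric] prod_power_distrib prod.distrib)
      finally show "ennreal ((1 + (norm \<xi>)\<^sup>2) powr t * (norm (fourier G \<xi>))\<^sup>2) \<le>
        (\<Prod>i\<in>UNIV. ennreal ((1 + (norm (\<xi> $ i))\<^sup>2) powr t * (norm (fourier (F i) (\<xi> $ i)))\<^sup>2))"
        by (subst prod_ennreal) (auto intro: ennreal_leI)
    qed
    also have "\<dots> = (\<Prod>i\<in>UNIV. \<integral>\<^sup>+ y. ennreal ((1 + (norm y)\<^sup>2) powr t * (norm (fourier (F i) y))\<^sup>2) \<partial>lborel)"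
      by (rule nn_integral_tensor) measurable
    also have "\<dots> < \<infinity>"
      using F(2) by (auto simp: less_top[symmetric] ennreal_prod_eq_top sobolev_norm2_whole_def)
    finally show ?thesis using 1 by (simp add: sobolev_norm2_whole_def)
  qed
  finally show ?thesis using L2_tensor[of \<psi> l] \<psi> by (simp add: sobolev_def)
qed

section \<open>Completeness of closures in Sobolev spaces\<close>

text \<open>The Cauchy--Schwarz inequality with weights \<open>2\<^sup>-\<^sup>k\<close>, whose sum is \<open>2\<close>. It turns the norm of a series into a
  series of squared norms, to which monotone convergence applies.\<close>

lemma
  fixes y :: "nat \<Rightarrow> complex"
  shows summable_of_weighted_squares:
      "(\<Sum>k. ennreal (2 * 2 ^ k * (norm (y k))\<^sup>2)) < \<infinity> \<Longrightarrow> summable (\<lambda>k. norm (y k))"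
    and norm_suminf_square_le:
      "ennreal ((norm (\<Sum>k. y k))\<^sup>2) \<le> (\<Sum>k. ennreal (2 * 2 ^ k * (norm (y k))\<^sup>2))"
proof -
  have *: "summable (\<lambda>k. norm (y k)) \<and> ennreal ((norm (\<Sum>k. y k))\<^sup>2) \<le> (\<Sum>k. ennreal (2 * 2 ^ k * (norm (y k))\<^sup>2))"
    if fin: "(\<Sum>k. ennreal (2 * 2 ^ k * (norm (y k))\<^sup>2)) < \<infinity>"
  proof -
    have sm: "summable (\<lambda>k. 2 * 2 ^ k * (norm (y k))\<^sup>2)"
      using fin by (intro summable_suminf_not_top) auto
    define S where "S = (\<Sum>k. 2 * 2 ^ k * (norm (y k))\<^sup>2)"
    have partial: "(\<Sum>k<n. norm (y k)) \<le> sqrt S" for n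
    proof -
      have "(\<Sum>k<n. norm (y k))\<^sup>2 = (\<Sum>k<n. sqrt (1 / 2 ^ k) * (sqrt (2 ^ k) * norm (y k)))\<^sup>2"
        by (simp add: real_sqrt_divide)
      also have "\<dots> \<le> (\<Sum>k<n. (sqrt (1 / 2 ^ k))\<^sup>2) * (\<Sum>k<n. (sqrt (2 ^ k) * norm (y k))\<^sup>2)"
        by (rule Cauchy_Schwarz_ineq_sum)
      also have "\<dots> \<le> 2 * (\<Sum>k<n. (sqrt (2 ^ k) * norm (y k))\<^sup>2)"
      proof (intro mult_right_mono sum_nonneg)
        have "(\<Sum>k<n. (sqrt (1 / 2 ^ k))\<^sup>2) = (\<Sum>k<n. (1 / 2 :: real) ^ k)" by (simp add: power_one_over)
        also have "\<dots> \<le> (\<Sum>k. (1 / 2 :: real) ^ k)" by (intro sum_le_suminf summable_geometric) auto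
        also have "\<dots> = 2" by (subst suminf_geometric) auto
        finally show "(\<Sum>k<n. (sqrt (1 / 2 ^ k))\<^sup>2) \<le> (2::real)" .
      qed simp
      also have "\<dots> = (\<Sum>k<n. 2 * 2 ^ k * (norm (y k))\<^sup>2)"
        by (simp add: sum_distrib_left power_mult_distrib mult.assoc)
      also have "\<dots> \<le> S" unfolding S_def by (intro sum_le_suminf sm) auto
      finally show ?thesis by (rule real_le_rsqrt)
    qed
    have sn: "summable (\<lambda>k. norm (y k))" by (rule summableI_nonneg_bounded[OF _ partial]) simp
    have S0: "0 \<le> S" unfolding S_def by (intro suminf_nonneg sm) simp
    have "norm (\<Sum>k. y k) \<le> (\<Sum>k. norm (y k))" by (rule summable_norm[OF sn])
    also have "\<dots> \<le> sqrt S" by (rule suminf_le_const[OF sn partial])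
    finally have "(norm (\<Sum>k. y k))\<^sup>2 \<le> (sqrt S)\<^sup>2" by (rule power_mono) simp
    then have "ennreal ((norm (\<Sum>k. y k))\<^sup>2) \<le> ennreal S" using S0 by (intro ennreal_leI) simp
    also have "ennreal S = (\<Sum>k. ennreal (2 * 2 ^ k * (norm (y k))\<^sup>2))"
      unfolding S_def by (rule suminf_ennreal2[symmetric, OF _ sm]) simp
    finally show ?thesis using sn by simp
  qed
  then show "(\<Sum>k. ennreal (2 * 2 ^ k * (norm (y k))\<^sup>2)) < \<infinity> \<Longrightarrow> summable (\<lambda>k. norm (y k))" by simp
  show "ennreal ((norm (\<Sum>k. y k))\<^sup>2) \<le> (\<Sum>k. ennreal (2 * 2 ^ k * (norm (y k))\<^sup>2))"
  proof (cases "(\<Sum>k. ennreal (2 * 2 ^ k * (norm (y k))\<^sup>2)) = top")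
    case False
    then show ?thesis using * by (simp only: less_top infinity_ennreal_def)
  next
    case True
    show ?thesis unfolding True by (rule top_greatest)
  qed
qed

text \<open>Both parts of the norm, in space and in frequency, are integrals of \<open>|\<Sum>\<^sub>k y\<^sub>k|\<^sup>2\<close> against a weight. The weighted
  Cauchy--Schwarz inequality bounds them by \<open>\<Sum>\<^sub>k 2\<^sup>k\<^sup>+\<^sup>1\<close> times the squared norms of the terms; the ratio \<open>1/16\<close> beats the
  factor \<open>2\<^sup>k\<close>, and \<open>2 / (1 - 1/8)\<close> is below \<open>4\<close>.\<close>

lemma sobolev_norm2_whole_suminf:
  fixes G :: "nat \<Rightarrow> 'a::euclidean_space \<Rightarrow> complex"
  assumes G: "\<And>k. supported_in_box (G k)" and small: "\<And>k. sobolev_norm2_whole t (G k) \<le> ennreal (a * (1 / 16) ^ k)"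
    and a: "0 \<le> a"
  shows "sobolev_norm2_whole t (\<lambda>x. \<Sum>k. G k x) \<le> ennreal (4 * a)"
    and "AE x in lborel. summable (\<lambda>k. norm (G k x))"
proof -
  have [measurable]: "G k \<in> borel_measurable borel" for k using G by (auto simp: supported_in_box_def)
  have fin: "sobolev_norm2_whole t (G k) < \<infinity>" for k using small[of k] by (rule le_less_trans) simp
  note int = supported_in_box_integrable(1)[OF G fin]
  \<comment> \<open>The common shape of the two parts: \<open>H = G\<close>, \<open>w = 1\<close> in space, and \<open>H = fourier \<circ> G\<close>, \<open>w \<xi> = (1 + |\<xi>|\<^sup>2) powr t\<close> in frequency.\<close>
  have part: "(\<integral>\<^sup>+ x. (\<Sum>k. ennreal (2 * 2 ^ k * (norm (H k x))\<^sup>2) * w x) \<partial>lborel) = (\<Sum>k. ennreal (2 * 2 ^ k) * X k)"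
    if [measurable]: "\<And>k. H k \<in> borel_measurable borel" "w \<in> borel_measurable borel"
    and X: "\<And>k. X k = (\<integral>\<^sup>+ x. w x * ennreal ((norm (H k x))\<^sup>2) \<partial>lborel)"
    for H :: "nat \<Rightarrow> 'a \<Rightarrow> complex" and w X
  proof -
    have "(\<integral>\<^sup>+ x. ennreal (2 * 2 ^ k * (norm (H k x))\<^sup>2) * w x \<partial>lborel) = ennreal (2 * 2 ^ k) * X k" for k
    proof -
      have "ennreal (2 * 2 ^ k) * X k = (\<integral>\<^sup>+ x. ennreal (2 * 2 ^ k) * (w x * ennreal ((norm (H k x))\<^sup>2)) \<partial>lborel)"
        unfolding X by (rule nn_integral_cmult[symmetric]) measurable
      also have "\<dots> = (\<integral>\<^sup>+ x. ennreal (2 * 2 ^ k * (norm (H k x))\<^sup>2) * w x \<partial>lborel)"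
        by (intro nn_integral_cong) (simp only: ennreal_mult mult_ac zero_le_power2 zero_le_mult_iff zero_le_power zero_le_numeral simp_thms)
      finally show ?thesis ..
    qed
    then show ?thesis by (subst nn_integral_suminf) simp_all
  qed
  let ?w = "\<lambda>\<xi>::'a. (1 + (norm \<xi>)\<^sup>2) powr t"
  define X where "X k = (\<integral>\<^sup>+ x. 1 * ennreal ((norm (G k x))\<^sup>2) \<partial>lborel)" for k
  define Y where "Y k = (\<integral>\<^sup>+ \<xi>. ennreal (?w \<xi>) * ennreal ((norm (fourier (G k) \<xi>))\<^sup>2) \<partial>lborel)" for k
  have XY: "sobolev_norm2_whole t (G k) = X k + Y k" for k
    by (simp add: sobolev_norm2_whole_def X_def Y_def ennreal_mult)
  have total: "(\<Sum>k. ennreal (2 * 2 ^ k) * X k) + (\<Sum>k. ennreal (2 * 2 ^ k) * Y k) \<le> ennreal (4 * a)"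
  proof -
    have "(\<Sum>k. ennreal (2 * 2 ^ k) * X k) + (\<Sum>k. ennreal (2 * 2 ^ k) * Y k) = (\<Sum>k. ennreal (2 * 2 ^ k) * (X k + Y k))"
      by (subst suminf_add) (auto simp: distrib_left)
    also have "\<dots> \<le> (\<Sum>k. ennreal (2 * a * (1 / 8) ^ k))"
    proof (rule suminf_le)
      fix k
      have "ennreal (2 * 2 ^ k) * (X k + Y k) \<le> ennreal (2 * 2 ^ k) * ennreal (a * (1 / 16) ^ k)"
        using small[of k] unfolding XY by (rule mult_left_mono) simp
      also have "\<dots> = ennreal (2 * a * (1 / 8) ^ k)"
        using a by (subst ennreal_mult[symmetric]) (auto simp: power_divide power_mult_distrib[symmetric] field_simps)
      finally show "ennreal (2 * 2 ^ k) * (X k + Y k) \<le> ennreal (2 * a * (1 / 8) ^ k)" .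
    qed auto
    also have "\<dots> = ennreal (\<Sum>k. 2 * a * (1 / 8) ^ k)"
      using a by (intro suminf_ennreal2 summable_mult summable_geometric) auto
    also have "(\<Sum>k. 2 * a * (1 / 8) ^ k) = 2 * a * (8 / 7)"
      by (subst suminf_mult) (auto simp: suminf_geometric intro!: summable_geometric)
    also have "ennreal (2 * a * (8 / 7)) \<le> ennreal (4 * a)" using a by (intro ennreal_leI) simp
    finally show ?thesis .
  qed
  have sumX: "(\<integral>\<^sup>+ x. (\<Sum>k. ennreal (2 * 2 ^ k * (norm (G k x))\<^sup>2)) \<partial>lborel) = (\<Sum>k. ennreal (2 * 2 ^ k) * X k)"
  proof -
    have "(\<integral>\<^sup>+ x. (\<Sum>k. ennreal (2 * 2 ^ k * (norm (G k x))\<^sup>2) * 1) \<partial>lborel) = (\<Sum>k. ennreal (2 * 2 ^ k) * X k)"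
      by (rule part) (measurable, rule X_def)
    then show ?thesis by (simp only: mult_1_right)
  qed
  have "(\<Sum>k. ennreal (2 * 2 ^ k) * X k) \<le> ennreal (4 * a)"
    by (rule order_trans[OF add_increasing2[OF zero_le order_refl] total])
  then have Xfin: "(\<Sum>k. ennreal (2 * 2 ^ k) * X k) \<noteq> top"
    by (rule neq_top_trans[OF ennreal_neq_top])
  have "AE x in lborel. (\<Sum>k. ennreal (2 * 2 ^ k * (norm (G k x))\<^sup>2)) \<noteq> \<infinity>"
  proof (rule nn_integral_PInf_AE)
    show "(\<lambda>x. \<Sum>k. ennreal (2 * 2 ^ k * (norm (G k x))\<^sup>2)) \<in> borel_measurable lborel" by measurable
    show "(\<integral>\<^sup>+ x. (\<Sum>k. ennreal (2 * 2 ^ k * (norm (G k x))\<^sup>2)) \<partial>lborel) \<noteq> \<infinity>"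
      unfolding sumX infinity_ennreal_def by (rule Xfin)
  qed
  then show AE: "AE x in lborel. summable (\<lambda>k. norm (G k x))"
    by eventually_elim (rule summable_of_weighted_squares, simp only: less_top infinity_ennreal_def)
  \<comment> \<open>With \<open>y = 2\<^sup>-\<^sup>k\<close> both terms of the \<open>L\<^sup>1\<close> bound are geometric.\<close>
  have sm: "summable (\<lambda>k. LINT x|lborel. norm (G k x))"
  proof (rule summable_comparison_test_ev[OF always_eventually], intro allI)
    fix k
    let ?m = "measure lborel (cbox (- One) (2 *\<^sub>R (One::'a)))"
    have "enn2real (sobolev_norm2_whole t (G k)) \<le> a * (1 / 16) ^ k"
      using enn2real_mono[OF small[of k]] a by simp
    then have "1 / (1 / 2) ^ k * enn2real (sobolev_norm2_whole t (G k)) \<le> 1 / (1 / 2) ^ k * (a * (1 / 16) ^ k)"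
      by (intro mult_left_mono) auto
    also have "\<dots> = a * (1 / 8) ^ k" by (simp add: power_divide power_mult_distrib[symmetric] field_simps)
    finally show "norm (LINT x|lborel. norm (G k x)) \<le> (1 / 2) ^ k * ?m + a * (1 / 8) ^ k"
      using supported_in_box_integrable(2)[OF G fin, of "(1 / 2) ^ k" k] by simp
  qed (intro summable_add summable_mult summable_mult2 summable_geometric; simp)
  have 1: "(\<integral>\<^sup>+ x. ennreal ((norm (\<Sum>k. G k x))\<^sup>2) \<partial>lborel) \<le> (\<Sum>k. ennreal (2 * 2 ^ k) * X k)"
    unfolding sumX[symmetric] by (intro nn_integral_mono norm_suminf_square_le)
  have "(\<integral>\<^sup>+ \<xi>. ennreal (?w \<xi> * (norm (fourier (\<lambda>x. \<Sum>k. G k x) \<xi>))\<^sup>2) \<partial>lborel) \<le>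
      (\<integral>\<^sup>+ \<xi>. (\<Sum>k. ennreal (2 * 2 ^ k * (norm (fourier (G k) \<xi>))\<^sup>2) * ennreal (?w \<xi>)) \<partial>lborel)"
    unfolding fourier_suminf[OF int AE sm]
    using mult_right_mono[OF norm_suminf_square_le]
    by (intro nn_integral_mono) (simp add: ennreal_mult mult.commute)
  also have "\<dots> = (\<Sum>k. ennreal (2 * 2 ^ k) * Y k)"
    by (rule part) (auto simp: Y_def)
  finally show "sobolev_norm2_whole t (\<lambda>x. \<Sum>k. G k x) \<le> ennreal (4 * a)"
    unfolding sobolev_norm2_whole_def using order_trans[OF add_mono[OF 1] total] by simp
qed

text \<open>Extend each increment almost optimally and sum the extensions on the whole space. The tails \<open>R n\<close> of this
  series are extensions of the differences between the limit \<open>R 0\<close> and the partial sums, so their norms bound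
  the error.\<close>

lemma sobolev_complete:
  fixes D :: "nat \<Rightarrow> 'a::euclidean_space \<Rightarrow> complex"
  assumes D: "\<And>k. sobolev_norm2 t (D k) < ennreal ((1 / 16) ^ k)"
  obtains g where "g \<in> sobolev t"
    "\<And>n. sobolev_norm2 t (\<lambda>x. g x - (\<Sum>k<n. D k x)) \<le> ennreal (4 * (1 / 16) ^ n)"
proof -
  have "\<exists>F. F \<in> extensions (D k) \<and> sobolev_norm2_whole t F < ennreal ((1 / 16) ^ k)" for k
    using D[of k] unfolding sobolev_norm2_def INF_less_iff by blast
  then obtain G where G: "\<And>k. G k \<in> extensions (D k)" "\<And>k. sobolev_norm2_whole t (G k) < ennreal ((1 / 16) ^ k)"
    by metis
  have box: "supported_in_box (G k)" for k using G(1)[of k] by (simp add: extensions_iff)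
  define R where "R n x = (\<Sum>k. G (k + n) x)" for n x
  have boxR: "supported_in_box (R n)" for n
  proof -
    have [measurable]: "G k \<in> borel_measurable borel" for k using box[of k] by (simp add: supported_in_box_def)
    have "R n \<in> borel_measurable borel" unfolding R_def[abs_def] by measurable
    moreover have "R n x = 0" if "x \<notin> cbox (- One) (2 *\<^sub>R One)" for x
      using box that by (simp add: R_def supported_in_box_def)
    ultimately show ?thesis by (simp add: supported_in_box_def)
  qed
  have small: "sobolev_norm2_whole t (G (k + n)) \<le> ennreal ((1 / 16) ^ n * (1 / 16) ^ k)" for k n
    using less_imp_le[OF G(2)[of "k + n"]] by (simp only: power_add mult.commute)
  have N: "sobolev_norm2_whole t (R n) \<le> ennreal (4 * (1 / 16) ^ n)" for n
    unfolding R_def[abs_def] by (rule sobolev_norm2_whole_suminf(1)[OF box small]) simp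
  have "AE x in lborel. summable (\<lambda>k. norm (G (k + 0) x))"
    by (rule sobolev_norm2_whole_suminf(2)[OF box small]) simp
  then have "AE x in lborel. summable (\<lambda>k. norm (G k x))" by simp
  then have "AE x in cube. summable (\<lambda>k. norm (G k x))" unfolding AE_cube_iff by eventually_elim simp
  moreover have "AE x in cube. \<forall>k. G k x = D k x"
    using G(1) by (simp add: AE_all_countable extensions_iff)
  ultimately have "AE x in cube. R n x = R 0 x - (\<Sum>k<n. D k x)" for n
  proof eventually_elim
    case (elim x)
    have "(\<Sum>k. G k x) = (\<Sum>k. G (k + n) x) + (\<Sum>k<n. G k x)"
      by (rule suminf_split_initial_segment[OF summable_norm_cancel[OF elim(1)]])
    then show ?case using elim by (simp add: R_def)
  qed
  then have ext: "R n \<in> extensions (\<lambda>x. R 0 x - (\<Sum>k<n. D k x))" for n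
    using boxR by (simp add: extensions_iff)
  have bound: "sobolev_norm2 t (\<lambda>x. R 0 x - (\<Sum>k<n. D k x)) \<le> ennreal (4 * (1 / 16) ^ n)" for n
    unfolding sobolev_norm2_def
    using INF_lower[OF ext[of n], of "sobolev_norm2_whole t"] N[of n] by (rule order_trans)
  have fin: "sobolev_norm2 t (R 0) < \<infinity>"
  proof -
    have "sobolev_norm2 t (R 0) \<le> ennreal (4 * (1 / 16) ^ 0)" using bound[of 0] by simp
    also have "\<dots> < \<infinity>" by simp
    finally show ?thesis .
  qed
  have "R 0 \<in> L2"
  proof -
    have "(\<lambda>x. indicator (cbox 0 One) x *\<^sub>R R 0 x) \<in> borel_measurable borel"
      using boxR[of 0] by (intro borel_measurable_scaleR) (auto simp: supported_in_box_def)
    then show ?thesis using le_less_trans[OF square_integral_le_sobolev fin] by (simp add: L2_iff measurable_cube_iff)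
  qed
  then show ?thesis using that[of "R 0"] bound fin by (simp add: sobolev_def)
qed

definition linear_subspace :: "('a \<Rightarrow> complex) set \<Rightarrow> bool" where
  "linear_subspace S \<longleftrightarrow> (\<lambda>x. 0) \<in> S \<and> (\<forall>f\<in>S. \<forall>g\<in>S. \<forall>b. (\<lambda>x. f x + b * g x) \<in> S)"

text \<open>Both approximation errors are taken below \<open>d\<close>, chosen such that \<open>(2 + 2 |b|\<^sup>2) d\<^sup>2 < e\<^sup>2\<close>.\<close>

lemma sobolev_closure_add:
  assumes S: "linear_subspace S" and f: "f \<in> sobolev_closure t S" and g: "g \<in> sobolev_closure t S"
  shows "(\<lambda>x. f x + b * g x) \<in> sobolev_closure t S"
  unfolding sobolev_closure_def
proof (intro CollectI conjI allI impI)
  show s: "(\<lambda>x. f x + b * g x) \<in> sobolev t"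
    using f g by (intro sobolev_add) (auto simp: sobolev_closure_def)
  fix e :: real assume e: "0 < e"
  define d where "d = e / sqrt (3 + 3 * (norm b)\<^sup>2)"
  have pos: "0 < 3 + 3 * (norm b)\<^sup>2" by (simp add: add_pos_nonneg)
  have d: "0 < d" using e pos by (simp add: d_def)
  obtain f' where f': "f' \<in> S" "f - f' \<in> sobolev t" "sobolev_norm t (f - f') < d"
    using f d by (auto simp: sobolev_closure_def)
  obtain g' where g': "g' \<in> S" "g - g' \<in> sobolev t" "sobolev_norm t (g - g') < d"
    using g d by (auto simp: sobolev_closure_def)
  have eq: "(\<lambda>x. f x + b * g x) - (\<lambda>x. f' x + b * g' x) = (\<lambda>x. (f - f') x + b * (g - g') x)"
    by (auto simp: algebra_simps)
  have in_s: "(\<lambda>x. f x + b * g x) - (\<lambda>x. f' x + b * g' x) \<in> sobolev t"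
    unfolding eq by (intro sobolev_add f' g')
  have "sobolev_norm2 t (\<lambda>x. (f - f') x + b * (g - g') x) \<le>
      2 * ennreal (d\<^sup>2) + ennreal (2 * (norm b)\<^sup>2) * ennreal (d\<^sup>2)"
    using f'(3) g'(3) unfolding sobolev_norm_less_iff[OF f'(2) d] sobolev_norm_less_iff[OF g'(2) d]
    by (rule sobolev_norm2_add)
  also have "\<dots> = ennreal (2 * d\<^sup>2 + 2 * (norm b)\<^sup>2 * d\<^sup>2)"
    by (subst ennreal_plus) (simp_all add: ennreal_mult)
  also have "\<dots> < ennreal (e\<^sup>2)"
  proof (rule ennreal_lessI)
    have "2 * d\<^sup>2 + 2 * (norm b)\<^sup>2 * d\<^sup>2 < (3 + 3 * (norm b)\<^sup>2) * d\<^sup>2"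
      using d by (simp add: algebra_simps add_less_le_mono)
    also have "\<dots> = e\<^sup>2" using pos by (simp add: d_def power_divide)
    finally show "2 * d\<^sup>2 + 2 * (norm b)\<^sup>2 * d\<^sup>2 < e\<^sup>2" .
  qed (use e in simp)
  finally have "sobolev_norm t ((\<lambda>x. f x + b * g x) - (\<lambda>x. f' x + b * g' x)) < e"
    using sobolev_norm_less_iff[OF in_s e] eq by simp
  then show "\<exists>h\<in>S. (\<lambda>x. f x + b * g x) - h \<in> sobolev t \<and> sobolev_norm t ((\<lambda>x. f x + b * g x) - h) < e"
    using S f' g' in_s by (intro bexI[of _ "\<lambda>x. f' x + b * g' x"]) (auto simp: linear_subspace_def)
qed

lemma sobolev_closure_superset:
  assumes "S \<subseteq> sobolev t" shows "S \<subseteq> sobolev_closure t S"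
proof
  fix f assume f: "f \<in> S"
  have "f - f = (\<lambda>x. 0)" by auto
  then show "f \<in> sobolev_closure t S" using f assms
    by (auto simp: sobolev_closure_def sobolev_zero sobolev_norm_def sobolev_norm2_zero intro!: bexI[of _ f])
qed

lemma sobolev_closure_sum:
  fixes D :: "nat \<Rightarrow> 'a::euclidean_space \<Rightarrow> complex"
  assumes S: "linear_subspace S" "S \<subseteq> sobolev t" and D: "\<And>k. D k \<in> sobolev_closure t S"
  shows "(\<lambda>x. \<Sum>k<n. D k x) \<in> sobolev_closure t S"
proof (induction n)
  case 0
  then show ?case using S sobolev_closure_superset[of S t] by (auto simp: linear_subspace_def)
next
  case (Suc n)
  then show ?case using sobolev_closure_add[OF S(1) Suc D[of n], of 1] by simp
qed

text \<open>Convergence is recorded in \<open>L\<^sup>2\<close> only, as the limit serves to compute inner products with dual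
  wavelets.\<close>

lemma sobolev_closure_complete:
  fixes D :: "nat \<Rightarrow> 'a::euclidean_space \<Rightarrow> complex"
  assumes S: "linear_subspace S" "S \<subseteq> sobolev t"
    and D: "\<And>k. D k \<in> sobolev_closure t S" "\<And>k. sobolev_norm t (D k) < (1 / 4) ^ k"
  obtains g where "g \<in> sobolev_closure t S" "(\<lambda>n. l2_norm (g - (\<lambda>x. \<Sum>k<n. D k x))) \<longlonglongrightarrow> 0"
proof -
  have Ds: "D k \<in> sobolev t" for k using D(1)[of k] by (simp add: sobolev_closure_def)
  have "sobolev_norm2 t (D k) < ennreal ((1 / 16) ^ k)" for k
    using D(2)[of k] sobolev_norm_less_iff[OF Ds[of k], of "(1 / 4) ^ k"]
    by (simp add: power_mult_distrib[symmetric] power2_eq_square)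
  then obtain g where g: "g \<in> sobolev t"
    "\<And>n. sobolev_norm2 t (\<lambda>x. g x - (\<Sum>k<n. D k x)) \<le> ennreal (4 * (1 / 16) ^ n)"
    using sobolev_complete[of t D] by blast
  define P where "P n = (\<lambda>x. \<Sum>k<n. D k x)" for n
  have P: "P n \<in> sobolev_closure t S" for n unfolding P_def by (rule sobolev_closure_sum[OF S D(1)])
  have gP: "g - P n = (\<lambda>x. g x + (- 1) * P n x)" for n by auto
  have gPs: "g - P n \<in> sobolev t" for n
    unfolding gP using P[of n] by (intro sobolev_add g) (simp add: sobolev_closure_def)
  have bound: "sobolev_norm t (g - P n) \<le> 2 * (1 / 4) ^ n" for n
  proof (rule power2_le_imp_le)
    have "ennreal ((sobolev_norm t (g - P n))\<^sup>2) \<le> ennreal (4 * (1 / 16) ^ n)"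
      using g(2)[of n] unfolding sobolev_norm2_eq[OF gPs, symmetric] by (simp add: P_def fun_diff_def)
    then have "(sobolev_norm t (g - P n))\<^sup>2 \<le> 4 * (1 / 16) ^ n" by simp
    also have "\<dots> = (2 * (1 / 4) ^ n)\<^sup>2"
      by (simp add: power_mult_distrib power2_eq_square power_mult_distrib[symmetric])
    finally show "(sobolev_norm t (g - P n))\<^sup>2 \<le> (2 * (1 / 4) ^ n)\<^sup>2" .
  qed simp
  have lim: "(\<lambda>n. 2 * (1 / 4 :: real) ^ n) \<longlonglongrightarrow> 0"
    by (rule tendsto_mult_right_zero) (rule LIMSEQ_power_zero, simp)
  have "g \<in> sobolev_closure t S"
    unfolding sobolev_closure_def
  proof (intro CollectI conjI allI impI g)
    fix e :: real assume e: "0 < e"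
    then obtain n where n: "2 * (1 / 4 :: real) ^ n < e / 3"
      using order_tendstoD(2)[OF lim, of "e / 3"] by (auto dest: eventually_happens)
    obtain h where h: "h \<in> S" "P n - h \<in> sobolev t" "sobolev_norm t (P n - h) < e / 3"
      using P[of n] e unfolding sobolev_closure_def by (auto dest!: spec[of _ "e / 3"])
    have eq: "g - h = (\<lambda>x. (g - P n) x + 1 * (P n - h) x)" by auto
    have in_s: "g - h \<in> sobolev t" unfolding eq by (intro sobolev_add gPs h)
    have "sobolev_norm2 t (g - h) \<le> 2 * ennreal ((e / 3)\<^sup>2) + ennreal (2 * (norm (1::complex))\<^sup>2) * ennreal ((e / 3)\<^sup>2)"
      unfolding eq
    proof (rule sobolev_norm2_add)
      have e3: "0 < e / 3" using e by simp
      show "sobolev_norm2 t (g - P n) < ennreal ((e / 3)\<^sup>2)"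
        using n bound[of n] unfolding sobolev_norm_less_iff[OF gPs e3, symmetric] by linarith
      show "sobolev_norm2 t (P n - h) < ennreal ((e / 3)\<^sup>2)"
        using h(3) unfolding sobolev_norm_less_iff[OF h(2) e3] .
    qed
    also have "\<dots> = ennreal (2 * (e / 3)\<^sup>2 + 2 * (e / 3)\<^sup>2)"
      by (subst ennreal_plus) (simp_all add: ennreal_mult)
    also have "\<dots> < ennreal (e\<^sup>2)" using e by (intro ennreal_lessI) (auto simp: power_divide)
    finally show "\<exists>h\<in>S. g - h \<in> sobolev t \<and> sobolev_norm t (g - h) < e"
      using h sobolev_norm_less_iff[OF in_s e] in_s by auto
  qed
  moreover have "(\<lambda>n. l2_norm (g - P n)) \<longlonglongrightarrow> 0"
  proof (rule tendsto_sandwich[OF _ _ tendsto_const lim])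
    show "\<forall>\<^sub>F n in sequentially. 0 \<le> l2_norm (g - P n)" by (simp add: l2_norm_def)
    show "\<forall>\<^sub>F n in sequentially. l2_norm (g - P n) \<le> 2 * (1 / 4) ^ n"
      using order_trans[OF l2_norm_le_sobolev_norm[OF gPs] bound] by (intro always_eventually) simp
  qed
  ultimately show ?thesis using that[of g] by (simp add: P_def)
qed

section \<open>Coefficients of functionals\<close>

lemma lincomb_extend:
  assumes "finite G" "F \<subseteq> G"
  shows "lincomb b F c = lincomb b G (\<lambda>i. if i \<in> F then c i else 0)"
  unfolding lincomb_def using assms by (intro ext sum.mono_neutral_cong_left) auto

lemma subspace_fin_span: "linear_subspace (fin_span b I)"
  unfolding linear_subspace_def
proof (intro conjI ballI allI)
  have "lincomb b {} (\<lambda>_. 0) \<in> fin_span b I" unfolding fin_span_def by blast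
  then show "(\<lambda>x. 0) \<in> fin_span b I" by (simp add: lincomb_def)
  fix f g \<beta> assume "f \<in> fin_span b I" "g \<in> fin_span b I"
  then obtain F c G d where F: "finite F" "F \<subseteq> I" "f = lincomb b F c"
    and G: "finite G" "G \<subseteq> I" "g = lincomb b G d" by (auto simp: fin_span_def)
  define e where "e i = (if i \<in> F then c i else 0) + \<beta> * (if i \<in> G then d i else 0)" for i
  have "(\<lambda>x. f x + \<beta> * g x) = lincomb b (F \<union> G) e"
    unfolding F(3) G(3) lincomb_extend[of "F \<union> G" F b c, OF finite_UnI[OF F(1) G(1)] Un_upper1]
      lincomb_extend[of "F \<union> G" G b d, OF finite_UnI[OF F(1) G(1)] Un_upper2] e_def
    by (simp add: lincomb_def sum.distrib sum_distrib_left distrib_right mult.assoc)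
  then show "(\<lambda>x. f x + \<beta> * g x) \<in> fin_span b I"
    unfolding fin_span_def using F G by blast
qed

lemma basis_in_fin_span: "i \<in> I \<Longrightarrow> b i \<in> fin_span b I"
proof -
  assume "i \<in> I"
  moreover have "b i = lincomb b {i} (\<lambda>_. 1)" by (simp add: lincomb_def)
  ultimately show ?thesis unfolding fin_span_def by blast
qed

lemma functional_lincomb:
  assumes u: "u \<in> functionals P' I" and F: "finite F" "F \<subseteq> I"
  shows "u (lincomb P' F c) = (\<Sum>i\<in>F. cnj (c i) * u (P' i))"
  using F
proof (induction F rule: finite_induct)
  case empty
  have "lincomb P' {} c \<in> fin_span P' I" unfolding fin_span_def by blast
  then have "u (\<lambda>x. 0 * lincomb P' {} c x + 0 * lincomb P' {} c x) = cnj 0 * u (lincomb P' {} c) + cnj 0 * u (lincomb P' {} c)"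
    using u unfolding functionals_def by blast
  then show ?case by (simp add: lincomb_def)
next
  case (insert i F)
  have "lincomb P' F c \<in> fin_span P' I" unfolding fin_span_def using insert by blast
  moreover have "P' i \<in> fin_span P' I" using insert by (intro basis_in_fin_span) auto
  ultimately have "u (\<lambda>x. c i * P' i x + 1 * lincomb P' F c x) = cnj (c i) * u (P' i) + cnj 1 * u (lincomb P' F c)"
    using u unfolding functionals_def by blast
  then show ?case using insert by (simp add: lincomb_insert)
qed

lemma functional_eqI:
  assumes u: "u \<in> functionals P' I" and w: "w \<in> functionals P' I"
    and eq: "\<And>i. i \<in> I \<Longrightarrow> u (P' i) = w (P' i)"
  shows "u = w"
proof
  fix v
  show "u v = w v"
  proof (cases "v \<in> fin_span P' I")
    case True
    then obtain F c where F: "finite F" "F \<subseteq> I" "v = lincomb P' F c" by (auto simp: fin_span_def)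
    then show ?thesis using functional_lincomb[OF u F(1,2)] functional_lincomb[OF w F(1,2)] eq
      by (auto intro!: sum.cong)
  qed (use u w in \<open>auto simp: functionals_def\<close>)
qed

lemma functionals_diff:
  assumes u: "u \<in> functionals P' I" and w: "w \<in> functionals P' I"
  shows "u - w \<in> functionals P' I"
proof -
  have "(u - w) (\<lambda>x. a * v x + b * v' x) = cnj a * (u - w) v + cnj b * (u - w) v'"
    if v: "v \<in> fin_span P' I" "v' \<in> fin_span P' I" for v v' a b
  proof -
    have "u (\<lambda>x. a * v x + b * v' x) = cnj a * u v + cnj b * u v'"
      "w (\<lambda>x. a * v x + b * v' x) = cnj a * w v + cnj b * w v'"
      using u w v unfolding functionals_def by blast+
    then show ?thesis by (simp add: algebra_simps)
  qed
  then show ?thesis using u w by (auto simp: functionals_def)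
qed

lemma l2_inner_sum_lessThan:
  fixes D :: "nat \<Rightarrow> 'a::euclidean_space \<Rightarrow> complex"
  assumes v: "v \<in> L2" and D: "\<And>k. D k \<in> L2"
  shows "(\<lambda>x. \<Sum>k<n. D k x) \<in> L2 \<and> l2_inner v (\<lambda>x. \<Sum>k<n. D k x) = (\<Sum>k<n. l2_inner v (D k))"
proof (induction n)
  case (Suc n)
  then show ?case
    using L2_add_scale[of "\<lambda>x. \<Sum>k<n. D k x" "D n" 1 1] l2_inner_linear[OF v, of "\<lambda>x. \<Sum>k<n. D k x" "D n" 1 1] D[of n]
    by simp
qed (simp add: L2_zero l2_inner_def)

text \<open>The wavelet system with its regularity on the side that defines \<open>H\<^sup>q\<close> (primal for \<open>q \<ge> 0\<close>, dual for
  \<open>q < 0\<close>) and the norm equivalence with weights \<open>w\<close>. The norm equivalence speaks about elements of the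
  space alone; membership of a functional has to be proved separately.\<close>

locale biorthogonal_system =
  fixes P P' :: "'i \<Rightarrow> 'a::euclidean_space \<Rightarrow> complex" and I :: "'i set" and q :: real
    and w :: "'i \<Rightarrow> real" and c C :: real
  assumes P: "l \<in> I \<Longrightarrow> P l \<in> L2" and P': "l \<in> I \<Longrightarrow> P' l \<in> L2"
    and biorthogonal: "l \<in> I \<Longrightarrow> l' \<in> I \<Longrightarrow> l2_inner (P' l') (P l) = (if l' = l then 1 else 0)"
    and P_sobolev: "0 \<le> q \<Longrightarrow> l \<in> I \<Longrightarrow> P l \<in> sobolev q"
    and P'_sobolev: "q < 0 \<Longrightarrow> l \<in> I \<Longrightarrow> P' l \<in> sobolev (- q)"
    and w: "l \<in> I \<Longrightarrow> 0 < w l" and c: "0 < c" and C: "0 < C"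
    and weighted_summable: "u \<in> H_space P P' I q \<Longrightarrow> (\<lambda>l. (w l * norm (u (P' l)))\<^sup>2) summable_on I"
    and H_norm_lower: "u \<in> H_space P P' I q \<Longrightarrow>
      c * (\<Sum>\<^sub>\<infinity>l\<in>I. (w l * norm (u (P' l)))\<^sup>2) \<le> (H_norm P P' I q u)\<^sup>2"
    and H_norm_upper: "u \<in> H_space P P' I q \<Longrightarrow>
      (H_norm P P' I q u)\<^sup>2 \<le> C * (\<Sum>\<^sub>\<infinity>l\<in>I. (w l * norm (u (P' l)))\<^sup>2)"
begin

abbreviation H where "H \<equiv> H_space P P' I q"
abbreviation H_nrm where "H_nrm \<equiv> H_norm P P' I q"
abbreviation S where "S \<equiv> fin_span P I"
abbreviation S' where "S' \<equiv> fin_span P' I"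

lemma lincomb_L2: "finite F \<Longrightarrow> F \<subseteq> I \<Longrightarrow> lincomb P F a \<in> L2"
  using P by (intro L2_lincomb) auto

lemma S'_L2: "v \<in> S' \<Longrightarrow> v \<in> L2"
  using P' by (auto simp: fin_span_def intro!: L2_lincomb)

lemma S_sobolev: "0 \<le> q \<Longrightarrow> S \<subseteq> sobolev q"
  using P_sobolev by (auto simp: fin_span_def intro!: sobolev_lincomb)

lemma S'_sobolev: "q < 0 \<Longrightarrow> v \<in> S' \<Longrightarrow> v \<in> sobolev (- q)"
  using P'_sobolev by (auto simp: fin_span_def intro!: sobolev_lincomb)

lemma of_fun_functional:
  assumes f: "f \<in> L2" shows "of_fun P' I f \<in> functionals P' I"
proof -
  have "(\<lambda>x. a * v x + b * v' x) \<in> S'" if v: "v \<in> S'" "v' \<in> S'" for a b v v'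
  proof -
    have "(\<lambda>x. 0) \<in> S'" and add: "\<And>f g \<beta>. f \<in> S' \<Longrightarrow> g \<in> S' \<Longrightarrow> (\<lambda>x. f x + \<beta> * g x) \<in> S'"
      using subspace_fin_span[of P' I] by (auto simp: linear_subspace_def)
    then have "(\<lambda>x. 0 + a * v x) \<in> S'" using v by blast
    then show ?thesis using add[OF _ v(2), of "\<lambda>x. a * v x" b] by simp
  qed
  then show ?thesis using f S'_L2 by (auto simp: functionals_def of_fun_def l2_inner_antilinear)
qed

lemma of_fun_diff:
  assumes "f \<in> L2" "g \<in> L2" shows "of_fun P' I f - of_fun P' I g = of_fun P' I (f - g)"
  using assms S'_L2 by (auto simp: of_fun_def l2_inner_diff)

lemma of_fun_P': "l \<in> I \<Longrightarrow> of_fun P' I f (P' l) = l2_inner (P' l) f"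
  by (simp add: of_fun_def basis_in_fin_span)

lemma coeff_lincomb:
  assumes "finite F" "F \<subseteq> I" "l \<in> I"
  shows "of_fun P' I (lincomb P F a) (P' l) = (if l \<in> F then a l else 0)"
proof -
  have "l2_inner (P' l) (lincomb P F a) = (\<Sum>i\<in>F. a i * l2_inner (P' l) (P i))"
    using assms P by (intro l2_inner_lincomb P') auto
  also have "\<dots> = (\<Sum>i\<in>F. if l = i then a i else 0)"
    using assms by (intro sum.cong) (auto simp: biorthogonal)
  also have "\<dots> = (if l \<in> F then a l else 0)" using assms by simp
  finally show ?thesis using assms by (simp add: of_fun_P')
qed

lemma H_functional: "u \<in> H \<Longrightarrow> u \<in> functionals P' I"
  by (auto simp: H_space_def sobolev_closure_def sobolev_def intro!: of_fun_functional split: if_splits)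

lemma H_diff:
  assumes u: "u \<in> H" and v: "v \<in> H" shows "u - v \<in> H"
proof (cases "0 \<le> q")
  case True
  then obtain f g where f: "f \<in> sobolev_closure q S" "u = of_fun P' I f"
    and g: "g \<in> sobolev_closure q S" "v = of_fun P' I g"
    using u v by (auto simp: H_space_def)
  have "(\<lambda>x. f x + (- 1) * g x) \<in> sobolev_closure q S"
    by (rule sobolev_closure_add[OF subspace_fin_span f(1) g(1)])
  moreover have "f - g = (\<lambda>x. f x + (- 1) * g x)" by auto
  moreover have "u - v = of_fun P' I (f - g)"
    using f g by (simp add: of_fun_diff sobolev_closure_def sobolev_def)
  ultimately show ?thesis using True by (auto simp: H_space_def)
next
  case False
  then obtain A B where A: "\<And>x. x \<in> S' \<Longrightarrow> norm (u x) \<le> A * sobolev_norm (- q) x"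
    and B: "\<And>x. x \<in> S' \<Longrightarrow> norm (v x) \<le> B * sobolev_norm (- q) x"
    using u v by (auto simp: H_space_def)
  have "norm ((u - v) x) \<le> (A + B) * sobolev_norm (- q) x" if "x \<in> S'" for x
    using norm_triangle_ineq4[of "u x" "v x"] A[OF that] B[OF that] by (simp add: algebra_simps)
  then show ?thesis using False functionals_diff[OF H_functional[OF u] H_functional[OF v]]
    by (auto simp: H_space_def)
qed

lemma H_norm_nonneg:
  assumes "u \<in> H" shows "0 \<le> H_nrm u"
proof (cases "0 \<le> q")
  case True
  then show ?thesis using assms unfolding H_norm_def
    by (auto intro!: cInf_greatest simp: sobolev_norm_nonneg H_space_def)
next
  case False
  then obtain A where A: "\<And>x. x \<in> S' \<Longrightarrow> norm (u x) \<le> A * sobolev_norm (- q) x"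
    using assms by (auto simp: H_space_def)
  have "norm (u x) \<le> \<bar>A\<bar> * sobolev_norm (- q) x" if "x \<in> S'" for x
    using A[OF that] mult_right_mono[OF abs_ge_self sobolev_norm_nonneg, of A "- q" x] by linarith
  then have "\<bar>A\<bar> \<in> {A. A \<ge> 0 \<and> (\<forall>v\<in>S'. norm (u v) \<le> A * sobolev_norm (- q) v)}" by simp
  then have "0 \<le> Inf {A. A \<ge> 0 \<and> (\<forall>v\<in>S'. norm (u v) \<le> A * sobolev_norm (- q) v)}"
    by (intro cInf_greatest) blast+
  then show ?thesis using False by (simp add: H_norm_def)
qed

lemma H_norm_bound:
  assumes q: "q < 0" and u: "u \<in> H" and v: "v \<in> S'"
  shows "norm (u v) \<le> H_nrm u * sobolev_norm (- q) v"
proof -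
  let ?X = "{A. A \<ge> 0 \<and> (\<forall>v\<in>S'. norm (u v) \<le> A * sobolev_norm (- q) v)}"
  obtain A where A: "\<And>x. x \<in> S' \<Longrightarrow> norm (u x) \<le> A * sobolev_norm (- q) x"
    using u q by (auto simp: H_space_def)
  have "norm (u x) \<le> \<bar>A\<bar> * sobolev_norm (- q) x" if "x \<in> S'" for x
    using A[OF that] mult_right_mono[OF abs_ge_self sobolev_norm_nonneg, of A "- q" x] by linarith
  then have ne: "\<bar>A\<bar> \<in> ?X" by simp
  have H: "H_nrm u = Inf ?X" using q by (simp add: H_norm_def)
  show ?thesis
  proof (cases "sobolev_norm (- q) v = 0")
    case True
    then show ?thesis using A[OF v] by simp
  next
    case False
    then have pos: "0 < sobolev_norm (- q) v" using sobolev_norm_nonneg[of "- q" v] by simp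
    have "norm (u v) / sobolev_norm (- q) v \<le> Inf ?X"
    proof (rule cInf_greatest)
      fix B assume "B \<in> ?X"
      then show "norm (u v) / sobolev_norm (- q) v \<le> B" using v pos by (simp add: pos_divide_le_eq)
    qed (use ne in blast)
    then show ?thesis using pos by (simp add: H pos_divide_le_eq)
  qed
qed

lemma lincomb_in_H:
  assumes F: "finite F" "F \<subseteq> I" shows "of_fun P' I (lincomb P F a) \<in> H"
proof (cases "0 \<le> q")
  case True
  have "lincomb P F a \<in> S" using F by (auto simp: fin_span_def)
  then have "lincomb P F a \<in> sobolev_closure q S"
    using sobolev_closure_superset[OF S_sobolev[OF True]] by auto
  then show ?thesis using True by (simp add: H_space_def)
next
  case False
  have "norm (of_fun P' I (lincomb P F a) v) \<le> l2_norm (lincomb P F a) * sobolev_norm (- q) v" if v: "v \<in> S'" for v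
  proof -
    have "norm (of_fun P' I (lincomb P F a) v) \<le> l2_norm v * l2_norm (lincomb P F a)"
      using v by (simp add: of_fun_def l2_Cauchy_Schwarz S'_L2 lincomb_L2 F)
    also have "\<dots> \<le> sobolev_norm (- q) v * l2_norm (lincomb P F a)"
      using False v by (intro mult_right_mono l2_norm_le_sobolev_norm S'_sobolev) (auto simp: l2_norm_def)
    finally show ?thesis by (simp add: mult.commute)
  qed
  then show ?thesis using False of_fun_functional[OF lincomb_L2[OF F]] by (auto simp: H_space_def)
qed

lemma H_norm_lincomb:
  assumes F: "finite F" "F \<subseteq> I"
  shows "(H_nrm (of_fun P' I (lincomb P F a)))\<^sup>2 \<le> C * (\<Sum>l\<in>F. (w l * norm (a l))\<^sup>2)"
proof -
  have "(\<Sum>\<^sub>\<infinity>l\<in>I. (w l * norm (of_fun P' I (lincomb P F a) (P' l)))\<^sup>2) = (\<Sum>\<^sub>\<infinity>l\<in>F. (w l * norm (a l))\<^sup>2)"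
    using F by (intro infsum_cong_neutral) (auto simp: coeff_lincomb)
  then show ?thesis using H_norm_upper[OF lincomb_in_H[OF F, of a]] F by simp
qed

text \<open>On a test function \<open>v\<close> with finite support \<open>F\<close>, the functional agrees with the section of its expansion to
  \<open>F\<close>. The sections lie in the space, and the norm equivalence bounds their norms uniformly.\<close>

lemma in_H_negative:
  assumes q: "q < 0" and u: "u \<in> functionals P' I" and sm: "(\<lambda>l. (w l * norm (u (P' l)))\<^sup>2) summable_on I"
  shows "u \<in> H"
proof -
  define A where "A = sqrt (C * (\<Sum>\<^sub>\<infinity>l\<in>I. (w l * norm (u (P' l)))\<^sup>2))"
  have "norm (u v) \<le> A * sobolev_norm (- q) v" if v: "v \<in> S'" for v
  proof -
    obtain F a where F: "finite F" "F \<subseteq> I" "v = lincomb P' F a" using v by (auto simp: fin_span_def)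
    define f where "f = of_fun P' I (lincomb P F (\<lambda>l. u (P' l)))"
    have f: "f \<in> H" unfolding f_def by (rule lincomb_in_H[OF F(1,2)])
    have "u v = f v"
      using functional_lincomb[OF u F(1,2)] functional_lincomb[OF H_functional[OF f] F(1,2)] F
      by (auto simp: f_def coeff_lincomb subset_iff intro!: sum.cong)
    then have "norm (u v) \<le> H_nrm f * sobolev_norm (- q) v" using H_norm_bound[OF q f v] by simp
    also have "\<dots> \<le> A * sobolev_norm (- q) v"
    proof (intro mult_right_mono sobolev_norm_nonneg)
      have "(H_nrm f)\<^sup>2 \<le> C * (\<Sum>l\<in>F. (w l * norm (u (P' l)))\<^sup>2)"
        unfolding f_def by (rule H_norm_lincomb[OF F(1,2)])
      also have "\<dots> \<le> C * (\<Sum>\<^sub>\<infinity>l\<in>I. (w l * norm (u (P' l)))\<^sup>2)"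
        using F C by (intro mult_left_mono finite_sum_le_infsum sm) auto
      finally show "H_nrm f \<le> A" unfolding A_def by (rule real_le_rsqrt)
    qed
    finally show ?thesis .
  qed
  then show ?thesis using q u by (auto simp: H_space_def)
qed

text \<open>Sections \<open>U k\<close> of the expansion to finite sets that exhaust the square sum rapidly form a fast Cauchy sequence
  by the norm equivalence. The norm of a functional is an infimum over all functions that represent it,
  so each increment is represented by some function \<open>D k\<close> of small Sobolev norm, which may differ from
  the finite combination of wavelets that defines it. The series of the \<open>D k\<close> converges in the Sobolev
  space, and the limit has the required coefficients because inner products with dual wavelets are continuous
  in \<open>L\<^sup>2\<close>.\<close>

lemma in_H_nonneg:
  assumes q: "0 \<le> q" and u: "u \<in> functionals P' I" and sm: "(\<lambda>l. (w l * norm (u (P' l)))\<^sup>2) summable_on I"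
  shows "u \<in> H"
proof -
  let ?x = "\<lambda>l. (w l * norm (u (P' l)))\<^sup>2"
  \<comment> \<open>Two consecutive errors together must satisfy \<open>C (\<epsilon> k + \<epsilon> (k + 1)) < 16\<^sup>-\<^sup>k\<close>.\<close>
  define \<epsilon> where "\<epsilon> k = (1 / 16) ^ k / (2 * C + 1)" for k :: nat
  have \<epsilon>: "0 < \<epsilon> k" for k using C by (simp add: \<epsilon>_def)
  have "\<exists>F. finite F \<and> F \<subseteq> I \<and> (\<Sum>\<^sub>\<infinity>l\<in>I - F. ?x l) \<le> \<epsilon> k" for k
  proof -
    obtain F where F: "finite F" "F \<subseteq> I" "dist (sum ?x F) (infsum ?x I) \<le> \<epsilon> k"
      using infsum_finite_approximation[OF sm \<epsilon>[of k]] by auto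
    have "infsum ?x I = infsum ?x F + infsum ?x (I - F)"
      using F infsum_Un_disjoint[of ?x F "I - F"] summable_on_subset_banach[OF sm, of "I - F"] by (simp add: Un_absorb1)
    then show ?thesis using F by (intro exI[of _ F]) (auto simp: dist_real_def abs_le_iff)
  qed
  then obtain F where F: "\<And>k. finite (F k)" "\<And>k. F k \<subseteq> I" "\<And>k. (\<Sum>\<^sub>\<infinity>l\<in>I - F k. ?x l) \<le> \<epsilon> k" by metis
  define U where "U k = of_fun P' I (lincomb P (F k) (\<lambda>l. u (P' l)))" for k
  have U: "U k \<in> H" for k unfolding U_def by (rule lincomb_in_H[OF F(1,2)])
  have UP: "U k (P' l) = (if l \<in> F k then u (P' l) else 0)" if "l \<in> I" for k l
    unfolding U_def using coeff_lincomb[OF F(1,2) that] by simp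
  have err: "(\<Sum>\<^sub>\<infinity>l\<in>I. (w l * norm (U k (P' l) - u (P' l)))\<^sup>2) \<le> \<epsilon> k" for k
  proof -
    have "(\<Sum>\<^sub>\<infinity>l\<in>I. (w l * norm (U k (P' l) - u (P' l)))\<^sup>2) = (\<Sum>\<^sub>\<infinity>l\<in>I - F k. ?x l)"
      using F by (intro infsum_cong_neutral) (auto simp: UP)
    then show ?thesis using F(3)[of k] by simp
  qed
  have errs: "(\<lambda>l. (w l * norm (U k (P' l) - u (P' l)))\<^sup>2) summable_on I" for k
  proof -
    have "?x summable_on I - F k" by (rule summable_on_subset_banach[OF sm]) auto
    then show ?thesis by (rule summable_on_cong_neutral[THEN iffD1, rotated -1]) (use F in \<open>auto simp: UP\<close>)
  qed
  have point: "(w l * norm (U k (P' l) - u (P' l)))\<^sup>2 \<le> \<epsilon> k" if "l \<in> I" for k l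
    using finite_sum_le_infsum[OF errs[of k], of "{l}"] err[of k] that by simp
  have step: "H_nrm (U (Suc k) - U k) < (1 / 4) ^ k" for k
  proof -
    have pw: "(w l * norm ((U (Suc k) - U k) (P' l)))\<^sup>2 \<le> (w l * norm (U (Suc k) (P' l) - u (P' l)))\<^sup>2 + (w l * norm (U k (P' l) - u (P' l)))\<^sup>2"
      if "l \<in> I" for l
      by (simp add: UP[OF that])
    have "(\<Sum>\<^sub>\<infinity>l\<in>I. (w l * norm ((U (Suc k) - U k) (P' l)))\<^sup>2) \<le>
        (\<Sum>\<^sub>\<infinity>l\<in>I. (w l * norm (U (Suc k) (P' l) - u (P' l)))\<^sup>2 + (w l * norm (U k (P' l) - u (P' l)))\<^sup>2)"
      by (intro infsum_mono pw weighted_summable H_diff U summable_on_add errs)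
    also have "\<dots> \<le> \<epsilon> (Suc k) + \<epsilon> k"
      by (subst infsum_add[OF errs errs]) (intro add_mono err)
    also have "\<epsilon> (Suc k) = \<epsilon> k / 16" by (simp add: \<epsilon>_def)
    also have "\<epsilon> k / 16 + \<epsilon> k \<le> 2 * \<epsilon> k" using \<epsilon>[of k] by simp
    finally have "(H_nrm (U (Suc k) - U k))\<^sup>2 \<le> C * (2 * \<epsilon> k)"
      using H_norm_upper[OF H_diff[OF U U], of "Suc k" k] C by (meson mult_left_mono less_imp_le order_trans)
    also have "C * (2 * \<epsilon> k) = (2 * C) / (2 * C + 1) * (1 / 16) ^ k" by (simp add: \<epsilon>_def)
    also have "\<dots> < 1 * (1 / 16) ^ k" using C by (intro mult_strict_right_mono) auto
    also have "\<dots> = ((1 / 4) ^ k)\<^sup>2" by (simp add: power_mult_distrib[symmetric] power2_eq_square)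
    finally show ?thesis by (rule power2_less_imp_less) simp
  qed
  have "\<exists>D. D \<in> sobolev_closure q S \<and> of_fun P' I D = U (Suc k) - U k \<and> sobolev_norm q D < (1 / 4) ^ k" for k
  proof -
    let ?X = "{sobolev_norm q f | f. f \<in> sobolev_closure q S \<and> of_fun P' I f = U (Suc k) - U k}"
    have "Inf ?X < (1 / 4) ^ k" using step[of k] q by (simp add: H_norm_def)
    moreover have "?X \<noteq> {}" using H_diff[OF U U, of "Suc k" k] q by (auto simp: H_space_def)
    ultimately have "\<exists>x\<in>?X. x < (1 / 4) ^ k" by (intro cInf_lessD)
    then show ?thesis by auto
  qed
  then obtain D where D: "\<And>k. D k \<in> sobolev_closure q S" "\<And>k. of_fun P' I (D k) = U (Suc k) - U k"
    "\<And>k. sobolev_norm q (D k) < (1 / 4) ^ k" by metis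
  obtain g where g: "g \<in> sobolev_closure q S" "(\<lambda>n. l2_norm (g - (\<lambda>x. \<Sum>k<n. D k x))) \<longlonglongrightarrow> 0"
    using sobolev_closure_complete[OF subspace_fin_span S_sobolev[OF q] D(1,3)] .
  obtain f0 where f0: "f0 \<in> sobolev_closure q S" "of_fun P' I f0 = U 0"
    using U[of 0] q by (auto simp: H_space_def)
  have L2: "g \<in> L2" "f0 \<in> L2" "\<And>k. D k \<in> L2"
    using g(1) f0(1) D(1) by (auto simp: sobolev_closure_def sobolev_def)
  define f where "f = (\<lambda>x. f0 x + 1 * g x)"
  have f: "f \<in> sobolev_closure q S" unfolding f_def by (rule sobolev_closure_add[OF subspace_fin_span f0(1) g(1)])
  have "of_fun P' I f = u"
  proof (rule functional_eqI[OF of_fun_functional u])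
    show "f \<in> L2" using f by (auto simp: sobolev_closure_def sobolev_def)
    fix l assume l: "l \<in> I"
    let ?p = "\<lambda>n x. \<Sum>k<n. D k x"
    have p: "?p n \<in> L2" "l2_inner (P' l) (?p n) = (\<Sum>k<n. l2_inner (P' l) (D k))" for n
      using l2_inner_sum_lessThan[OF P'[OF l], of D n] L2 by auto
    have "l2_inner (P' l) (?p n) = U n (P' l) - U 0 (P' l)" for n
    proof -
      have "l2_inner (P' l) (D k) = U (Suc k) (P' l) - U k (P' l)" for k
        using fun_cong[OF D(2)[of k], of "P' l"] of_fun_P'[OF l, of "D k"] by simp
      then show ?thesis unfolding p by (simp add: sum_lessThan_telescope[of "\<lambda>k. U k (P' l)"])
    qed
    then have eq: "l2_inner (P' l) (g - ?p n) = of_fun P' I f (P' l) - U n (P' l)" for n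
      using l2_inner_diff[OF P'[OF l] L2(1) p(1)[of n]] l2_inner_linear[OF P'[OF l] L2(2,1), of 1 1]
        f0(2) of_fun_P'[OF l, of f0] of_fun_P'[OF l, of f] by (simp add: f_def)
    have "(\<lambda>n. of_fun P' I f (P' l) - U n (P' l)) \<longlonglongrightarrow> 0"
    proof (rule tendsto_norm_zero_cancel, rule tendsto_sandwich[OF _ _ tendsto_const])
      show "\<forall>\<^sub>F n in sequentially. norm (of_fun P' I f (P' l) - U n (P' l)) \<le> l2_norm (P' l) * l2_norm (g - ?p n)"
        unfolding eq[symmetric]
        by (intro always_eventually allI l2_Cauchy_Schwarz P'[OF l] L2_diff L2 p)
      show "(\<lambda>n. l2_norm (P' l) * l2_norm (g - ?p n)) \<longlonglongrightarrow> 0" using g(2) by (rule tendsto_mult_right_zero)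
    qed simp
    moreover have "(\<lambda>n. U n (P' l) - u (P' l)) \<longlonglongrightarrow> 0"
    proof (rule tendsto_norm_zero_cancel, rule tendsto_sandwich[OF _ _ tendsto_const])
      show "\<forall>\<^sub>F n in sequentially. norm (U n (P' l) - u (P' l)) \<le> sqrt (1 / (2 * C + 1)) / w l * (1 / 4) ^ n"
      proof (intro always_eventually allI)
        fix n
        have "w l * norm (U n (P' l) - u (P' l)) \<le> sqrt (\<epsilon> n)" using point[OF l, of n] by (rule real_le_rsqrt)
        also have "sqrt (\<epsilon> n) = sqrt (1 / (2 * C + 1) * ((1 / 4) ^ n)\<^sup>2)"
          by (simp add: \<epsilon>_def power_mult_distrib[symmetric] power2_eq_square)
        also have "\<dots> = sqrt (1 / (2 * C + 1)) * (1 / 4) ^ n" unfolding real_sqrt_mult by simp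
        finally show "norm (U n (P' l) - u (P' l)) \<le> sqrt (1 / (2 * C + 1)) / w l * (1 / 4) ^ n"
          using w[OF l] by (simp add: pos_le_divide_eq mult.commute)
      qed
      show "(\<lambda>n. sqrt (1 / (2 * C + 1)) / w l * (1 / 4) ^ n) \<longlonglongrightarrow> 0"
        by (intro tendsto_mult_right_zero LIMSEQ_power_zero) simp
    qed simp
    ultimately have "(\<lambda>n. (of_fun P' I f (P' l) - U n (P' l)) + (U n (P' l) - u (P' l))) \<longlonglongrightarrow> 0 + 0"
      by (rule tendsto_add)
    then show "of_fun P' I f (P' l) = u (P' l)" by (simp add: LIMSEQ_const_iff)
  qed
  then show ?thesis using f q by (auto simp: H_space_def)
qed

lemma in_H:
  assumes "u \<in> functionals P' I" "(\<lambda>l. (w l * norm (u (P' l)))\<^sup>2) summable_on I"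
  shows "u \<in> H"
  using in_H_nonneg in_H_negative assms by (cases "0 \<le> q") auto

end

section \<open>Tensor-product wavelets and hybrid Besov spaces\<close>

lemma L2_span_basis: "b i \<in> L2 \<Longrightarrow> i \<in> J \<Longrightarrow> b i \<in> L2_span b J"
  unfolding L2_span_def using basis_in_fin_span[of i J b] by auto

lemma L2_span_zero: "(\<lambda>x. 0) \<in> L2_span b J"
proof -
  have "(\<lambda>x. 0) \<in> fin_span b J" using subspace_fin_span[of b J] by (simp add: linear_subspace_def)
  then show ?thesis by (auto simp: L2_span_def L2_zero)
qed

lemma wavelet_index_sets:
  assumes "wavelet_mra j0 \<Delta> \<Lambda> \<phi> \<psi>" "j0 \<le> j"
  shows "finite (\<Lambda> j)" "\<Lambda> j \<subseteq> {j} \<times> UNIV"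
proof -
  note d = assms(1)[unfolded wavelet_mra_def]
  have "\<forall>j\<ge>j0. finite (\<Lambda> j) \<and> \<Lambda> j \<subseteq> {j} \<times> UNIV \<and> (\<forall>l\<in>\<Lambda> j. \<psi> l \<in> L2)"
    using d by (elim conjE)
  then show "finite (\<Lambda> j)" "\<Lambda> j \<subseteq> {j} \<times> UNIV" using assms(2) by auto
qed

lemma wavelet_in_L2_span:
  assumes mra: "wavelet_mra j0 \<Delta> \<Lambda> \<phi> \<psi>" and j: "j0 \<le> j" and m: "m \<in> \<Lambda> j"
  shows "\<psi> m \<in> L2" "\<psi> m \<in> L2_span \<phi> (\<Delta> j)"
proof -
  note d = mra[unfolded wavelet_mra_def]
  have "\<forall>j\<ge>j0. finite (\<Lambda> j) \<and> \<Lambda> j \<subseteq> {j} \<times> UNIV \<and> (\<forall>l\<in>\<Lambda> j. \<psi> l \<in> L2)"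
    using d by (elim conjE)
  then show L2: "\<psi> m \<in> L2" using j m by blast
  have base1: "\<Lambda> j0 = \<Delta> j0" using d by (elim conjE)
  have base2: "\<forall>l\<in>\<Lambda> j0. \<psi> l = \<phi> l" using d by (elim conjE)
  have sum: "\<forall>j>j0. L2_span \<phi> (\<Delta> j) =
          {\<lambda>x. f x + g x | f g. f \<in> L2_span \<phi> (\<Delta> (j - 1)) \<and> g \<in> L2_span \<psi> (\<Lambda> j)} \<and>
        (\<forall>f \<in> L2_span \<phi> (\<Delta> (j - 1)) \<inter> L2_span \<psi> (\<Lambda> j). AE x in cube. f x = 0)"
    using d by (elim conjE)
  show "\<psi> m \<in> L2_span \<phi> (\<Delta> j)"
  proof (cases "j = j0")
    case True
    then have "m \<in> \<Delta> j" "\<psi> m = \<phi> m" using base1 base2 m by auto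
    then show ?thesis using L2_span_basis[of \<phi> m "\<Delta> j"] L2 by simp
  next
    case False
    then have "j0 < j" using j by simp
    note eq = sum[THEN spec, THEN mp, OF this, THEN conjunct1]
    show ?thesis
      unfolding eq
    proof (intro CollectI exI conjI)
      show "\<psi> m = (\<lambda>x. 0 + \<psi> m x)" by simp
      show "(\<lambda>x. 0) \<in> L2_span \<phi> (\<Delta> (j - 1))" by (rule L2_span_zero)
      show "\<psi> m \<in> L2_span \<psi> (\<Lambda> j)" by (rule L2_span_basis[of \<psi>, OF L2 m])
    qed
  qed
qed

text \<open>Each wavelet lies in some \<open>V\<^sub>j\<close>, which by the definition of regularity consists of smoother functions.\<close>

lemma wavelet_in_sobolev:
  assumes mra: "wavelet_mra j0 \<Delta> \<Lambda> \<phi> \<psi>" and j: "j0 \<le> j" and m: "m \<in> \<Lambda> j"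
    and q: "ereal q < regularity j0 \<Delta> \<phi>"
  shows "\<psi> m \<in> sobolev q"
proof -
  obtain t where t: "q < t" "\<forall>j\<ge>j0. L2_span \<phi> (\<Delta> j) \<subseteq> sobolev t"
    using q unfolding regularity_def less_Sup_iff by auto
  then show ?thesis using wavelet_in_L2_span(2)[OF mra j m] sobolev_mono[of q t] j by auto
qed

lemma tensor_idx_iff:
  assumes "\<And>j. j0 \<le> j \<Longrightarrow> \<Lambda> j \<subseteq> {j} \<times> UNIV"
  shows "l \<in> tensor_idx j0 \<Lambda> \<longleftrightarrow> (\<forall>i. j0 \<le> fst (l i) \<and> l i \<in> \<Lambda> (fst (l i)))"
proof
  assume "l \<in> tensor_idx j0 \<Lambda>"
  then obtain j where j: "\<And>i. j0 \<le> j i" "\<And>i. l i \<in> \<Lambda> (j i)"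
    by (auto simp: tensor_idx_def levels_def tensor_idx_at_def)
  have "l i \<in> {j i} \<times> UNIV" for i using assms[OF j(1)] j(2) by blast
  then have "fst (l i) = j i" for i by (auto simp: mem_Times_iff)
  then show "\<forall>i. j0 \<le> fst (l i) \<and> l i \<in> \<Lambda> (fst (l i))" using j by simp
next
  assume "\<forall>i. j0 \<le> fst (l i) \<and> l i \<in> \<Lambda> (fst (l i))"
  then show "l \<in> tensor_idx j0 \<Lambda>"
    unfolding tensor_idx_def levels_def tensor_idx_at_def by (auto intro!: exI[of _ "\<lambda>i. fst (l i)"])
qed

lemma level_tensor_idx_at:
  assumes "\<And>j. j0 \<le> j \<Longrightarrow> \<Lambda> j \<subseteq> {j} \<times> UNIV" "j \<in> levels j0" "l \<in> tensor_idx_at \<Lambda> j"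
  shows "level l = j"
proof
  fix i
  have "j0 \<le> j i" "l i \<in> \<Lambda> (j i)" using assms(2,3) by (auto simp: levels_def tensor_idx_at_def)
  then have "l i \<in> {j i} \<times> UNIV" using assms(1) by blast
  then show "level l i = j i" by (auto simp: level_def mem_Times_iff)
qed

lemma finite_tensor_idx_at:
  assumes "\<And>j. j0 \<le> j \<Longrightarrow> finite (\<Lambda> j)" "j \<in> levels j0"
  shows "finite (tensor_idx_at \<Lambda> (j :: 'n::finite \<Rightarrow> int))"
proof -
  have "tensor_idx_at \<Lambda> j = (\<Pi>\<^sub>E i\<in>UNIV. \<Lambda> (j i))" by (auto simp: tensor_idx_at_def PiE_def Pi_def)
  then show ?thesis using assms by (auto simp: levels_def intro!: finite_PiE)
qed

text \<open>Grouping by levels: the sum over levels in the Besov norm is a sum over all wavelet indices.\<close>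

lemma
  fixes f :: "'i \<Rightarrow> real"
  assumes fin: "\<And>j. j \<in> J \<Longrightarrow> finite (T j)" and disj: "disjoint_family_on T J" and f: "\<And>l. 0 \<le> f l"
  shows summable_on_blocks: "(\<lambda>j. \<Sum>l\<in>T j. f l) summable_on J \<longleftrightarrow> f summable_on (\<Union>j\<in>J. T j)"
    and infsum_blocks: "f summable_on (\<Union>j\<in>J. T j) \<Longrightarrow>
      (\<Sum>\<^sub>\<infinity>j\<in>J. \<Sum>l\<in>T j. f l) = (\<Sum>\<^sub>\<infinity>l\<in>(\<Union>j\<in>J. T j). f l)"
proof -
  have hs: "(f has_sum (\<Sum>l\<in>T j. f l)) (T j)" if "j \<in> J" for j using fin[OF that] by simp
  show "(\<lambda>j. \<Sum>l\<in>T j. f l) summable_on J \<longleftrightarrow> f summable_on (\<Union>j\<in>J. T j)"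
    by (rule summable_on_Union_iff[OF hs f disj, symmetric])
  assume "f summable_on (\<Union>j\<in>J. T j)"
  then have "(f has_sum infsum f (\<Union>j\<in>J. T j)) (\<Union>j\<in>J. T j)" by simp
  also have "(\<Union>j\<in>J. T j) = snd ` Sigma J T" by force
  finally have "(f \<circ> snd has_sum infsum f (snd ` Sigma J T)) (Sigma J T)"
    using disj by (subst (asm) has_sum_reindex) (auto simp: inj_on_def disjoint_family_on_def)
  then have "((\<lambda>j. \<Sum>l\<in>T j. f l) has_sum infsum f (snd ` Sigma J T)) J"
    by (rule has_sum_SigmaD) (simp add: hs)
  then show "(\<Sum>\<^sub>\<infinity>j\<in>J. \<Sum>l\<in>T j. f l) = (\<Sum>\<^sub>\<infinity>l\<in>(\<Union>j\<in>J. T j). f l)"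
    using \<open>(\<Union>j\<in>J. T j) = snd ` Sigma J T\<close> by (simp add: infsumI)
qed

text \<open>The exponents cancel: \<open>\<tau> r |j|\<^sub>1\<close> from the weight against \<open>\<tau> (1/2 - 1/\<tau>) |j|\<^sub>1 = - \<tau> r |j|\<^sub>1\<close> from the
  normalisation of the coefficients.\<close>

lemma besov_term_eq:
  assumes \<tau>: "1 / \<tau> = r + 1 / 2" "0 < \<tau>" and lev: "\<And>l. l \<in> tensor_idx_at \<Lambda> j \<Longrightarrow> level l = j"
  shows "besov_term \<Lambda> P' q r \<tau> \<tau> u j =
    (\<Sum>l\<in>tensor_idx_at \<Lambda> j. (2 powr (q * abs_inf (level l)) * norm (u (P' l))) powr \<tau>)"
proof -
  have e: "1 / 2 - 1 / \<tau> = - r" using \<tau> by simp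
  have "besov_term \<Lambda> P' q r \<tau> \<tau> u j = 2 powr (\<tau> * (q * abs_inf j + r * abs_1 j)) *
     (\<Sum>l\<in>tensor_idx_at \<Lambda> j. (2 powr (abs_1 (level l) * (- r)) * norm (u (P' l))) powr \<tau>)"
    unfolding besov_term_def e using \<tau> by (simp add: sum_nonneg)
  also have "\<dots> = (\<Sum>l\<in>tensor_idx_at \<Lambda> j. (2 powr (q * abs_inf (level l)) * norm (u (P' l))) powr \<tau>)"
    unfolding sum_distrib_left
  proof (rule sum.cong[OF refl])
    fix l assume "l \<in> tensor_idx_at \<Lambda> j"
    then have l: "level l = j" by (rule lev)
    have "2 powr (\<tau> * (q * abs_inf j + r * abs_1 j)) * (2 powr (abs_1 j * (- r))) powr \<tau> =
        (2 powr (q * abs_inf j)) powr \<tau>"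
      by (simp add: powr_powr powr_add[symmetric] algebra_simps)
    then show "2 powr (\<tau> * (q * abs_inf j + r * abs_1 j)) * (2 powr (abs_1 (level l) * (- r)) * norm (u (P' l))) powr \<tau> =
       (2 powr (q * abs_inf (level l)) * norm (u (P' l))) powr \<tau>"
      unfolding l by (simp only: powr_mult powr_ge_zero norm_ge_zero mult.assoc[symmetric])
  qed
  finally show ?thesis .
qed

lemma
  fixes \<Lambda> :: "int \<Rightarrow> (int \<times> 'k) set" and P' :: "('n::finite \<Rightarrow> int \<times> 'k) \<Rightarrow> real ^ 'n \<Rightarrow> complex"
  assumes \<tau>: "1 / \<tau> = r + 1 / 2" "0 < \<tau>"
    and \<Lambda>: "\<And>j. j0 \<le> j \<Longrightarrow> finite (\<Lambda> j)" "\<And>j. j0 \<le> j \<Longrightarrow> \<Lambda> j \<subseteq> {j} \<times> UNIV"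
  defines "I \<equiv> tensor_idx j0 \<Lambda>"
  shows besov_space_iff: "u \<in> besov_space j0 \<Lambda> P' q r \<tau> \<tau> \<longleftrightarrow> u \<in> functionals P' I \<and>
      (\<lambda>l. (2 powr (q * abs_inf (level l)) * norm (u (P' l))) powr \<tau>) summable_on I"
    and besov_norm_eq: "u \<in> besov_space j0 \<Lambda> P' q r \<tau> \<tau> \<Longrightarrow> besov_norm j0 \<Lambda> P' q r \<tau> \<tau> u =
      (\<Sum>\<^sub>\<infinity>l\<in>I. (2 powr (q * abs_inf (level l)) * norm (u (P' l))) powr \<tau>) powr (1 / \<tau>)"
proof -
  let ?f = "\<lambda>u l. (2 powr (q * abs_inf (level l)) * norm (u (P' l))) powr \<tau>"
  have lev: "level l = j" if "j \<in> levels j0" "l \<in> tensor_idx_at \<Lambda> j" for j l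
    by (rule level_tensor_idx_at[OF \<Lambda>(2) that])
  have eq: "besov_term \<Lambda> P' q r \<tau> \<tau> u j = (\<Sum>l\<in>tensor_idx_at \<Lambda> j. ?f u l)" if "j \<in> levels j0" for u j
    by (rule besov_term_eq[OF \<tau> lev[OF that]])
  have fin: "finite (tensor_idx_at \<Lambda> j)" if "j \<in> levels j0" for j :: "'n \<Rightarrow> int"
    by (rule finite_tensor_idx_at[OF \<Lambda>(1) that])
  have disj: "disjoint_family_on (tensor_idx_at \<Lambda>) (levels j0 :: ('n \<Rightarrow> int) set)"
    unfolding disjoint_family_on_def
  proof (intro ballI impI)
    fix i j :: "'n \<Rightarrow> int" assume "i \<in> levels j0" "j \<in> levels j0" "i \<noteq> j"
    then show "tensor_idx_at \<Lambda> i \<inter> tensor_idx_at \<Lambda> j = {}"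
      using lev[of i] lev[of j] by (metis disjoint_iff)
  qed
  have I: "I = (\<Union>j\<in>levels j0. tensor_idx_at \<Lambda> j)" by (simp add: I_def tensor_idx_def)
  show iff: "u \<in> besov_space j0 \<Lambda> P' q r \<tau> \<tau> \<longleftrightarrow> u \<in> functionals P' I \<and> ?f u summable_on I" for u
  proof -
    have "besov_term \<Lambda> P' q r \<tau> \<tau> u summable_on levels j0 \<longleftrightarrow>
        (\<lambda>j. \<Sum>l\<in>tensor_idx_at \<Lambda> j. ?f u l) summable_on levels j0"
      by (rule summable_on_cong) (rule eq)
    also have "\<dots> \<longleftrightarrow> ?f u summable_on I" unfolding I by (rule summable_on_blocks[OF fin disj]) simp_all
    finally show ?thesis by (simp add: besov_space_def I_def)
  qed
  assume u: "u \<in> besov_space j0 \<Lambda> P' q r \<tau> \<tau>"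
  have "(\<Sum>\<^sub>\<infinity>j\<in>levels j0. besov_term \<Lambda> P' q r \<tau> \<tau> u j) = (\<Sum>\<^sub>\<infinity>j\<in>levels j0. \<Sum>l\<in>tensor_idx_at \<Lambda> j. ?f u l)"
    by (rule infsum_cong) (rule eq)
  also have "\<dots> = (\<Sum>\<^sub>\<infinity>l\<in>I. ?f u l)"
    using u iff[of u] unfolding I
    by (intro infsum_blocks[OF fin disj]) simp_all
  finally show "besov_norm j0 \<Lambda> P' q r \<tau> \<tau> u = (\<Sum>\<^sub>\<infinity>l\<in>I. ?f u l) powr (1 / \<tau>)"
    by (simp add: besov_norm_def)
qed

text \<open>The embedding of \<open>\<ell>\<^sup>\<tau>\<close> into \<open>\<ell>\<^sup>2\<close>: the entries are bounded, so \<open>x\<^sup>2\<close> is at most a multiple of \<open>x\<^sup>\<tau>\<close>.\<close>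

lemma summable_on_square:
  fixes x :: "'i \<Rightarrow> real"
  assumes sm: "(\<lambda>l. x l powr \<tau>) summable_on I" and \<tau>: "0 < \<tau>" "\<tau> \<le> 2" and x: "\<And>l. l \<in> I \<Longrightarrow> 0 \<le> x l"
  shows "(\<lambda>l. (x l)\<^sup>2) summable_on I"
proof -
  define S where "S = (\<Sum>\<^sub>\<infinity>l\<in>I. x l powr \<tau>)"
  have le: "x l \<le> S powr (1 / \<tau>)" if l: "l \<in> I" for l
  proof -
    have "x l powr \<tau> \<le> S" using finite_sum_le_infsum[OF sm, of "{l}"] l by (simp add: S_def)
    then have "(x l powr \<tau>) powr (1 / \<tau>) \<le> S powr (1 / \<tau>)" using \<tau> by (intro powr_mono2) auto
    then show ?thesis using x[OF l] \<tau> by (simp add: powr_powr)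
  qed
  have "(x l)\<^sup>2 \<le> (S powr (1 / \<tau>)) powr (2 - \<tau>) * x l powr \<tau>" if l: "l \<in> I" for l
  proof (cases "x l = 0")
    case False
    then have "(x l)\<^sup>2 = x l powr (2 - \<tau>) * x l powr \<tau>" using x[OF l] by (simp add: powr_add[symmetric])
    also have "\<dots> \<le> (S powr (1 / \<tau>)) powr (2 - \<tau>) * x l powr \<tau>"
      using le[OF l] x[OF l] \<tau> by (intro mult_right_mono powr_mono2) auto
    finally show ?thesis .
  qed simp
  then show ?thesis
    by (intro summable_on_comparison_test[OF summable_on_cmult_right[OF sm, of "(S powr (1 / \<tau>)) powr (2 - \<tau>)"]]) auto
qed

context biorthogonal_system
begin

lemma n_term_card: "M \<le> N \<Longrightarrow> n_term P P' I M \<subseteq> n_term P P' I N"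
  unfolding n_term_def by force

lemma seq_model:
  assumes r: "0 < r" and \<tau>: "1 / \<tau> = r + 1 / 2"
    and W: "\<And>u. u \<in> W \<longleftrightarrow> u \<in> functionals P' I \<and> (\<lambda>l. (w l * norm (u (P' l))) powr \<tau>) summable_on I"
    and nW: "\<And>u. u \<in> W \<Longrightarrow> nW u = (\<Sum>\<^sub>\<infinity>l\<in>I. (w l * norm (u (P' l))) powr \<tau>) powr (1 / \<tau>)"
  shows "seq_model H H_nrm W nW (n_term P P' I) I (\<lambda>u l. of_real (w l) * u (P' l)) \<tau> r c C"
proof -
  have nrm: "norm (of_real (w l) * u (P' l)) = w l * norm (u (P' l))" if "l \<in> I" for u :: "'a functional" and l
    using w[OF that] by (simp add: norm_mult)
  have sq_cong: "(\<lambda>l. (norm (of_real (w l) * u (P' l)))\<^sup>2) summable_on I \<longleftrightarrow> (\<lambda>l. (w l * norm (u (P' l)))\<^sup>2) summable_on I"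
    "(\<Sum>\<^sub>\<infinity>l\<in>I. (norm (of_real (w l) * u (P' l)))\<^sup>2) = (\<Sum>\<^sub>\<infinity>l\<in>I. (w l * norm (u (P' l)))\<^sup>2)"
    "(\<lambda>l. norm (of_real (w l) * u (P' l)) powr \<tau>) summable_on I \<longleftrightarrow> (\<lambda>l. (w l * norm (u (P' l))) powr \<tau>) summable_on I"
    "(\<Sum>\<^sub>\<infinity>l\<in>I. norm (of_real (w l) * u (P' l)) powr \<tau>) = (\<Sum>\<^sub>\<infinity>l\<in>I. (w l * norm (u (P' l))) powr \<tau>)" for u :: "'a functional"
    by (auto intro!: summable_on_cong infsum_cong simp: nrm)
  have \<tau>0: "0 < \<tau>" by (rule summability_exponent[OF \<tau> r])
  have \<tau>2: "\<tau> \<le> 2" using summability_exponent(2)[OF \<tau> r] by simp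
  show ?thesis
  proof (unfold_locales, unfold sq_cong)
    show "W \<subseteq> H"
    proof
      fix u assume "u \<in> W"
      then have u: "u \<in> functionals P' I" "(\<lambda>l. (w l * norm (u (P' l))) powr \<tau>) summable_on I" using W by auto
      then show "u \<in> H" using w by (intro in_H summable_on_square[OF _ \<tau>0 \<tau>2]) (auto simp: less_imp_le)
    qed
    fix N
    show "n_term P P' I N \<subseteq> W"
    proof
      fix v assume "v \<in> n_term P P' I N"
      then obtain F a where F: "finite F" "F \<subseteq> I" "v = of_fun P' I (lincomb P F a)" by (auto simp: n_term_def)
      have "(\<lambda>l. (w l * norm (v (P' l))) powr \<tau>) summable_on F" using F by simp
      then have "(\<lambda>l. (w l * norm (v (P' l))) powr \<tau>) summable_on I"
        by (rule summable_on_cong_neutral[THEN iffD1, rotated -1]) (use F in \<open>auto simp: coeff_lincomb\<close>)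
      then show "v \<in> W" using F by (simp add: W of_fun_functional lincomb_L2)
    qed
    show "\<exists>F. finite F \<and> F \<subseteq> I \<and> card F \<le> N \<and> (\<forall>l\<in>I - F. of_real (w l) * v (P' l) = 0)"
      if "v \<in> n_term P P' I N" for v
    proof -
      obtain F a where F: "finite F" "F \<subseteq> I" "card F \<le> N" "v = of_fun P' I (lincomb P F a)"
        using \<open>v \<in> n_term P P' I N\<close> by (auto simp: n_term_def)
      then show ?thesis by (intro exI[of _ F]) (auto simp: coeff_lincomb)
    qed
    show "\<exists>v\<in>n_term P P' I N. (\<forall>l\<in>F. of_real (w l) * v (P' l) = b l) \<and> (\<forall>l\<in>I - F. of_real (w l) * v (P' l) = 0)"
      if F: "finite F" "F \<subseteq> I" "card F \<le> N" for F b
    proof (rule bexI)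
      let ?v = "of_fun P' I (lincomb P F (\<lambda>l. b l / of_real (w l)))"
      show "?v \<in> n_term P P' I N" using F by (auto simp: n_term_def)
      show "(\<forall>l\<in>F. of_real (w l) * ?v (P' l) = b l) \<and> (\<forall>l\<in>I - F. of_real (w l) * ?v (P' l) = 0)"
        using F w by (auto simp: coeff_lincomb subset_iff dest!: w)
    qed
  qed (use r \<tau> c C H_diff H_norm_nonneg weighted_summable H_norm_lower H_norm_upper W nW n_term_card
      in \<open>auto simp: algebra_simps\<close>)
qed

end

theorem theorem4p3:
  fixes j\<^sub>0 :: int
    and \<Delta> \<Lambda> :: "int \<Rightarrow> (int \<times> 'k) set"
    and \<phi> \<psi> \<phi>' \<psi>' :: "int \<times> 'k \<Rightarrow> real \<Rightarrow> complex"
    and P P' :: "('n::finite \<Rightarrow> int \<times> 'k) \<Rightarrow> real ^ 'n \<Rightarrow> complex"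
    and I :: "('n \<Rightarrow> int \<times> 'k) set"
    and q r s \<tau> :: real and \<kappa> :: ereal
  defines "P \<equiv> tensor \<psi>" and "P' \<equiv> tensor \<psi>'" and "I \<equiv> tensor_idx j\<^sub>0 \<Lambda>"
  assumes wavelets: "biorthogonal_wavelets j\<^sub>0 \<Delta> \<Lambda> \<phi> \<psi> \<phi>' \<psi>'"
    and dual_regularity: "0 < regularity j\<^sub>0 \<Delta> \<phi>'"
    and norm_equiv: "norm_equivalence P P' I q"
    and r: "0 < r"
    and q: "- regularity j\<^sub>0 \<Delta> \<phi>' < ereal q" "ereal q < regularity j\<^sub>0 \<Delta> \<phi>"
    and \<tau>: "1 / \<tau> = r + 1 / 2"
    and s: "0 < s" "s < r"
    and \<kappa>: "0 < \<kappa>"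
  shows "approx_space (H_space P P' I q) (H_norm P P' I q) (n_term P P' I) s \<kappa> =
         interp_space (H_space P P' I q) (H_norm P P' I q)
           (besov_space j\<^sub>0 \<Lambda> P' q r \<tau> \<tau>) (besov_norm j\<^sub>0 \<Lambda> P' q r \<tau> \<tau>) (s / r) \<kappa>"
proof -
  have mra: "wavelet_mra j\<^sub>0 \<Delta> \<Lambda> \<phi> \<psi>" and mra': "wavelet_mra j\<^sub>0 \<Delta> \<Lambda> \<phi>' \<psi>'"
    and biorth: "\<And>l l'. l \<in> (\<Union>j\<in>{j\<^sub>0..}. \<Lambda> j) \<Longrightarrow> l' \<in> (\<Union>j\<in>{j\<^sub>0..}. \<Lambda> j) \<Longrightarrow>
        l2_inner (\<psi>' l') (\<psi> l) = (if l' = l then 1 else 0)"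
    using wavelets unfolding biorthogonal_wavelets_def by blast+
  have \<Lambda>: "\<And>j. j\<^sub>0 \<le> j \<Longrightarrow> finite (\<Lambda> j)" "\<And>j. j\<^sub>0 \<le> j \<Longrightarrow> \<Lambda> j \<subseteq> {j} \<times> UNIV"
    by (fact wavelet_index_sets[OF mra])+
  have idx: "j\<^sub>0 \<le> fst (l i)" "l i \<in> \<Lambda> (fst (l i))" "l i \<in> (\<Union>j\<in>{j\<^sub>0..}. \<Lambda> j)" if "l \<in> I" for l i
  proof -
    have "\<forall>i. j\<^sub>0 \<le> fst (l i) \<and> l i \<in> \<Lambda> (fst (l i))"
      using that tensor_idx_iff[of j\<^sub>0 \<Lambda> l, OF \<Lambda>(2)] unfolding I_def by blast
    then show "j\<^sub>0 \<le> fst (l i)" "l i \<in> \<Lambda> (fst (l i))" "l i \<in> (\<Union>j\<in>{j\<^sub>0..}. \<Lambda> j)" by auto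
  qed
  have L2: "\<psi> (l i) \<in> L2" "\<psi>' (l i) \<in> L2" if "l \<in> I" for l i
    using wavelet_in_L2_span(1)[OF mra idx(1,2)[OF that]] wavelet_in_L2_span(1)[OF mra' idx(1,2)[OF that]] by auto
  define w where "w l = 2 powr (q * abs_inf (level l))" for l :: "'n \<Rightarrow> int \<times> 'k"
  \<comment> \<open>The weighted terms of the norm equivalence are the squares of the weighted coefficients.\<close>
  have w2: "2 powr (2 * q * abs_inf (level l)) * x\<^sup>2 = (w l * x)\<^sup>2" for l :: "'n \<Rightarrow> int \<times> 'k" and x :: real
    by (simp add: w_def power_mult_distrib power2_eq_square powr_add[symmetric] mult.assoc)
  obtain c C where cC: "0 < c" "0 < C" and equiv: "\<And>u. u \<in> H_space P P' I q \<Longrightarrow>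
        (\<lambda>l. (w l * norm (u (P' l)))\<^sup>2) summable_on I \<and>
        c * (\<Sum>\<^sub>\<infinity>l\<in>I. (w l * norm (u (P' l)))\<^sup>2) \<le> (H_norm P P' I q u)\<^sup>2 \<and>
        (H_norm P P' I q u)\<^sup>2 \<le> C * (\<Sum>\<^sub>\<infinity>l\<in>I. (w l * norm (u (P' l)))\<^sup>2)"
    using norm_equiv unfolding norm_equivalence_def w2 by blast
  have \<tau>0: "0 < \<tau>" by (rule summability_exponent[OF \<tau> r])
  interpret biorthogonal_system P P' I q w c C
  proof
    fix l assume l: "l \<in> I"
    show "P l \<in> L2" "P' l \<in> L2" unfolding P_def P'_def by (intro L2_tensor L2 l)+
    show "P l \<in> sobolev q" if "0 \<le> q"
      unfolding P_def by (intro sobolev_tensor that wavelet_in_sobolev[OF mra idx(1,2)[OF l] q(2)])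
    show "P' l \<in> sobolev (- q)" if "q < 0"
    proof -
      have "ereal (- q) < regularity j\<^sub>0 \<Delta> \<phi>'"
        using q(1) ereal_uminus_less_reorder[of "regularity j\<^sub>0 \<Delta> \<phi>'" "ereal q"] by simp
      then show ?thesis unfolding P'_def using that
        by (intro sobolev_tensor wavelet_in_sobolev[OF mra' idx(1,2)[OF l]]) auto
    qed
    fix l' assume l': "l' \<in> I"
    have "l2_inner (P' l') (P l) = (\<Prod>i\<in>UNIV. if l' i = l i then 1 else 0)"
      unfolding P_def P'_def using l2_inner_tensor[of \<psi> l \<psi>' l', OF L2(1)[OF l] L2(2)[OF l']]
      by (simp add: biorth[OF idx(3)[OF l] idx(3)[OF l']])
    also have "\<dots> = (if l' = l then 1 else 0)"
    proof (cases "l' = l")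
      case False
      then obtain i where "l' i \<noteq> l i" by auto
      then have "(\<Prod>i\<in>UNIV. if l' i = l i then 1 else 0 :: complex) = 0" by (intro prod_zero) auto
      then show ?thesis using False by simp
    qed simp
    finally show "l2_inner (P' l') (P l) = (if l' = l then 1 else 0)" .
  qed (use cC equiv in \<open>auto simp: w_def\<close>)
  have "seq_model (H_space P P' I q) (H_norm P P' I q) (besov_space j\<^sub>0 \<Lambda> P' q r \<tau> \<tau>) (besov_norm j\<^sub>0 \<Lambda> P' q r \<tau> \<tau>)
      (n_term P P' I) I (\<lambda>u l. of_real (w l) * u (P' l)) \<tau> r c C"
    unfolding w_def by (rule seq_model[unfolded w_def, OF r \<tau>])
      (use besov_space_iff[OF \<tau> \<tau>0 \<Lambda>] besov_norm_eq[OF \<tau> \<tau>0 \<Lambda>] in \<open>auto simp: I_def\<close>)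
  then show ?thesis by (rule seq_model.approx_space_eq_interp_space) (use \<kappa> s in auto)
qed

end
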